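(* Let $P\in\mathbb{K}[x]$ be a polynomial of uniqueness for ${\cal M}(\mathbb{K})$ such that $$P'(x)=b(x-a_1)^n\prod_{i=2}^l(x-a_i)^{k_i},$$ where $b\in\mathbb{K}^*$, $l\geq 2$, $a_1,\dots,a_l\in\mathbb{K}$ are pairwise distinct, $n,k_2,\dots,k_l$ are positive integers with $k_i\geq k_{i+1}$ for $2\leq i\leq l-1$, and let $k=\sum_{i=2}^l k_i$. Suppose that: (i) $n\geq 10+\sum_{i=3}^{l}\max(0,4-k_i)+\max(0,5-k_2)$; (ii) $n\geq k+2$; (iii) if $l=2$, then $n\neq 2k$, $n\neq 2k+1$, $n\neq 3k+1$; (iv) if $l=3$, then $n\neq 2k+1$ and $n\neq 3k_i-k$ for $i=2,3$. Let $f,g\in{\cal M}(\mathbb{K})$ be transcendental and let $\alpha\in{\cal M}(\mathbb{K})$ be non-identically zero and small with respect to both $f$ and $g$. If $f'P'(f)$ and $g'P'(g)$ share $\alpha$ C.M., then $f=g$.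
   Context: $\mathbb{K}$ is an algebraically closed field of characteristic zero, complete with respect to an ultrametric absolute value $|\cdot|$. ${\cal M}(\mathbb{K})$ is the field of meromorphic functions on $\mathbb{K}$, i.e. the field of fractions of the ring of entire functions (power series converging on all of $\mathbb{K}$). A function in ${\cal M}(\mathbb{K})$ is transcendental if it is not a rational function. For $h\in{\cal M}(\mathbb{K})$ and $\gamma\in\mathbb{K}$, $\omega_\gamma(h)$ is $m$ if $h$ has a zero of order $m$ at $\gamma$, $-m$ if $h$ has a pole of order $m$ at $\gamma$, and $0$ otherwise. For $h$ with no zero or pole at $0$ and $r>0$: $Z(r,h)=\sum_{\omega_\gamma(h)>0,\ |\gamma|\leq r}\omega_\gamma(h)(\log r-\log|\gamma|)$, $N(r,h)=Z(r,1/h)$, and $T(r,h)=\max\{Z(r,h)+\log|h(0)|,\ N(r,h)\}$. A function $\alpha\in{\cal M}(\mathbb{K})$ is small with respect to $f$ if $\lim_{r\to+\infty}T(r,\alpha)/T(r,f)=0$ (if $0$ is a zero or pole of $f$ or $\alpha$, one first translates the variable so that the origin is neither; the condition does not depend on this choice). Two meromorphic functions $F,G$ share $\alpha$ C.M. if $F-\alpha$ and $G-\alpha$ have the same zeroes with the same multiplicities. A polynomial $P$ is a polynomial of uniqueness for a class ${\cal F}$ of functions if for all $f,g\in{\cal F}$, $P(f)=P(g)$ implies $f=g$. *)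

theory Defs
  imports
    "HOL-Analysis.Analysis"
    "HOL-Computational_Algebra.Computational_Algebra"
begin

text \<open>
  The remaining axioms of an absolute value follow from those of the metric. The library's
  \<open>norm\<close> cannot be used: it is confined to real normed vector spaces, which are Archimedean.
\<close>

class complete_ultrametric_field = field + complete_space +
  fixes absv :: "'a \<Rightarrow> real"
  assumes dist_absv: "dist x y = absv (x - y)"
    and absv_mult: "absv (x * y) = absv x * absv y"
    and absv_add_le_max: "absv (x + y) \<le> max (absv x) (absv y)"

definition entire :: "'a::complete_ultrametric_field fps set" where
  "entire = {F. \<forall>x. summable (\<lambda>n. fps_nth F n * x ^ n)}"

definition ev :: "'a::complete_ultrametric_field fps \<Rightarrow> 'a \<Rightarrow> 'a" where
  "ev F x = (\<Sum>n. fps_nth F n * x ^ n)"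

text \<open>
  The field of fractions of the ring of entire functions, realised inside the field of
  formal Laurent series: a meromorphic function is identified with its Laurent expansion
  at 0. Under this identification \<open>fls_deriv\<close> is the usual derivative, and the constant
  coefficient of a function without pole at 0 is its value at 0.
\<close>

definition mero :: "'a::complete_ultrametric_field fls set" where
  "mero = {fps_to_fls F / fps_to_fls G | F G. F \<in> entire \<and> G \<in> entire \<and> G \<noteq> 0}"

definition rational_fun :: "'a::field fls \<Rightarrow> bool" where
  "rational_fun h \<longleftrightarrow>
     (\<exists>p q. q \<noteq> 0 \<and> h = fps_to_fls (fps_of_poly p) / fps_to_fls (fps_of_poly q))"

definition transcendental_mero :: "'a::complete_ultrametric_field fls \<Rightarrow> bool" where
  "transcendental_mero h \<longleftrightarrow> h \<in> mero \<and> \<not> rational_fun h"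

text \<open>
  For meromorphic \<open>h \<noteq> 0\<close>: the integer \<open>m\<close> such that \<open>h(x) = (x - \<gamma>)\<^sup>m F(x) / G(x)\<close> with
  \<open>F\<close>, \<open>G\<close> entire and non-zero at \<open>\<gamma>\<close>. It is positive at zeroes, negative at poles, and
  unspecified for \<open>h = 0\<close>.
\<close>

definition mero_order :: "'a::complete_ultrametric_field \<Rightarrow> 'a fls \<Rightarrow> int" where
  "mero_order \<gamma> h = (THE m. \<exists>F G. F \<in> entire \<and> G \<in> entire \<and> ev F \<gamma> \<noteq> 0 \<and> ev G \<gamma> \<noteq> 0 \<and>
     h = (fls_X - fls_const \<gamma>) powi m * fps_to_fls F / fps_to_fls G)"

definition zero_mult :: "'a::complete_ultrametric_field \<Rightarrow> 'a fls \<Rightarrow> enat" where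
  "zero_mult \<gamma> h = (if h = 0 then \<infinity> else enat (nat (mero_order \<gamma> h)))"

definition share_CM ::
  "'a::complete_ultrametric_field fls \<Rightarrow> 'a fls \<Rightarrow> 'a fls \<Rightarrow> bool" where
  "share_CM F G \<alpha> \<longleftrightarrow> (\<forall>\<gamma>. zero_mult \<gamma> (F - \<alpha>) = zero_mult \<gamma> (G - \<alpha>))"

text \<open>
  The functions \<open>Z\<close>, \<open>N\<close> and \<open>T\<close> are only meaningful for meromorphic \<open>h \<noteq> 0\<close> with neither
  zero nor pole at 0; the index set of the sum is then finite.
\<close>

definition Z_count :: "real \<Rightarrow> 'a::complete_ultrametric_field fls \<Rightarrow> real" where
  "Z_count r h = (\<Sum>\<gamma> | mero_order \<gamma> h > 0 \<and> absv \<gamma> \<le> r.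
     of_int (mero_order \<gamma> h) * (ln r - ln (absv \<gamma>)))"

definition N_count :: "real \<Rightarrow> 'a::complete_ultrametric_field fls \<Rightarrow> real" where
  "N_count r h = Z_count r (1 / h)"

definition T_char :: "real \<Rightarrow> 'a::complete_ultrametric_field fls \<Rightarrow> real" where
  "T_char r h = max (Z_count r h + ln (absv (fls_nth h 0))) (N_count r h)"

text \<open>The function \<open>x \<mapsto> h (x + c)\<close>.\<close>

definition translate ::
  "'a::complete_ultrametric_field \<Rightarrow> 'a fls \<Rightarrow> 'a fls" where
  "translate c h = (THE h'. \<exists>F G F' G'.
     F \<in> entire \<and> G \<in> entire \<and> F' \<in> entire \<and> G' \<in> entire \<and> G \<noteq> 0 \<and> G' \<noteq> 0 \<and>
     (\<forall>x. ev F' x = ev F (x + c)) \<and> (\<forall>x. ev G' x = ev G (x + c)) \<and>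
     h = fps_to_fls F / fps_to_fls G \<and> h' = fps_to_fls F' / fps_to_fls G')"

text \<open>
  The limit does not depend on the admissible centre \<open>c\<close>; \<open>c = 0\<close> is admissible unless 0 is
  a zero or pole of \<open>\<alpha>\<close> or \<open>f\<close>.
\<close>

definition small_wrt ::
  "'a::complete_ultrametric_field fls \<Rightarrow> 'a fls \<Rightarrow> bool" where
  "small_wrt \<alpha> f \<longleftrightarrow>
     (\<exists>c. mero_order 0 (translate c \<alpha>) = 0 \<and> mero_order 0 (translate c f) = 0 \<and>
          ((\<lambda>r. T_char r (translate c \<alpha>) / T_char r (translate c f)) \<longlongrightarrow> 0) at_top)"

definition poly_comp :: "'a::field poly \<Rightarrow> 'a fls \<Rightarrow> 'a fls" where
  "poly_comp P f = poly (map_poly fls_const P) f"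

definition uniqueness_poly :: "'a::field poly \<Rightarrow> 'a fls set \<Rightarrow> bool" where
  "uniqueness_poly P \<F> \<longleftrightarrow> (\<forall>f\<in>\<F>. \<forall>g\<in>\<F>. poly_comp P f = poly_comp P g \<longrightarrow> f = g)"

text \<open>
  Uniqueness polynomials are considered for non-constant functions: with constants admitted,
  no polynomial of degree at least 2 over an algebraically closed field of characteristic 0
  would qualify.
\<close>

definition nonconstant_mero :: "'a::complete_ultrametric_field fls set" where
  "nonconstant_mero = mero - range fls_const"

end

theory Submission
  imports Defs
begin

text \<open>
  The Gauss norms \<open>\<bar>\<Sum> a\<^sub>n x\<^sup>n\<bar>\<^sub>r = max \<bar>a\<^sub>n\<bar> r\<^sup>n\<close> extend to multiplicative norms on the meromorphic
  functions, \<open>\<bar>h'\<bar>\<^sub>r \<le> \<bar>h\<bar>\<^sub>r / r\<close>, and by Jensen's formula \<open>ln \<bar>h\<bar>\<^sub>r\<close> counts the zeroes and poles of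
  \<open>h\<close>. The second main theorem follows from these facts, with the error term \<open>- ln r + O(1)\<close>.

  Let \<open>F = f' P'(f) / \<alpha>\<close> and \<open>G = g' P'(g) / \<alpha>\<close>. They share the value 1, apart from the zeroes and poles
  of \<open>\<alpha>\<close>, so that \<open>\<psi> = F''/F' - 2 F'/(F - 1) - G''/G' + 2 G'/(G - 1)\<close> vanishes at the common simple
  1-points and has few poles. If \<open>\<psi> \<noteq> 0\<close>, counting its zeroes bounds the characteristics of \<open>F\<close> and
  \<open>G\<close> by the zeroes and poles of \<open>F\<close> and \<open>G\<close>, counted at most twice; since most zeroes and all poles of
  \<open>F\<close> and \<open>G\<close> are of high order, this contradicts (i). If \<open>\<psi> = 0\<close>, then \<open>F\<close> is a Moebius transform of
  \<open>G\<close>, and the same bound leaves only \<open>F = G\<close> and \<open>F G = 1\<close>. If \<open>F G = 1\<close>, then the zeroes of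
  \<open>f - a\<^sub>i\<close> are poles of \<open>g\<close>, and (ii), (iii), (iv) force them to have such a high multiplicity that
  the second main theorem fails. If \<open>F = G\<close>, then \<open>P(f) = P(g) + c\<close>, where \<open>c = 0\<close> by (ii).
\<close>

section \<open>Ultrametric absolute values\<close>

text \<open>The second main theorem is kept as the counting function of an exact divisor
  (\<open>smt_divisor\<close>), which retains the zeroes of \<open>f'\<close>. Every application is
  a local inequality between divisors, checked point by point and only then counted. For
  \<open>\<psi>\<close>, zeroes and poles need no separate count: its Gauss norm is at most
  \<open>1 / r\<close>, so by Jensen's formula its signed divisor has a counting function bounded
  above. Condition (i) is tailored to the inequality \<open>n + k \<ge> 4 * l + 7\<close>, the
  degree at which the characteristics outweigh the truncated zeroes and poles and the zeroes of the
  derivatives. The equalities excluded by (iii) and (iv) are the small solutions of the equation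
  between the order of a zero of \<open>f - a_i\<close> and that of the matching pole of
  \<open>g\<close>. The zeroes and poles of \<open>\<alpha>\<close> go into an error divisor, whose
  count is small. Bounded errors are harmless because the term \<open>- ln r\<close> also forces the
  characteristic of a non-constant function to grow. Algebraic closedness speaks of polynomials
  only, so Jensen's formula rests on a construction of zeroes of entire functions as limits of roots
  of truncations.\<close>

lemma absv_0 [simp]: "absv 0 = 0"
  using dist_absv[of 0 0] by simp

lemma absv_eq_0_iff [simp]: "absv x = 0 \<longleftrightarrow> x = 0"
  using dist_absv[of x 0] by (metis diff_zero dist_eq_0_iff)

lemma absv_nonneg [simp]: "0 \<le> absv x"
  using dist_absv[of x 0] by (metis diff_zero zero_le_dist)

lemma absv_pos_iff [simp]: "0 < absv x \<longleftrightarrow> x \<noteq> 0"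
  using absv_nonneg[of x] absv_eq_0_iff[of x] by linarith

lemma absv_1 [simp]: "absv 1 = 1"
  using absv_mult[of 1 1] by simp

lemma absv_diff_commute: "absv (x - y) = absv (y - x)"
  using dist_absv[of x y] dist_absv[of y x] by (simp add: dist_commute)

lemma absv_minus [simp]: "absv (- x) = absv x"
  using absv_diff_commute[of 0 x] by simp

lemma absv_diff_le_max: "absv (x - y) \<le> max (absv x) (absv y)"
  using absv_add_le_max[of x "- y"] by simp

lemma absv_power [simp]: "absv (x ^ n) = absv x ^ n"
  by (induction n) (simp_all add: absv_mult)

lemma absv_inverse [simp]: "absv (inverse x) = inverse (absv x)"
proof (cases "x = 0")
  case False
  then show ?thesis
    using absv_mult[of x "inverse x"] by (simp add: field_simps)
qed auto

text \<open>The isosceles principle: a strictly larger summand cannot be cancelled. All arguments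
  with dominant terms go back to it.\<close>

lemma absv_add_eq_left: "absv y < absv x \<Longrightarrow> absv (x + y) = absv x"
  using absv_add_le_max[of x y] absv_diff_le_max[of "x + y" y] by auto

lemma absv_diff_eq_left: "absv y < absv x \<Longrightarrow> absv (x - y) = absv x"
  using absv_add_eq_left[of "- y" x] by simp

lemma absv_sum_le:
  assumes "\<And>i. i \<in> A \<Longrightarrow> absv (h i) \<le> B" "0 \<le> B"
  shows "absv (sum h A) \<le> B"
  using assms
proof (induction A rule: infinite_finite_induct)
  case (insert x F)
  then show ?case
    using absv_add_le_max[of "h x" "sum h F"] by fastforce
qed auto

lemma absv_sum_less:
  assumes "\<And>i. i \<in> A \<Longrightarrow> absv (h i) < B" "0 < B"
  shows "absv (sum h A) < B"
  using assms
proof (induction A rule: infinite_finite_induct)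
  case (insert x F)
  then show ?case
    using absv_add_le_max[of "h x" "sum h F"] by fastforce
qed auto

text \<open>The residue characteristic may be positive, so integers can have small absolute value
  even in characteristic zero. This upper bound is what controls derivatives, whose coefficients
  carry integer factors.\<close>

lemma absv_of_nat_le_1: "absv (of_nat n :: 'a::complete_ultrametric_field) \<le> 1"
proof (induction n)
  case (Suc n)
  then show ?case using absv_add_le_max[of 1 "of_nat n :: 'a"] by simp
qed auto

lemma tendsto_absv_iff: "(h \<longlongrightarrow> l) F \<longleftrightarrow> ((\<lambda>x. absv (h x - l)) \<longlongrightarrow> 0) F"
  unfolding dist_absv[symmetric] by (rule tendsto_dist_iff)

text \<open>A telescoping sum is no larger than its largest term. Consecutive differences therefore
  only have to tend to 0; nothing like summability is required.\<close>

lemma Cauchy_absvI: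
  fixes X :: "nat \<Rightarrow> 'a::complete_ultrametric_field"
  assumes "(\<lambda>n. absv (X (Suc n) - X n)) \<longlonglongrightarrow> 0"
  shows "Cauchy X"
proof (rule metric_CauchyI)
  fix e :: real assume "e > 0"
  then obtain N where N: "\<And>n. n \<ge> N \<Longrightarrow> absv (X (Suc n) - X n) < e"
    using order_tendstoD(2)[OF assms] by (auto simp: eventually_sequentially)
  have *: "absv (X n - X N) < e" if "n \<ge> N" for n
    using that
  proof (induction n rule: dec_induct)
    case (step n)
    then show ?case
      using N[of n] absv_add_le_max[of "X (Suc n) - X n" "X n - X N"] by simp
  qed (use \<open>e > 0\<close> in simp)
  have "dist (X m) (X n) < e" if "m \<ge> N" "n \<ge> N" for m n
    using *[OF that(1)] *[OF that(2)] absv_diff_le_max[of "X m - X N" "X n - X N"]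
    by (simp add: dist_absv)
  then show "\<exists>M. \<forall>m\<ge>M. \<forall>n\<ge>M. dist (X m) (X n) < e" by blast
qed

lemma summable_absvI:
  fixes u :: "nat \<Rightarrow> 'a::complete_ultrametric_field"
  assumes "(\<lambda>n. absv (u n)) \<longlonglongrightarrow> 0"
  shows "summable u"
proof -
  have "Cauchy (\<lambda>n. \<Sum>i<n. u i)"
    by (rule Cauchy_absvI) (use assms in simp)
  then have "convergent (\<lambda>n. \<Sum>i<n. u i)"
    by (rule Cauchy_convergent)
  then show ?thesis by (simp add: summable_iff_convergent)
qed

text \<open>Makes the library's rules on limits and series of sums and differences available.
  Multiples of series are treated by \<open>sums_cmult_absv\<close>.\<close>

instance complete_ultrametric_field \<subseteq> topological_ab_group_add
proof
  fix a b :: 'a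
  show "((\<lambda>x. fst x + snd x) \<longlongrightarrow> a + b) (nhds a \<times>\<^sub>F nhds b)"
  proof (subst tendsto_absv_iff, rule tendsto_sandwich)
    let ?F = "nhds a \<times>\<^sub>F nhds b"
    show "\<forall>\<^sub>F x in ?F. 0 \<le> absv (fst x + snd x - (a + b))" by simp
    show "\<forall>\<^sub>F x in ?F. absv (fst x + snd x - (a + b)) \<le> max (absv (fst x - a)) (absv (snd x - b))"
    proof (intro always_eventually allI)
      fix x :: "'a \<times> 'a"
      show "absv (fst x + snd x - (a + b)) \<le> max (absv (fst x - a)) (absv (snd x - b))"
        using absv_add_le_max[of "fst x - a" "snd x - b"] by (simp add: algebra_simps)
    qed
    have 1: "((\<lambda>x. absv (fst x - a)) \<longlongrightarrow> 0) ?F"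
      using filterlim_fst[of "nhds a" "nhds b"] by (simp add: tendsto_absv_iff)
    have 2: "((\<lambda>x. absv (snd x - b)) \<longlongrightarrow> 0) ?F"
      using filterlim_snd[of "nhds b" "nhds a"] by (simp add: tendsto_absv_iff)
    show "((\<lambda>x. max (absv (fst x - a)) (absv (snd x - b))) \<longlongrightarrow> 0) ?F"
      using tendsto_max[OF 1 2] by simp
  qed auto
next
  fix a :: 'a
  show "(uminus \<longlongrightarrow> - a) (nhds a)"
  proof (subst tendsto_absv_iff)
    have "((\<lambda>x. absv (x - a)) \<longlongrightarrow> 0) (nhds a)"
      using filterlim_ident[of "nhds a"] by (simp add: tendsto_absv_iff)
    moreover have "absv (- x - - a) = absv (x - a)" for x :: 'a
      using absv_diff_commute[of x a] by (simp add: algebra_simps)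
    ultimately show "((\<lambda>x. absv (- x - - a)) \<longlongrightarrow> 0) (nhds a)" by simp
  qed
qed

lemma sums_cmult_absv:
  fixes u :: "nat \<Rightarrow> 'a::complete_ultrametric_field"
  assumes "u sums s"
  shows "(\<lambda>n. c * u n) sums (c * s)"
proof -
  have "(\<lambda>n. absv c * absv ((\<Sum>i<n. u i) - s)) \<longlonglongrightarrow> absv c * 0"
    using assms unfolding sums_def tendsto_absv_iff[of _ s] by (rule tendsto_mult_left)
  moreover have "absv c * absv ((\<Sum>i<n. u i) - s) = absv ((\<Sum>i<n. c * u i) - c * s)" for n
    by (simp add: absv_mult[symmetric] right_diff_distrib sum_distrib_left)
  ultimately show ?thesis
    unfolding sums_def tendsto_absv_iff[of _ "c * s"] by simp
qed

lemma summable_tendsto_0: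
  fixes u :: "nat \<Rightarrow> 'a::complete_ultrametric_field"
  assumes "summable u"
  shows "u \<longlonglongrightarrow> 0"
proof -
  have *: "(\<lambda>n. \<Sum>i<n. u i) \<longlonglongrightarrow> suminf u"
    using assms by (rule summable_LIMSEQ)
  show ?thesis
    using tendsto_diff[OF LIMSEQ_Suc[OF *] *] by simp
qed

text \<open>If \<open>absv x\<close> exceeded the bound, some term would differ from
  \<open>x\<close> by less than \<open>absv x\<close> and hence have the same absolute
  value.\<close>

lemma absv_le_if_tendsto:
  fixes x :: "'a::complete_ultrametric_field"
  assumes "X \<longlonglongrightarrow> x" "\<And>n::nat. absv (X n) \<le> B"
  shows "absv x \<le> B"
proof (rule ccontr)
  assume "\<not> absv x \<le> B"
  then have "absv x > B" by simp
  have "B \<ge> 0" using assms(2)[of 0] absv_nonneg[of "X 0"] by linarith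
  then have "absv x > 0" using \<open>absv x > B\<close> by linarith
  have "(\<lambda>n. absv (X n - x)) \<longlonglongrightarrow> 0" using assms(1) by (simp add: tendsto_absv_iff)
  from order_tendstoD(2)[OF this \<open>absv x > 0\<close>] obtain n where "absv (X n - x) < absv x"
    by (auto simp: eventually_sequentially)
  then have "absv (x + (X n - x)) = absv x" by (rule absv_add_eq_left)
  then show False using assms(2)[of n] \<open>absv x > B\<close> by simp
qed

section \<open>Gauss norms of entire functions\<close>

lemma null_sequence_sandwich:
  fixes u v :: "nat \<Rightarrow> real"
  assumes "v \<longlonglongrightarrow> 0" "\<And>n. 0 \<le> u n" "\<And>n. u n \<le> v n"
  shows "u \<longlonglongrightarrow> 0"
  using assms by (intro real_tendsto_sandwich[of "\<lambda>_. 0" u sequentially v]) auto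

text \<open>The definition tests convergence at points of the field, whereas Gauss norms need decay
  for every real radius, whether or not it is the absolute value of a point. A power of some
  \<open>x\<close> with \<open>absv x > 1\<close> exceeds any given radius.\<close>

lemma entire_iff:
  "F \<in> entire \<longleftrightarrow> (\<forall>r>0. (\<lambda>n. absv (fps_nth F n) * r ^ n) \<longlonglongrightarrow> 0)"
proof
  assume F: "F \<in> entire"
  have lim: "(\<lambda>n. absv (fps_nth F n) * absv x ^ n) \<longlonglongrightarrow> 0" for x :: 'a
  proof -
    have "summable (\<lambda>n. fps_nth F n * x ^ n)" using F by (simp add: entire_def)
    then have "(\<lambda>n. fps_nth F n * x ^ n) \<longlonglongrightarrow> 0" by (rule summable_tendsto_0)
    then show ?thesis by (subst (asm) tendsto_absv_iff) (simp add: absv_mult)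
  qed
  show "\<forall>r>0. (\<lambda>n. absv (fps_nth F n) * r ^ n) \<longlonglongrightarrow> 0"
  proof (intro allI impI)
    fix r :: real assume "r > 0"
    show "(\<lambda>n. absv (fps_nth F n) * r ^ n) \<longlonglongrightarrow> 0"
    proof (cases "\<exists>x::'a. absv x > 1")
      case True
      then obtain x :: 'a where "absv x > 1" by blast
      then obtain j where j: "r < absv x ^ j" using real_arch_pow[of "absv x" r] by blast
      then have "absv (fps_nth F n) * r ^ n \<le> absv (fps_nth F n) * absv (x ^ j) ^ n" for n
        using \<open>r > 0\<close> j unfolding absv_power by (intro mult_left_mono power_mono) auto
      then show ?thesis
        using \<open>r > 0\<close> by (intro null_sequence_sandwich[OF lim[of "x ^ j"]]) simp_all
    next
      \<comment> \<open>The absolute value is trivial: no element exceeds 1, and by taking inverses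
        no non-zero element lies below 1. Coefficients tending to 0 are then eventually 0.\<close>
      case False
      have one: "absv x = 1" if "x \<noteq> 0" for x :: 'a
      proof -
        have le: "absv y \<le> 1" for y :: 'a using False not_less by blast
        have "absv x \<le> 1" "absv (inverse x) \<le> 1" by (rule le)+
        moreover have "absv x > 0" using that by simp
        ultimately show ?thesis by (simp add: inverse_le_1_iff)
      qed
      have "\<forall>\<^sub>F n in sequentially. absv (fps_nth F n) < 1"
        using order_tendstoD(2)[OF lim[of 1], of 1] by simp
      then have "\<forall>\<^sub>F n in sequentially. absv (fps_nth F n) * r ^ n = 0"
      proof eventually_elim
        case (elim n)
        then have "fps_nth F n = 0" using one[of "fps_nth F n"] by fastforce
        then show ?case by simp
      qed
      then show ?thesis by (rule tendsto_eventually)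
    qed
  qed
next
  assume *: "\<forall>r>0. (\<lambda>n. absv (fps_nth F n) * r ^ n) \<longlonglongrightarrow> 0"
  show "F \<in> entire"
    unfolding entire_def
  proof (intro CollectI allI summable_absvI)
    fix x :: 'a
    have "(\<lambda>n. absv (fps_nth F n) * (absv x + 1) ^ n) \<longlonglongrightarrow> 0"
      using *[rule_format, of "absv x + 1"] absv_nonneg[of x] by simp
    then show "(\<lambda>n. absv (fps_nth F n * x ^ n)) \<longlonglongrightarrow> 0"
    proof (rule null_sequence_sandwich)
      show "absv (fps_nth F n * x ^ n) \<le> absv (fps_nth F n) * (absv x + 1) ^ n" for n
        unfolding absv_mult absv_power by (intro mult_left_mono power_mono) auto
    qed simp
  qed
qed

lemma entire_tendsto: "F \<in> entire \<Longrightarrow> r > 0 \<Longrightarrow> (\<lambda>n. absv (fps_nth F n) * r ^ n) \<longlonglongrightarrow> 0"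
  by (simp add: entire_iff)

lemma entire_le:
  assumes "\<And>r. r > 0 \<Longrightarrow> \<exists>u. u \<longlonglongrightarrow> 0 \<and> (\<forall>n. absv (fps_nth F n) * r ^ n \<le> u n)"
  shows "F \<in> entire"
  unfolding entire_iff
proof (intro allI impI)
  fix r :: real assume "r > 0"
  from assms[OF this] obtain u where u: "u \<longlonglongrightarrow> 0" "\<And>n. absv (fps_nth F n) * r ^ n \<le> u n" by blast
  show "(\<lambda>n. absv (fps_nth F n) * r ^ n) \<longlonglongrightarrow> 0"
    by (rule null_sequence_sandwich[OF u(1) _ u(2)]) (use \<open>r > 0\<close> in simp)
qed

definition gnorm :: "real \<Rightarrow> 'a::complete_ultrametric_field fps \<Rightarrow> real" where
  "gnorm r F = (SUP n. absv (fps_nth F n) * r ^ n)"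

text \<open>Such an \<open>M\<close> is the number of zeroes in the closed disc of radius \<open>r\<close>.\<close>

definition dominant :: "real \<Rightarrow> 'a::complete_ultrametric_field fps \<Rightarrow> nat \<Rightarrow> bool" where
  "dominant r F M \<longleftrightarrow> (\<forall>n. absv (fps_nth F n) * r ^ n \<le> absv (fps_nth F M) * r ^ M) \<and>
     (\<forall>n>M. absv (fps_nth F n) * r ^ n < absv (fps_nth F M) * r ^ M)"

lemma bdd_above_gauss:
  assumes "F \<in> entire" "r > 0"
  shows "bdd_above (range (\<lambda>n. absv (fps_nth F n) * r ^ n))"
proof -
  have "Bseq (\<lambda>n. absv (fps_nth F n) * r ^ n)"
    by (rule convergent_imp_Bseq[OF convergentI[OF entire_tendsto[OF assms]]])
  then show ?thesis by (rule Bseq_bdd_above)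
qed

lemma gnorm_upper: "F \<in> entire \<Longrightarrow> r > 0 \<Longrightarrow> absv (fps_nth F n) * r ^ n \<le> gnorm r F"
  unfolding gnorm_def by (rule cSUP_upper[OF UNIV_I bdd_above_gauss])

lemma gnorm_least: "(\<And>n. absv (fps_nth F n) * r ^ n \<le> B) \<Longrightarrow> gnorm r F \<le> B"
  unfolding gnorm_def by (rule cSUP_least) simp_all

lemma gnorm_dominant: "dominant r F M \<Longrightarrow> gnorm r F = absv (fps_nth F M) * r ^ M"
  unfolding gnorm_def dominant_def by (intro cSup_eq_maximum rangeI) blast

lemma dominant_nonzero:
  assumes "dominant r F M" "r > 0"
  shows "fps_nth F M \<noteq> 0" "F \<noteq> 0"
proof -
  have "absv (fps_nth F (Suc M)) * r ^ Suc M < absv (fps_nth F M) * r ^ M"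
    using assms by (auto simp: dominant_def)
  moreover have "0 \<le> absv (fps_nth F (Suc M)) * r ^ Suc M" using assms by simp
  ultimately show "fps_nth F M \<noteq> 0" by auto
  then show "F \<noteq> 0" by auto
qed

text \<open>The terms tend to 0, so only finitely many reach a fixed positive one. Among these there
  is a largest value, and a last index attaining it.\<close>

lemma dominant_exists:
  assumes "F \<in> entire" "F \<noteq> 0" "r > 0"
  shows "\<exists>M. dominant r F M"
proof -
  define u where "u n = absv (fps_nth F n) * r ^ n" for n
  from assms obtain k where "fps_nth F k \<noteq> 0" by (auto simp: fps_eq_iff)
  then have "u k > 0" using assms by (simp add: u_def)
  define S where "S = {n. u k \<le> u n}"
  have "u \<longlonglongrightarrow> 0" unfolding u_def using assms by (intro entire_tendsto)
  from order_tendstoD(2)[OF this \<open>u k > 0\<close>] obtain N where "\<And>n. n \<ge> N \<Longrightarrow> u n < u k"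
    by (auto simp: eventually_sequentially)
  then have "S \<subseteq> {..<N}" unfolding S_def by (force simp: not_less[symmetric])
  then have fS: "finite S" by (rule finite_subset) simp
  have "k \<in> S" by (simp add: S_def)
  define m where "m = Max (u ` S)"
  have m_ge: "u n \<le> m" for n
  proof (cases "n \<in> S")
    case False
    then have "u n \<le> u k" by (simp add: S_def)
    also have "u k \<le> m" unfolding m_def using fS \<open>k \<in> S\<close> by (intro Max_ge) auto
    finally show ?thesis .
  qed (use fS in \<open>auto simp: m_def\<close>)
  define L where "L = {n \<in> S. u n = m}"
  have "m \<in> u ` S" unfolding m_def using fS \<open>k \<in> S\<close> by (intro Max_in) auto
  then have "L \<noteq> {}" by (auto simp: L_def)
  have fL: "finite L" using fS by (simp add: L_def)
  define M where "M = Max L"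
  have "M \<in> L" unfolding M_def using fL \<open>L \<noteq> {}\<close> by (rule Max_in)
  then have uM: "u M = m" by (simp add: L_def)
  have "u n < m" if "n > M" for n
  proof (rule ccontr)
    assume "\<not> u n < m"
    then have "u n = m" using m_ge[of n] by simp
    then have "n \<in> L" using m_ge[of k] by (simp add: L_def S_def)
    then have "n \<le> M" unfolding M_def using fL by simp
    then show False using that by simp
  qed
  then have "dominant r F M"
    unfolding dominant_def using m_ge uM by (simp add: u_def)
  then show ?thesis by blast
qed

lemma gnorm_0 [simp]: "gnorm r 0 = 0"
  unfolding gnorm_def by simp

lemma gnorm_pos: "F \<in> entire \<Longrightarrow> F \<noteq> 0 \<Longrightarrow> r > 0 \<Longrightarrow> 0 < gnorm r F"
  using dominant_exists[of F r] gnorm_dominant[of r F] dominant_nonzero[of r F] by force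

lemma gnorm_nonneg: "F \<in> entire \<Longrightarrow> r > 0 \<Longrightarrow> 0 \<le> gnorm r F"
  using gnorm_pos[of F r] by (cases "F = 0") auto

text \<open>Gauss's lemma. In the convolution at \<open>M + N\<close> every pair of indices other
  than \<open>(M, N)\<close> goes beyond \<open>M\<close> or beyond \<open>N\<close>, so its product
  is strictly smaller and cannot cancel the dominant one. This yields both the multiplicativity of
  \<open>gnorm\<close> and the additivity of the number of zeroes.\<close>

lemma dominant_mult:
  assumes F: "dominant r F M" and G: "dominant r G N" and r: "r > 0"
  shows "dominant r (F * G) (M + N)"
    and "absv (fps_nth (F * G) (M + N)) = absv (fps_nth F M) * absv (fps_nth G N)"
proof -
  let ?B = "absv (fps_nth F M) * r ^ M * (absv (fps_nth G N) * r ^ N)"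
  have pos: "0 < absv (fps_nth F M) * r ^ M" "0 < absv (fps_nth G N) * r ^ N"
    using dominant_nonzero[OF F r] dominant_nonzero[OF G r] r by auto
  have le: "absv (fps_nth F i) * r ^ i * (absv (fps_nth G j) * r ^ j) \<le> ?B" for i j
    by (rule mult_mono) (use F G pos r in \<open>simp_all add: dominant_def\<close>)
  have less: "absv (fps_nth F i) * r ^ i * (absv (fps_nth G j) * r ^ j) < ?B"
    if "i > M \<or> j > N" for i j
    using that
  proof
    assume "i > M"
    then have "absv (fps_nth F i) * r ^ i < absv (fps_nth F M) * r ^ M"
      using F by (simp add: dominant_def)
    then have "absv (fps_nth F i) * r ^ i * (absv (fps_nth G j) * r ^ j) \<le>
        absv (fps_nth F i) * r ^ i * (absv (fps_nth G N) * r ^ N)"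
      using G r by (intro mult_left_mono) (auto simp: dominant_def)
    also have "\<dots> < ?B"
      using \<open>absv (fps_nth F i) * r ^ i < _\<close> pos by (intro mult_strict_right_mono) auto
    finally show ?thesis .
  next
    assume "j > N"
    then have "absv (fps_nth G j) * r ^ j < absv (fps_nth G N) * r ^ N"
      using G by (simp add: dominant_def)
    have "absv (fps_nth F i) * r ^ i * (absv (fps_nth G j) * r ^ j) \<le>
        absv (fps_nth F M) * r ^ M * (absv (fps_nth G j) * r ^ j)"
      using F r by (intro mult_right_mono) (auto simp: dominant_def)
    also have "\<dots> < ?B"
      using \<open>absv (fps_nth G j) * r ^ j < _\<close> pos by (intro mult_strict_left_mono) auto
    finally show ?thesis .
  qed
  have split: "absv (fps_nth F i * fps_nth G (n - i)) * r ^ n =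
      absv (fps_nth F i) * r ^ i * (absv (fps_nth G (n - i)) * r ^ (n - i))" if "i \<le> n" for i n
    using that power_add[of r i "n - i"] by (simp add: absv_mult)
  have mult_r: "absv x \<le> b / r ^ n \<longleftrightarrow> absv x * r ^ n \<le> b"
    "absv x < b / r ^ n \<longleftrightarrow> absv x * r ^ n < b" for x :: 'a and b n
    using r by (simp_all add: field_simps)
  have 1: "absv (fps_nth (F * G) n) * r ^ n \<le> ?B" for n
  proof -
    have "absv (fps_nth (F * G) n) \<le> ?B / r ^ n"
      unfolding fps_mult_nth
    proof (rule absv_sum_le)
      fix i assume "i \<in> {0..n}"
      then show "absv (fps_nth F i * fps_nth G (n - i)) \<le> ?B / r ^ n"
        unfolding mult_r using split[of i n] le by simp
    qed (use pos r in auto)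
    then show ?thesis by (simp add: mult_r)
  qed
  have 2: "absv (fps_nth (F * G) n) * r ^ n < ?B" if "n > M + N" for n
  proof -
    have "absv (fps_nth (F * G) n) < ?B / r ^ n"
      unfolding fps_mult_nth
    proof (rule absv_sum_less)
      fix i assume i: "i \<in> {0..n}"
      have "i > M \<or> n - i > N" using that i by auto
      from less[OF this] show "absv (fps_nth F i * fps_nth G (n - i)) < ?B / r ^ n"
        unfolding mult_r using split[of i n] i by simp
    qed (use pos r in auto)
    then show ?thesis by (simp add: mult_r)
  qed
  have "fps_nth (F * G) (M + N) = fps_nth F M * fps_nth G N +
      (\<Sum>i\<in>{0..M+N} - {M}. fps_nth F i * fps_nth G (M + N - i))"
    unfolding fps_mult_nth by (subst sum.remove[of _ M]) auto
  moreover have "absv (\<Sum>i\<in>{0..M+N} - {M}. fps_nth F i * fps_nth G (M + N - i)) < ?B / r ^ (M + N)"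
  proof (rule absv_sum_less)
    fix i assume i: "i \<in> {0..M + N} - {M}"
    then have "i > M \<or> M + N - i > N" by auto
    from less[OF this] show "absv (fps_nth F i * fps_nth G (M + N - i)) < ?B / r ^ (M + N)"
      unfolding mult_r using split[of i "M + N"] i by simp
  qed (use pos r in auto)
  moreover have "absv (fps_nth F M * fps_nth G N) = ?B / r ^ (M + N)"
    using r by (simp add: absv_mult power_add)
  ultimately show 3: "absv (fps_nth (F * G) (M + N)) = absv (fps_nth F M) * absv (fps_nth G N)"
    by (simp add: absv_add_eq_left absv_mult)
  have 4: "absv (fps_nth (F * G) (M + N)) * r ^ (M + N) = ?B"
    by (simp add: 3 power_add)
  show "dominant r (F * G) (M + N)"
    unfolding dominant_def 4 using 1 2 by simp
qed

section \<open>The ring of entire functions and the multiplicativity of Gauss norms\<close>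

lemma entire_0 [simp]: "0 \<in> entire"
  by (simp add: entire_iff)

lemma entire_finite_support:
  assumes "\<And>n. n > N \<Longrightarrow> fps_nth F n = 0"
  shows "F \<in> entire"
  unfolding entire_iff
proof (intro allI impI tendsto_eventually)
  fix r :: real
  show "\<forall>\<^sub>F n in sequentially. absv (fps_nth F n) * r ^ n = 0"
    using eventually_gt_at_top[of N] by eventually_elim (use assms in simp)
qed

lemma entire_const [simp]: "fps_const c \<in> entire"
  by (rule entire_finite_support[of 0]) simp

lemma entire_1 [simp]: "1 \<in> entire"
  using entire_const[of 1] by simp

lemma entire_X [simp]: "fps_X \<in> entire"
  by (rule entire_finite_support[of 1]) (simp add: fps_X_def)

lemma entire_poly [simp]: "fps_of_poly p \<in> entire"
  by (rule entire_finite_support[of "degree p"]) (simp add: coeff_eq_0)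

lemma entire_add [simp]:
  assumes "F \<in> entire" "G \<in> entire"
  shows "F + G \<in> entire"
proof (rule entire_le)
  fix r :: real assume r: "r > 0"
  have "(\<lambda>n. max (absv (fps_nth F n) * r ^ n) (absv (fps_nth G n) * r ^ n)) \<longlonglongrightarrow> 0"
    using tendsto_max[OF entire_tendsto[OF assms(1) r] entire_tendsto[OF assms(2) r]] by simp
  moreover have "absv (fps_nth (F + G) n) * r ^ n \<le>
      max (absv (fps_nth F n) * r ^ n) (absv (fps_nth G n) * r ^ n)" for n
    using mult_right_mono[OF absv_add_le_max[of "fps_nth F n" "fps_nth G n"], of "r ^ n"] r
    by (simp add: max_mult_distrib_right)
  ultimately show "\<exists>u. u \<longlonglongrightarrow> 0 \<and> (\<forall>n. absv (fps_nth (F + G) n) * r ^ n \<le> u n)" by blast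
qed

lemma entire_uminus [simp]: "F \<in> entire \<Longrightarrow> - F \<in> entire"
  by (simp add: entire_iff)

lemma entire_diff [simp]: "F \<in> entire \<Longrightarrow> G \<in> entire \<Longrightarrow> F - G \<in> entire"
  using entire_add[of F "- G"] by simp

lemma gnorm_add_le:
  assumes "F \<in> entire" "G \<in> entire" "r > 0"
  shows "gnorm r (F + G) \<le> max (gnorm r F) (gnorm r G)"
proof (rule gnorm_least)
  fix n
  have "absv (fps_nth (F + G) n) * r ^ n \<le>
      max (absv (fps_nth F n) * r ^ n) (absv (fps_nth G n) * r ^ n)"
    using mult_right_mono[OF absv_add_le_max[of "fps_nth F n" "fps_nth G n"], of "r ^ n"] assms
    by (simp add: max_mult_distrib_right)
  also have "\<dots> \<le> max (gnorm r F) (gnorm r G)"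
    using gnorm_upper[OF assms(1,3)] gnorm_upper[OF assms(2,3)] by (intro max.mono) auto
  finally show "absv (fps_nth (F + G) n) * r ^ n \<le> max (gnorm r F) (gnorm r G)" .
qed

text \<open>Splitting the convolution at \<open>n / 2\<close> bounds each summand by a null sequence.\<close>

lemma entire_mult [simp]:
  assumes "F \<in> entire" "G \<in> entire"
  shows "F * G \<in> entire"
  unfolding entire_iff
proof (intro allI impI)
  fix r :: real assume r: "r > 0"
  define B where "B = max 1 (max (gnorm r F) (gnorm r G))"
  have B: "B > 0" "gnorm r F \<le> B" "gnorm r G \<le> B" by (auto simp: B_def)
  show "(\<lambda>n. absv (fps_nth (F * G) n) * r ^ n) \<longlonglongrightarrow> 0"
  proof (rule order_tendstoI)
    fix e :: real assume "e > 0"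
    then have "e / B > 0" using B by simp
    from order_tendstoD(2)[OF entire_tendsto[OF assms(1) r] this]
      order_tendstoD(2)[OF entire_tendsto[OF assms(2) r] this]
    obtain N1 N2 where N: "\<And>n. n \<ge> N1 \<Longrightarrow> absv (fps_nth F n) * r ^ n < e / B"
      "\<And>n. n \<ge> N2 \<Longrightarrow> absv (fps_nth G n) * r ^ n < e / B"
      by (auto simp: eventually_sequentially)
    have "absv (fps_nth (F * G) n) * r ^ n < e" if "n \<ge> N1 + N2" for n
    proof -
      have "absv (fps_nth (F * G) n) < e / r ^ n"
        unfolding fps_mult_nth
      proof (rule absv_sum_less)
        fix i assume i: "i \<in> {0..n}"
        let ?x = "absv (fps_nth F i) * r ^ i" and ?y = "absv (fps_nth G (n - i)) * r ^ (n - i)"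
        have nn: "0 \<le> ?x" "0 \<le> ?y" using r by auto
        have le: "?x \<le> B" "?y \<le> B"
          using gnorm_upper[OF assms(1) r, of i] gnorm_upper[OF assms(2) r, of "n - i"] B
          by linarith+
        have "?x * ?y < e"
        proof (cases "i \<ge> N1")
          case True
          then have "?x < e / B" using N by simp
          then have "?x * B < e" using B by (simp add: field_simps)
          moreover have "?x * ?y \<le> ?x * B" using le nn by (intro mult_left_mono)
          ultimately show ?thesis by linarith
        next
          case False
          then have "?y < e / B" using N that by simp
          then have "B * ?y < e" using B by (simp add: field_simps)
          moreover have "?x * ?y \<le> B * ?y" using le nn by (intro mult_right_mono)
          ultimately show ?thesis by linarith
        qed
        moreover have "absv (fps_nth F i * fps_nth G (n - i)) * r ^ n = ?x * ?y"
          using i power_add[of r i "n - i"] by (simp add: absv_mult)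
        ultimately show "absv (fps_nth F i * fps_nth G (n - i)) < e / r ^ n"
          using r by (simp add: field_simps)
      qed (use \<open>e > 0\<close> r in simp)
      then show ?thesis using r by (simp add: field_simps)
    qed
    then show "\<forall>\<^sub>F n in sequentially. absv (fps_nth (F * G) n) * r ^ n < e"
      unfolding eventually_sequentially by blast
  next
    fix e :: real assume "e < 0"
    show "\<forall>\<^sub>F n in sequentially. e < absv (fps_nth (F * G) n) * r ^ n"
    proof (intro always_eventually allI)
      fix n
      have "0 \<le> absv (fps_nth (F * G) n) * r ^ n" using r by simp
      then show "e < absv (fps_nth (F * G) n) * r ^ n" using \<open>e < 0\<close> by linarith
    qed
  qed
qed

lemma entire_power [simp]: "F \<in> entire \<Longrightarrow> F ^ n \<in> entire"
  by (induction n) auto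

lemma gnorm_mult:
  assumes "F \<in> entire" "G \<in> entire" "r > 0"
  shows "gnorm r (F * G) = gnorm r F * gnorm r G"
proof (cases "F = 0 \<or> G = 0")
  case False
  then obtain M N where "dominant r F M" "dominant r G N"
    using assms dominant_exists by blast
  with dominant_mult[OF this assms(3)] show ?thesis
    by (simp add: gnorm_dominant power_add)
qed auto

lemma gnorm_const [simp]:
  assumes "r > 0"
  shows "gnorm r (fps_const c) = absv c"
proof (rule antisym)
  show "gnorm r (fps_const c) \<le> absv c"
    by (rule gnorm_least) simp
  show "absv c \<le> gnorm r (fps_const c)"
    using gnorm_upper[of "fps_const c" r 0] assms by simp
qed

text \<open>For \<open>absv c = r\<close> both terms tie, and \<open>dominant\<close> takes the
  later index: the root is counted in the closed disc.\<close>

lemma dominant_linear: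
  assumes "r > 0"
  shows "dominant r (fps_X - fps_const c) (if absv c \<le> r then 1 else 0)"
  using assms by (auto simp: dominant_def fps_X_def)

lemma gnorm_linear: "r > 0 \<Longrightarrow> gnorm r (fps_X - fps_const c) = max r (absv c)"
  using gnorm_dominant[OF dominant_linear[of r c]] by (auto split: if_splits)

lemma absv_deriv_nth_le:
  fixes F :: "'a::complete_ultrametric_field fps"
  shows "absv (fps_nth (fps_deriv F) n) \<le> absv (fps_nth F (Suc n))"
proof -
  have "absv (of_nat (Suc n) :: 'a) * absv (fps_nth F (Suc n)) \<le> 1 * absv (fps_nth F (Suc n))"
    by (rule mult_right_mono[OF absv_of_nat_le_1]) simp
  then show ?thesis by (simp add: absv_mult)
qed

lemma gauss_deriv_le:
  assumes "r > 0"
  shows "absv (fps_nth (fps_deriv F) n) * r ^ n \<le> absv (fps_nth F (Suc n)) * r ^ Suc n / r"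
  using mult_right_mono[OF absv_deriv_nth_le[of F n], of "r ^ n"] assms by simp

lemma entire_deriv [simp]:
  assumes "F \<in> entire"
  shows "fps_deriv F \<in> entire"
proof (rule entire_le)
  fix r :: real assume r: "r > 0"
  have "(\<lambda>n. absv (fps_nth F (Suc n)) * r ^ Suc n / r) \<longlonglongrightarrow> 0"
    using tendsto_divide[OF LIMSEQ_Suc[OF entire_tendsto[OF assms r]] tendsto_const[of r]] r by simp
  then show "\<exists>u. u \<longlonglongrightarrow> 0 \<and> (\<forall>n. absv (fps_nth (fps_deriv F) n) * r ^ n \<le> u n)"
    using gauss_deriv_le[OF r, of F] by blast
qed

lemma gnorm_deriv_le:
  assumes "F \<in> entire" "r > 0"
  shows "gnorm r (fps_deriv F) \<le> gnorm r F / r"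
proof (rule gnorm_least)
  fix n
  have "absv (fps_nth (fps_deriv F) n) * r ^ n \<le> absv (fps_nth F (Suc n)) * r ^ Suc n / r"
    using assms by (intro gauss_deriv_le)
  also have "\<dots> \<le> gnorm r F / r"
    using gnorm_upper[OF assms, of "Suc n"] assms by (intro divide_right_mono) auto
  finally show "absv (fps_nth (fps_deriv F) n) * r ^ n \<le> gnorm r F / r" .
qed

section \<open>Evaluation and zeroes of entire functions\<close>

lemma entire_epsI:
  assumes "\<And>r e. r > 0 \<Longrightarrow> e > 0 \<Longrightarrow> \<exists>N. \<forall>n\<ge>N. absv (fps_nth F n) * r ^ n \<le> e"
  shows "F \<in> entire"
  unfolding entire_iff
proof (intro allI impI LIMSEQ_I)
  fix r e :: real assume "r > 0" "e > 0"
  then obtain N where "\<And>n. n \<ge> N \<Longrightarrow> absv (fps_nth F n) * r ^ n \<le> e / 2"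
    using assms[of r "e / 2"] by auto
  then show "\<exists>no. \<forall>n\<ge>no. norm (absv (fps_nth F n) * r ^ n - 0) < e"
    using \<open>r > 0\<close> \<open>e > 0\<close> by (intro exI[of _ N]) (force simp: abs_mult)
qed

lemma entire_eps:
  assumes "F \<in> entire" "r > 0" "e > 0"
  shows "\<exists>N. \<forall>n\<ge>N. absv (fps_nth F n) * r ^ n \<le> e"
  using order_tendstoD(2)[OF entire_tendsto[OF assms(1,2)] assms(3)]
  unfolding eventually_sequentially by (meson less_imp_le)

lemma ev_sums: "F \<in> entire \<Longrightarrow> (\<lambda>n. fps_nth F n * x ^ n) sums ev F x"
  unfolding ev_def entire_def by (rule summable_sums) simp

lemma ev_eqI: "(\<lambda>n. fps_nth F n * x ^ n) sums s \<Longrightarrow> ev F x = s"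
  unfolding ev_def by (rule sums_unique[symmetric])

lemma ev_const [simp]: "ev (fps_const c) x = c"
proof (rule ev_eqI)
  show "(\<lambda>n. fps_nth (fps_const c) n * x ^ n) sums c"
    using sums_finite[of "{0}" "\<lambda>n. fps_nth (fps_const c) n * x ^ n"] by simp
qed

lemma ev_0 [simp]: "ev 0 x = 0" and ev_1 [simp]: "ev 1 x = 1"
  using ev_const[of 0 x] ev_const[of 1 x] by simp_all

lemma ev_add: "F \<in> entire \<Longrightarrow> G \<in> entire \<Longrightarrow> ev (F + G) x = ev F x + ev G x"
  using sums_add[OF ev_sums[of F x] ev_sums[of G x]]
  by (intro ev_eqI) (simp add: distrib_right)

lemma ev_cmult: "F \<in> entire \<Longrightarrow> ev (fps_const c * F) x = c * ev F x"
  using sums_cmult_absv[OF ev_sums[of F x], of c]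
  by (intro ev_eqI) (simp add: mult.assoc)

lemma ev_uminus: "F \<in> entire \<Longrightarrow> ev (- F) x = - ev F x"
  using ev_cmult[of F "- 1" x] by (simp flip: fps_const_neg)

lemma ev_diff: "F \<in> entire \<Longrightarrow> G \<in> entire \<Longrightarrow> ev (F - G) x = ev F x - ev G x"
  using ev_add[of F "- G" x] by (simp add: ev_uminus)

lemma ev_X_mult:
  assumes "F \<in> entire"
  shows "ev (fps_X * F) x = x * ev F x"
proof (rule ev_eqI)
  have "(\<lambda>n. \<Sum>i<n. x * (fps_nth F i * x ^ i)) \<longlonglongrightarrow> x * ev F x"
    using sums_cmult_absv[OF ev_sums[OF assms, of x], of x] by (simp add: sums_def)
  moreover have "(\<Sum>i<n. x * (fps_nth F i * x ^ i)) = (\<Sum>i<Suc n. fps_nth (fps_X * F) i * x ^ i)" for n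
    unfolding sum.lessThan_Suc_shift by (simp add: mult_ac)
  ultimately show "(\<lambda>n. fps_nth (fps_X * F) n * x ^ n) sums (x * ev F x)"
    unfolding sums_def by (subst filterlim_sequentially_Suc[symmetric]) (simp only:)
qed

lemma absv_ev_le:
  assumes "F \<in> entire" "absv x \<le> r" "r > 0"
  shows "absv (ev F x) \<le> gnorm r F"
proof (rule absv_le_if_tendsto)
  show "(\<lambda>n. \<Sum>i<n. fps_nth F i * x ^ i) \<longlonglongrightarrow> ev F x"
    using ev_sums[OF assms(1), of x] by (simp add: sums_def)
  show "absv (\<Sum>i<n. fps_nth F i * x ^ i) \<le> gnorm r F" for n
  proof (rule absv_sum_le)
    fix i
    have "absv (fps_nth F i * x ^ i) \<le> absv (fps_nth F i) * r ^ i"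
      unfolding absv_mult absv_power using assms by (intro mult_left_mono power_mono) auto
    also have "\<dots> \<le> gnorm r F" by (rule gnorm_upper[OF assms(1,3)])
    finally show "absv (fps_nth F i * x ^ i) \<le> gnorm r F" .
  qed (rule gnorm_nonneg[OF assms(1,3)])
qed

lemma entire_shift [simp]:
  assumes "F \<in> entire"
  shows "fps_shift k F \<in> entire"
proof (rule entire_epsI)
  fix r e :: real assume r: "r > 0" and e: "e > 0"
  obtain N where N: "\<And>n. n \<ge> N \<Longrightarrow> absv (fps_nth F n) * r ^ n \<le> e * r ^ k"
    using entire_eps[OF assms r, of "e * r ^ k"] r e by auto
  have "absv (fps_nth (fps_shift k F) n) * r ^ n \<le> e" if "n \<ge> N" for n
    using N[of "n + k"] that r by (simp add: power_add field_simps)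
  then show "\<exists>N. \<forall>n\<ge>N. absv (fps_nth (fps_shift k F) n) * r ^ n \<le> e" by blast
qed

lemma ev_shift:
  assumes "F \<in> entire"
  shows "ev (fps_shift k F) c = fps_nth F k + c * ev (fps_shift (Suc k) F) c"
proof -
  have eq: "fps_shift k F = fps_const (fps_nth F k) + fps_X * fps_shift (Suc k) F"
  proof (rule fps_ext)
    fix n
    show "fps_nth (fps_shift k F) n =
        fps_nth (fps_const (fps_nth F k) + fps_X * fps_shift (Suc k) F) n"
      by (cases n) auto
  qed
  show ?thesis
    by (subst eq) (use assms in \<open>simp add: ev_add ev_X_mult\<close>)
qed

text \<open>Synthetic division: the coefficients of the quotient are the values at \<open>c\<close>
  of the shifted series, by the Horner recursion \<open>ev_shift\<close>. They decay at radius
  \<open>r\<close> because the shifts are estimated at a radius that is at least \<open>r\<close>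
  and \<open>absv c\<close>.\<close>

lemma entire_division:
  assumes "F \<in> entire"
  shows "\<exists>Q\<in>entire. F = fps_const (ev F c) + (fps_X - fps_const c) * Q"
proof
  define Q where "Q = Abs_fps (\<lambda>m. ev (fps_shift (Suc m) F) c)"
  show "Q \<in> entire"
  proof (rule entire_epsI)
    fix r e :: real assume r: "r > 0" and e: "e > 0"
    define s where "s = max r (absv c)"
    have s: "s > 0" "absv c \<le> s" "r \<le> s" using r by (auto simp: s_def)
    obtain N where N: "\<And>n. n \<ge> N \<Longrightarrow> absv (fps_nth F n) * s ^ n \<le> e * s"
      using entire_eps[OF assms s(1), of "e * s"] s(1) e by auto
    have "absv (fps_nth Q n) * r ^ n \<le> e" if "n \<ge> N" for n
    proof -
      have "absv (fps_nth Q n) \<le> gnorm s (fps_shift (Suc n) F)"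
        unfolding Q_def using assms s by (simp add: absv_ev_le)
      also have "\<dots> \<le> e * s / s ^ Suc n"
      proof (rule gnorm_least)
        fix m
        show "absv (fps_nth (fps_shift (Suc n) F) m) * s ^ m \<le> e * s / s ^ Suc n"
          using N[of "m + Suc n"] that s(1) by (simp add: power_add field_simps)
      qed
      also have "\<dots> = e / s ^ n" using s by (simp add: field_simps)
      finally have "absv (fps_nth Q n) * s ^ n \<le> e" using s by (simp add: field_simps)
      moreover have "absv (fps_nth Q n) * r ^ n \<le> absv (fps_nth Q n) * s ^ n"
        using r s by (intro mult_left_mono power_mono) auto
      ultimately show ?thesis by linarith
    qed
    then show "\<exists>N. \<forall>n\<ge>N. absv (fps_nth Q n) * r ^ n \<le> e" by blast
  qed
  show "F = fps_const (ev F c) + (fps_X - fps_const c) * Q"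
  proof (rule fps_ext)
    fix n
    show "fps_nth F n = fps_nth (fps_const (ev F c) + (fps_X - fps_const c) * Q) n"
    proof (cases n)
      case 0
      then show ?thesis
        using ev_shift[OF assms, of 0 c] by (simp add: Q_def left_diff_distrib)
    next
      case (Suc m)
      then show ?thesis
        using ev_shift[OF assms, of n c] by (simp add: Q_def left_diff_distrib)
    qed
  qed
qed

lemma ev_linear_mult: "Q \<in> entire \<Longrightarrow> ev ((fps_X - fps_const c) * Q) c = 0"
  by (simp add: left_diff_distrib ev_diff ev_X_mult ev_cmult)

text \<open>Avoids Cauchy products of series: both factors are a value plus a multiple of
  \<open>fps_X - fps_const c\<close>, and \<open>ev_linear_mult\<close> removes the
  multiples.\<close>

lemma ev_mult:
  assumes "F \<in> entire" "G \<in> entire"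
  shows "ev (F * G) c = ev F c * ev G c"
proof -
  let ?t = "fps_X - fps_const c" and ?a = "ev F c" and ?b = "ev G c"
  obtain Q R where Q: "Q \<in> entire" "F = fps_const ?a + ?t * Q"
    and R: "R \<in> entire" "G = fps_const ?b + ?t * R"
    using entire_division assms by metis
  have "F * G = (fps_const ?a + ?t * Q) * (fps_const ?b + ?t * R)"
    using Q(2) R(2) by (rule arg_cong2)
  also have "\<dots> = fps_const (?a * ?b) +
      ?t * (fps_const ?a * R + fps_const ?b * Q + ?t * Q * R)"
    by (simp add: algebra_simps flip: fps_const_mult)
  finally have "ev (F * G) c = ev (fps_const (?a * ?b) +
      ?t * (fps_const ?a * R + fps_const ?b * Q + ?t * Q * R)) c" by (rule arg_cong)
  also have "\<dots> = ?a * ?b"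
    using Q(1) R(1) by (subst ev_add) (simp_all add: ev_linear_mult)
  finally show ?thesis .
qed

lemma ev_power: "F \<in> entire \<Longrightarrow> ev (F ^ n) x = ev F x ^ n"
  by (induction n) (simp_all add: ev_mult)

lemma ev_X [simp]: "ev fps_X x = x"
  using ev_X_mult[of 1 x] by simp

lemma ev_linear [simp]: "ev (fps_X - fps_const c) x = x - c"
  by (simp add: ev_diff)

lemma ev_poly [simp]: "ev (fps_of_poly p) x = poly p x"
  by (induction p) (simp_all add: fps_of_poly_pCons ev_add ev_mult)

section \<open>Existence of zeroes\<close>

lemma entire_factor_root:
  assumes "F \<in> entire" "ev F c = 0"
  shows "\<exists>Q\<in>entire. F = (fps_X - fps_const c) * Q"
  using entire_division[OF assms(1), of c] assms(2) by simp

definition trunc_poly :: "nat \<Rightarrow> 'a::comm_monoid_add fps \<Rightarrow> 'a poly" where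
  "trunc_poly N F = (\<Sum>i<N. monom (fps_nth F i) i)"

lemma coeff_trunc_poly: "coeff (trunc_poly N F) n = (if n < N then fps_nth F n else 0)"
  by (simp add: trunc_poly_def coeff_sum)

lemma gnorm_trunc_poly:
  assumes "F \<in> entire" "r > 0" "e > 0"
  shows "\<exists>N. \<forall>n\<ge>N. gnorm r (F - fps_of_poly (trunc_poly n F)) \<le> e"
proof -
  obtain N where N: "\<And>n. n \<ge> N \<Longrightarrow> absv (fps_nth F n) * r ^ n \<le> e"
    using entire_eps[OF assms] by blast
  have "gnorm r (F - fps_of_poly (trunc_poly n F)) \<le> e" if "n \<ge> N" for n
    by (rule gnorm_least) (use N that assms in \<open>auto simp: coeff_trunc_poly\<close>)
  then show ?thesis by blast
qed

lemma dominant_unique: "dominant r F M \<Longrightarrow> dominant r F N \<Longrightarrow> M = N"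
  unfolding dominant_def by (metis leD linorder_neqE_nat)

text \<open>Division counterpart of \<open>dominant_mult\<close>. Splitting off a root in the disc
  lowers the dominant index by one, which drives the inductions on the number of zeroes.\<close>

lemma dominant_linear_mult:
  assumes "dominant r ((fps_X - fps_const c) * Q) M" "Q \<in> entire" "r > 0"
  shows "\<exists>N. dominant r Q N \<and> M = N + (if absv c \<le> r then 1 else 0) \<and>
    absv (fps_nth ((fps_X - fps_const c) * Q) M) =
      absv (fps_nth Q N) * (if absv c \<le> r then 1 else absv c)"
proof -
  have "Q \<noteq> 0" using dominant_nonzero[OF assms(1,3)] by auto
  then obtain N where N: "dominant r Q N"
    using dominant_exists assms by blast
  note * = dominant_mult[OF dominant_linear[OF assms(3)] N]
  have "M = (if absv c \<le> r then 1 else 0) + N"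
    using dominant_unique[OF assms(1) *(1)[OF assms(3)]] .
  then show ?thesis
    using N *(2)[OF assms(3), of c] by (intro exI[of _ N]) auto
qed

text \<open>If the constant term strictly exceeds all others, the rest of the series is too small to
  cancel it. In particular there is no zero in the disc: the base case of counting zeroes.\<close>

lemma absv_ev_dominant_0:
  assumes "F \<in> entire" "dominant r F 0" "absv x \<le> r" "r > 0"
  shows "absv (ev F x) = absv (fps_nth F 0)"
proof -
  define G where "G = fps_shift 1 F"
  have G: "G \<in> entire" using assms by (simp add: G_def)
  have ev: "ev F x = fps_nth F 0 + x * ev G x"
    using ev_shift[OF assms(1), of 0 x] by (simp add: G_def)
  have "absv (x * ev G x) < absv (fps_nth F 0)"
  proof (cases "G = 0")
    case True
    then show ?thesis using dominant_nonzero[OF assms(2,4)] by simp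
  next
    case False
    then obtain N where N: "dominant r G N" using dominant_exists G assms by blast
    have "absv (x * ev G x) \<le> r * gnorm r G"
      unfolding absv_mult using assms G by (intro mult_mono absv_ev_le) auto
    also have "\<dots> = absv (fps_nth F (Suc N)) * r ^ Suc N"
      unfolding gnorm_dominant[OF N] by (simp add: G_def)
    also have "\<dots> < absv (fps_nth F 0)"
      using assms(2) by (auto simp: dominant_def dest: spec[of _ "Suc N"])
    finally show ?thesis .
  qed
  then show ?thesis unfolding ev by (rule absv_add_eq_left)
qed

text \<open>A root \<open>w\<close> outside the disc satisfies \<open>absv (w - y) = absv w\<close>,
  so \<open>absv (poly p y)\<close> equals \<open>absv (coeff p M)\<close> times the product of the
  distances from \<open>y\<close> to the \<open>M\<close> roots inside. The nearest of these
  satisfies the estimate. The induction splits off one root at a time.\<close>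

lemma poly_root_close:
  fixes p :: "'a::{complete_ultrametric_field, alg_closed_field} poly"
  assumes "dominant r (fps_of_poly p) M" "M > 0" "absv y \<le> r" "r > 0"
  shows "\<exists>z. poly p z = 0 \<and> absv z \<le> r \<and> absv (z - y) ^ M * absv (coeff p M) \<le> absv (poly p y)"
  using assms
proof (induction "degree p" arbitrary: p M rule: less_induct)
  case less
  have "coeff p M \<noteq> 0" using dominant_nonzero(1)[OF less.prems(1,4)] by simp
  then have "degree p > 0" using less.prems(2) le_degree[of p M] by linarith
  then obtain w where w: "poly p w = 0" using alg_closed_imp_poly_has_root by blast
  then obtain q where q: "p = [:- w, 1:] * q" by (auto simp: poly_eq_0_iff_dvd)
  have "p \<noteq> 0" using \<open>degree p > 0\<close> by auto
  then have "q \<noteq> 0" using q by auto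
  then have deg: "degree q < degree p" unfolding q by (subst degree_mult_eq) auto
  have fps: "fps_of_poly p = (fps_X - fps_const w) * fps_of_poly q"
    unfolding q fps_of_poly_mult by (simp add: fps_of_poly_pCons)
  obtain N where N: "dominant r (fps_of_poly q) N" "M = N + (if absv w \<le> r then 1 else 0)"
    and coeff: "absv (coeff p M) = absv (coeff q N) * (if absv w \<le> r then 1 else absv w)"
    using dominant_linear_mult[OF less.prems(1)[unfolded fps] entire_poly less.prems(4)]
    unfolding fps[symmetric] fps_of_poly_nth by blast
  have py: "absv (poly p y) = absv (w - y) * absv (poly q y)"
    unfolding q by (simp add: absv_mult absv_diff_commute[of w y] left_diff_distrib[symmetric])
  have roots: "poly p z = 0" if "poly q z = 0" for z using that q by simp
  show ?case
  proof (cases "absv w \<le> r")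
    case True
    show ?thesis
    proof (cases "N = 0")
      case True
      then have "absv (poly q y) = absv (coeff q 0)"
        using absv_ev_dominant_0[of "fps_of_poly q" r y] N less.prems by simp
      then show ?thesis
        using w \<open>absv w \<le> r\<close> N coeff py True by (intro exI[of _ w]) simp
    next
      case False
      then obtain z where z: "poly q z = 0" "absv z \<le> r"
        "absv (z - y) ^ N * absv (coeff q N) \<le> absv (poly q y)"
        using less.hyps[OF deg N(1)] less.prems by auto
      define u where "u = (if absv (z - y) \<le> absv (w - y) then z else w)"
      have u: "absv (u - y) \<le> absv (z - y)" "absv (u - y) \<le> absv (w - y)"
        by (auto simp: u_def)
      have "absv (u - y) ^ M * absv (coeff p M) =
          absv (u - y) * (absv (u - y) ^ N * absv (coeff q N))"
        using N coeff True by simp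
      also have "\<dots> \<le> absv (w - y) * (absv (z - y) ^ N * absv (coeff q N))"
        using u by (intro mult_mono mult_right_mono power_mono) auto
      also have "\<dots> \<le> absv (w - y) * absv (poly q y)"
        using z by (intro mult_left_mono) auto
      finally show ?thesis
        using w z roots True py by (intro exI[of _ u]) (auto simp: u_def)
    qed
  next
    case False
    then have "N > 0" using N less.prems by simp
    then obtain z where z: "poly q z = 0" "absv z \<le> r"
      "absv (z - y) ^ N * absv (coeff q N) \<le> absv (poly q y)"
      using less.hyps[OF deg N(1)] less.prems by auto
    have "absv (w - y) = absv w"
      using False less.prems by (intro absv_diff_eq_left) simp
    then show ?thesis
      using z roots N coeff False py mult_left_mono[OF z(3), of "absv w"]
      by (intro exI[of _ z]) (simp add: mult_ac)
  qed
qed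

text \<open>All truncations used have dominant index \<open>M\<close>. At a root of one truncation
  the next takes the value of the single added monomial, which tends to 0, so
  \<open>poly_root_close\<close> supplies a nearby root of the next. The roots chosen in this way
  form a Cauchy sequence in the disc.\<close>

lemma entire_zero_exists:
  fixes F :: "'a::{complete_ultrametric_field, alg_closed_field} fps"
  assumes F: "F \<in> entire" and dom: "dominant r F M" and M: "M > 0" and r: "r > 0"
  shows "\<exists>x. absv x \<le> r \<and> ev F x = 0"
proof -
  \<comment> \<open>Starts at \<open>Suc M\<close> coefficients, so that the dominant term survives
    every truncation.\<close>
  define p where "p n = trunc_poly (n + Suc M) F" for n
  have coeff_p: "coeff (p n) i = (if i < n + Suc M then fps_nth F i else 0)" for n i
    by (simp add: p_def coeff_trunc_poly)
  have FM: "absv (fps_nth F M) > 0" using dominant_nonzero[OF dom r] by simp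
  have domp: "dominant r (fps_of_poly (p n)) M" for n
    using dom FM r by (auto simp: dominant_def coeff_p)
  have p_Suc: "p (Suc n) = p n + monom (fps_nth F (n + Suc M)) (n + Suc M)" for n
    by (simp add: p_def trunc_poly_def)
  have "\<exists>x. \<forall>n. (absv (x n) \<le> r \<and> poly (p n) (x n) = 0) \<and>
    absv (x (Suc n) - x n) ^ M * absv (fps_nth F M) \<le> absv (fps_nth F (n + Suc M)) * r ^ (n + Suc M)"
  proof (rule dependent_nat_choice)
    show "\<exists>x. absv x \<le> r \<and> poly (p 0) x = 0"
      using poly_root_close[OF domp M, of 0] r by auto
  next
    fix x n assume x: "absv x \<le> r \<and> poly (p n) x = 0"
    obtain z where z: "poly (p (Suc n)) z = 0" "absv z \<le> r"
      "absv (z - x) ^ M * absv (coeff (p (Suc n)) M) \<le> absv (poly (p (Suc n)) x)"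
      using poly_root_close[OF domp M _ r, of x "Suc n"] x by blast
    have "absv (poly (p (Suc n)) x) = absv (fps_nth F (n + Suc M)) * absv x ^ (n + Suc M)"
      using x by (simp add: p_Suc poly_monom absv_mult)
    also have "\<dots> \<le> absv (fps_nth F (n + Suc M)) * r ^ (n + Suc M)"
      using x by (intro mult_left_mono power_mono) auto
    finally show "\<exists>y. (absv y \<le> r \<and> poly (p (Suc n)) y = 0) \<and>
      absv (y - x) ^ M * absv (fps_nth F M) \<le> absv (fps_nth F (n + Suc M)) * r ^ (n + Suc M)"
      using z by (intro exI[of _ z]) (simp add: coeff_p)
  qed
  then obtain x where x_le: "\<And>n. absv (x n) \<le> r" and root: "\<And>n. poly (p n) (x n) = 0"
    and close: "\<And>n. absv (x (Suc n) - x n) ^ M * absv (fps_nth F M) \<le>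
      absv (fps_nth F (n + Suc M)) * r ^ (n + Suc M)" by blast
  have "(\<lambda>n. absv (x (Suc n) - x n)) \<longlonglongrightarrow> 0"
  proof (rule LIMSEQ_I)
    fix e :: real assume "e > 0"
    then have "e ^ M * absv (fps_nth F M) > 0" using FM by simp
    from order_tendstoD(2)[OF LIMSEQ_ignore_initial_segment[OF entire_tendsto[OF F r], of "Suc M"] this]
    obtain N where N: "\<And>n. n \<ge> N \<Longrightarrow>
        absv (fps_nth F (n + Suc M)) * r ^ (n + Suc M) < e ^ M * absv (fps_nth F M)"
      unfolding eventually_sequentially by blast
    have "absv (x (Suc n) - x n) < e" if "n \<ge> N" for n
    proof -
      have "absv (x (Suc n) - x n) ^ M < e ^ M"
        using le_less_trans[OF close N[OF that]] FM by simp
      then show ?thesis using \<open>e > 0\<close> by (rule power_less_imp_less_base[OF _ less_imp_le])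
    qed
    then show "\<exists>no. \<forall>n\<ge>no. norm (absv (x (Suc n) - x n) - 0) < e" by auto
  qed
  then have "convergent x" by (intro Cauchy_convergent Cauchy_absvI)
  then obtain l where l: "x \<longlonglongrightarrow> l" by (auto simp: convergent_def)
  have l_le: "absv l \<le> r" using absv_le_if_tendsto[OF l] x_le by blast
  \<comment> \<open>Division at the limit replaces continuity: \<open>F\<close> changes between
    \<open>l\<close> and \<open>x n\<close> by \<open>(x n - l) * ev Q (x n)\<close>, where the
    second factor is bounded by \<open>gnorm r Q\<close>.\<close>
  obtain Q where Q: "Q \<in> entire" "F = fps_const (ev F l) + (fps_X - fps_const l) * Q"
    using entire_division[OF F] by blast
  have "absv (ev F l) \<le> e" if "e > 0" for e
  proof -
    obtain N where N: "\<And>n. n \<ge> N \<Longrightarrow> gnorm r (F - fps_of_poly (trunc_poly n F)) \<le> e"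
      using gnorm_trunc_poly[OF F r \<open>e > 0\<close>] by blast
    have B: "gnorm r Q + 1 > 0" using gnorm_nonneg[OF Q(1) r] by simp
    have "(\<lambda>n. absv (x n - l)) \<longlonglongrightarrow> 0" using l by (simp add: tendsto_absv_iff)
    from order_tendstoD(2)[OF this, of "e / (gnorm r Q + 1)"] B \<open>e > 0\<close>
    obtain N' where N': "\<And>n. n \<ge> N' \<Longrightarrow> absv (x n - l) < e / (gnorm r Q + 1)"
      unfolding eventually_sequentially by auto
    define n where "n = max N N'"
    have "ev F (x n) = ev (F - fps_of_poly (p n)) (x n)"
      using F root by (simp add: ev_diff)
    also have "absv \<dots> \<le> gnorm r (F - fps_of_poly (p n))"
      using F x_le r by (intro absv_ev_le) auto
    also have "\<dots> \<le> e" unfolding p_def by (rule N) (simp add: n_def)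
    finally have 1: "absv (ev F (x n)) \<le> e" .
    have "ev F (x n) = ev F l + (x n - l) * ev Q (x n)"
      by (subst Q(2)) (simp add: ev_add ev_mult Q(1))
    then have eq: "ev F l = ev F (x n) - (x n - l) * ev Q (x n)" by simp
    have "absv ((x n - l) * ev Q (x n)) \<le> absv (x n - l) * (gnorm r Q + 1)"
      unfolding absv_mult using absv_ev_le[OF Q(1) x_le r, of n] by (intro mult_left_mono) auto
    also have "\<dots> \<le> e" using N'[of n] B by (simp add: n_def field_simps)
    finally show ?thesis
      unfolding eq using 1 absv_diff_le_max[of "ev F (x n)" "(x n - l) * ev Q (x n)"] by linarith
  qed
  then have "absv (ev F l) \<le> 0" by (rule dense_ge)
  then have "ev F l = 0" using absv_nonneg[of "ev F l"] by (metis absv_eq_0_iff antisym)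
  then show ?thesis using l_le by blast
qed

section \<open>Meromorphic functions\<close>

lemma fls_deriv_inverse_field:
  fixes h :: "'a::field fls"
  assumes "h \<noteq> 0"
  shows "fls_deriv (inverse h) = - fls_deriv h * inverse h ^ 2"
proof -
  have "fls_deriv (h * inverse h) = 0" using assms by simp
  then have "h * fls_deriv (inverse h) = - fls_deriv h * inverse h"
    unfolding fls_deriv_mult by (simp add: eq_neg_iff_add_eq_0 add.commute)
  then have "inverse h * (h * fls_deriv (inverse h)) = - fls_deriv h * inverse h ^ 2"
    by (simp add: power2_eq_square)
  then show ?thesis using assms by (simp flip: mult.assoc)
qed

lemma fls_deriv_divide_field:
  fixes g h :: "'a::field fls"
  assumes "h \<noteq> 0"
  shows "fls_deriv (g / h) = (fls_deriv g * h - g * fls_deriv h) / h ^ 2"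
  using assms unfolding divide_inverse[of g h] fls_deriv_mult fls_deriv_inverse_field[OF assms]
  by (simp add: field_simps power2_eq_square)

lemma fls_deriv_power_int_field:
  fixes h :: "'a::field fls"
  assumes "h \<noteq> 0"
  shows "fls_deriv (h powi m) = of_int m * h powi (m - 1) * fls_deriv h"
proof (cases m rule: int_cases2)
  case (nonneg n)
  then show ?thesis
  proof (cases n)
    case (Suc k)
    then have m: "m = int (Suc k)" using nonneg by simp
    have 1: "h powi m = h ^ Suc k" unfolding m power_int_of_nat ..
    have 2: "h powi (m - 1) = h ^ k" using power_int_of_nat[of h k] by (simp add: m)
    show ?thesis
      unfolding 1 2 using fls_deriv_power[of h "Suc k"] by (simp add: m del: fls_deriv_mult power_Suc)
  qed simp
next
  case (nonpos n)
  have "fls_deriv (h powi m) = fls_deriv (inverse (h ^ n))"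
    by (simp add: nonpos power_int_minus)
  also have "\<dots> = - (of_nat n * h ^ (n - 1) * fls_deriv h) * inverse (h ^ n) ^ 2"
    using assms by (simp add: fls_deriv_inverse_field fls_deriv_power)
  also have "\<dots> = of_int m * h powi (m - 1) * fls_deriv h"
  proof (cases n)
    case (Suc k)
    have 1: "h powi (m - 1) = inverse (h * h * h ^ k)"
      using power_int_minus[of h "int (n + 1)"] unfolding power_int_of_nat nonpos
      by (simp add: Suc mult.assoc)
    show ?thesis unfolding 1 using assms by (simp add: nonpos Suc field_simps power2_eq_square)
  qed (simp add: nonpos)
  finally show ?thesis .
qed

section \<open>The differential field of meromorphic functions\<close>

lemma meroI: "F \<in> entire \<Longrightarrow> G \<in> entire \<Longrightarrow> G \<noteq> 0 \<Longrightarrow> fps_to_fls F / fps_to_fls G \<in> mero"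
  unfolding mero_def by blast

lemma meroE:
  assumes "h \<in> mero"
  obtains F G where "F \<in> entire" "G \<in> entire" "G \<noteq> 0" "h = fps_to_fls F / fps_to_fls G"
  using assms unfolding mero_def by blast

lemma mero_entire [simp]: "F \<in> entire \<Longrightarrow> fps_to_fls F \<in> mero"
  using meroI[of F 1] by simp

lemma mero_const [simp]: "fls_const c \<in> mero"
  using mero_entire[of "fps_const c"] by simp

lemma mero_0 [simp]: "0 \<in> mero" and mero_1 [simp]: "1 \<in> mero"
  using mero_const[of 0] mero_const[of 1] by simp_all

lemma mero_of_int [simp]: "of_int m \<in> mero"
  using mero_const[of "of_int m"] by (simp add: fls_of_int)

lemma mero_add [simp]:
  assumes "g \<in> mero" "h \<in> mero"
  shows "g + h \<in> mero"
  using assms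
proof (elim meroE)
  fix F G F' G' assume *: "F \<in> entire" "G \<in> entire" "G \<noteq> 0" "g = fps_to_fls F / fps_to_fls G"
    "F' \<in> entire" "G' \<in> entire" "G' \<noteq> 0" "h = fps_to_fls F' / fps_to_fls G'"
  then have eq: "g + h = fps_to_fls (F * G' + F' * G) / fps_to_fls (G * G')"
    by (simp add: add_frac_eq fls_times_fps_to_fls)
  show ?thesis unfolding eq using * by (intro meroI) simp_all
qed

lemma mero_mult [simp]:
  assumes "g \<in> mero" "h \<in> mero"
  shows "g * h \<in> mero"
  using assms
proof (elim meroE)
  fix F G F' G' assume *: "F \<in> entire" "G \<in> entire" "G \<noteq> 0" "g = fps_to_fls F / fps_to_fls G"
    "F' \<in> entire" "G' \<in> entire" "G' \<noteq> 0" "h = fps_to_fls F' / fps_to_fls G'"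
  then have eq: "g * h = fps_to_fls (F * F') / fps_to_fls (G * G')"
    by (simp add: fls_times_fps_to_fls)
  show ?thesis unfolding eq using * by (intro meroI) simp_all
qed

lemma mero_inverse [simp]:
  assumes "h \<in> mero"
  shows "inverse h \<in> mero"
proof (cases "h = 0")
  case False
  from assms obtain F G where *: "F \<in> entire" "G \<in> entire" "G \<noteq> 0" "h = fps_to_fls F / fps_to_fls G"
    by (rule meroE)
  then have "inverse h = fps_to_fls G / fps_to_fls F" "F \<noteq> 0" using False by auto
  then show ?thesis using * by (simp add: meroI)
qed simp

lemma mero_divide [simp]: "g \<in> mero \<Longrightarrow> h \<in> mero \<Longrightarrow> g / h \<in> mero"
  by (simp add: divide_inverse)

lemma mero_uminus [simp]: "h \<in> mero \<Longrightarrow> - h \<in> mero"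
  using mero_mult[of "fls_const (- 1)" h] mero_const[of "- 1"] by simp

lemma mero_diff [simp]: "g \<in> mero \<Longrightarrow> h \<in> mero \<Longrightarrow> g - h \<in> mero"
  using mero_add[of g "- h"] by simp

lemma mero_power [simp]: "h \<in> mero \<Longrightarrow> h ^ n \<in> mero"
  by (induction n) auto

lemma mero_power_int [simp]: "h \<in> mero \<Longrightarrow> h powi m \<in> mero"
  by (simp add: power_int_def)

lemma mero_prod [simp]: "(\<And>i. i \<in> I \<Longrightarrow> h i \<in> mero) \<Longrightarrow> prod h I \<in> mero"
  by (induction I rule: infinite_finite_induct) auto

lemma mero_deriv [simp]:
  assumes "h \<in> mero"
  shows "fls_deriv h \<in> mero"
proof -
  from assms obtain F G where *: "F \<in> entire" "G \<in> entire" "G \<noteq> 0" "h = fps_to_fls F / fps_to_fls G"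
    by (rule meroE)
  then show ?thesis by (simp add: fls_deriv_divide_field fls_deriv_fps_to_fls)
qed

subsection \<open>Orders at a point\<close>

definition lin :: "'a::field \<Rightarrow> 'a fls" where
  "lin \<gamma> = fls_X - fls_const \<gamma>"

lemma lin_eq: "lin \<gamma> = fps_to_fls (fps_X - fps_const \<gamma>)"
  by (simp add: lin_def)

lemma lin_nonzero [simp]: "lin \<gamma> \<noteq> 0"
proof
  assume "lin \<gamma> = 0"
  then have "fls_nth (lin \<gamma>) 1 = 0" by simp
  then show False by (simp add: lin_def)
qed

lemma mero_lin [simp]: "lin \<gamma> \<in> mero"
  unfolding lin_eq by (rule mero_entire) simp

lemma deriv_lin [simp]: "fls_deriv (lin \<gamma>) = 1"
  by (simp add: lin_def)

text \<open>To be read as: the order at \<open>\<gamma>\<close> is at least \<open>m\<close>. Unlike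
  \<open>mero_order\<close> this makes sense for the zero function, so sums and derivatives can be
  estimated before they are known not to vanish.\<close>

definition vge :: "'a::complete_ultrametric_field \<Rightarrow> int \<Rightarrow> 'a fls \<Rightarrow> bool" where
  "vge \<gamma> m h \<longleftrightarrow> (\<exists>F G. F \<in> entire \<and> G \<in> entire \<and> ev G \<gamma> \<noteq> 0 \<and>
     h = lin \<gamma> powi m * fps_to_fls F / fps_to_fls G)"

definition is_ord :: "'a::complete_ultrametric_field \<Rightarrow> int \<Rightarrow> 'a fls \<Rightarrow> bool" where
  "is_ord \<gamma> m h \<longleftrightarrow> (\<exists>F G. F \<in> entire \<and> G \<in> entire \<and> ev F \<gamma> \<noteq> 0 \<and> ev G \<gamma> \<noteq> 0 \<and>
     h = lin \<gamma> powi m * fps_to_fls F / fps_to_fls G)"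

lemma ev_nonzero: "ev F x \<noteq> 0 \<Longrightarrow> F \<noteq> 0"
  by auto

lemma is_ord_imp_vge: "is_ord \<gamma> m h \<Longrightarrow> vge \<gamma> m h"
  unfolding is_ord_def vge_def by blast

lemma is_ord_nonzero: "is_ord \<gamma> m h \<Longrightarrow> h \<noteq> 0"
  unfolding is_ord_def by (auto dest: ev_nonzero)

text \<open>Otherwise clearing denominators gives an identity of entire functions in which only one
  side contains a positive power of \<open>fps_X - fps_const \<gamma>\<close>, while the other is
  non-zero at \<open>\<gamma>\<close>.\<close>

lemma is_ord_vge_le:
  assumes "is_ord \<gamma> m h" "vge \<gamma> k h"
  shows "k \<le> m"
proof (rule ccontr)
  assume "\<not> k \<le> m"
  define n where "n = nat (k - m)"
  have n: "n > 0" "k = m + int n" using \<open>\<not> k \<le> m\<close> by (auto simp: n_def)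
  from assms(1) obtain F G where F: "F \<in> entire" "G \<in> entire" "ev F \<gamma> \<noteq> 0" "ev G \<gamma> \<noteq> 0"
    and h: "h = lin \<gamma> powi m * fps_to_fls F / fps_to_fls G" unfolding is_ord_def by blast
  from assms(2) obtain F' G' where F': "F' \<in> entire" "G' \<in> entire" "ev G' \<gamma> \<noteq> 0"
    and h': "h = lin \<gamma> powi k * fps_to_fls F' / fps_to_fls G'" unfolding vge_def by blast
  have nz: "fps_to_fls G \<noteq> 0" "fps_to_fls G' \<noteq> 0" using F(4) F'(3) by auto
  have "lin \<gamma> powi m * (fps_to_fls F * fps_to_fls G') =
      lin \<gamma> powi m * (lin \<gamma> ^ n * fps_to_fls F' * fps_to_fls G)"
    using h h' nz by (simp add: n(2) power_int_add field_simps)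
  then have "fps_to_fls F * fps_to_fls G' = lin \<gamma> ^ n * fps_to_fls F' * fps_to_fls G"
    by simp
  then have "fps_to_fls (F * G') = fps_to_fls ((fps_X - fps_const \<gamma>) ^ n * F' * G)"
    unfolding lin_eq by (simp add: fls_times_fps_to_fls fps_to_fls_power)
  then have "F * G' = (fps_X - fps_const \<gamma>) ^ n * F' * G"
    by (simp only: fps_to_fls_eq_iff)
  then have "ev (F * G') \<gamma> = ev ((fps_X - fps_const \<gamma>) ^ n * F' * G) \<gamma>" by simp
  then show False using F F' n(1) by (simp add: ev_mult ev_power power_0_left)
qed

lemma is_ord_unique: "is_ord \<gamma> m h \<Longrightarrow> is_ord \<gamma> k h \<Longrightarrow> m = k"
  by (meson antisym is_ord_imp_vge is_ord_vge_le)

lemma is_ord_mero_order: "is_ord \<gamma> m h \<Longrightarrow> mero_order \<gamma> h = m"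
  unfolding mero_order_def lin_def[symmetric] is_ord_def[symmetric] using is_ord_unique by blast

lemma is_ord_mult:
  assumes "is_ord \<gamma> m g" "is_ord \<gamma> k h"
  shows "is_ord \<gamma> (m + k) (g * h)"
proof -
  from assms obtain F G F' G' where *: "F \<in> entire" "G \<in> entire" "ev F \<gamma> \<noteq> 0" "ev G \<gamma> \<noteq> 0"
    "F' \<in> entire" "G' \<in> entire" "ev F' \<gamma> \<noteq> 0" "ev G' \<gamma> \<noteq> 0"
    and gh: "g = lin \<gamma> powi m * fps_to_fls F / fps_to_fls G"
      "h = lin \<gamma> powi k * fps_to_fls F' / fps_to_fls G'" unfolding is_ord_def by blast
  show ?thesis
    unfolding is_ord_def gh
    by (intro exI[of _ "F * F'"] exI[of _ "G * G'"])
       (use * in \<open>simp add: ev_mult fls_times_fps_to_fls power_int_add mult_ac\<close>)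
qed

lemma is_ord_inverse:
  assumes "is_ord \<gamma> m h"
  shows "is_ord \<gamma> (- m) (inverse h)"
proof -
  from assms obtain F G where *: "F \<in> entire" "G \<in> entire" "ev F \<gamma> \<noteq> 0" "ev G \<gamma> \<noteq> 0"
    and h: "h = lin \<gamma> powi m * fps_to_fls F / fps_to_fls G" unfolding is_ord_def by blast
  show ?thesis
    unfolding is_ord_def h
    by (intro exI[of _ G] exI[of _ F]) (use * in \<open>simp add: power_int_minus field_simps\<close>)
qed

text \<open>The factor vanishing at \<open>\<gamma>\<close> can be divided out only finitely often,
  since at a radius beyond \<open>absv \<gamma>\<close> each division lowers the dominant
  index.\<close>

lemma is_ord_entire_exists:
  assumes "F \<in> entire" "F \<noteq> 0"
  shows "\<exists>m. is_ord \<gamma> m (fps_to_fls F)"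
proof -
  define r where "r = absv \<gamma> + 1"
  have r: "r > 0" "absv \<gamma> \<le> r" using absv_nonneg[of \<gamma>] by (auto simp: r_def intro: add_nonneg_pos)
  obtain M where "dominant r F M" using dominant_exists assms r by blast
  then show ?thesis using assms
  proof (induction M arbitrary: F rule: less_induct)
    case (less M)
    show ?case
    proof (cases "ev F \<gamma> = 0")
      case False
      then have "is_ord \<gamma> 0 (fps_to_fls F)"
        unfolding is_ord_def using less.prems by (intro exI[of _ F] exI[of _ 1]) simp
      then show ?thesis by blast
    next
      case True
      then obtain Q where Q: "Q \<in> entire" "F = (fps_X - fps_const \<gamma>) * Q"
        using entire_factor_root less.prems by blast
      then have "Q \<noteq> 0" using less.prems by auto
      from dominant_linear_mult[OF less.prems(1)[unfolded Q] Q(1) r(1)] r(2)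
      obtain N where "dominant r Q N" "N < M" by auto
      with less.IH[of N Q] Q \<open>Q \<noteq> 0\<close> obtain m where "is_ord \<gamma> m (fps_to_fls Q)" by blast
      moreover have "is_ord \<gamma> 1 (lin \<gamma>)"
        unfolding is_ord_def by (intro exI[of _ 1]) simp
      ultimately have "is_ord \<gamma> (1 + m) (lin \<gamma> * fps_to_fls Q)"
        by (intro is_ord_mult)
      then show ?thesis unfolding Q(2) fls_times_fps_to_fls lin_eq by blast
    qed
  qed
qed

lemma is_ord_exists:
  assumes "h \<in> mero" "h \<noteq> 0"
  shows "\<exists>m. is_ord \<gamma> m h"
proof -
  from assms(1) obtain F G where *: "F \<in> entire" "G \<in> entire" "G \<noteq> 0" "h = fps_to_fls F / fps_to_fls G"
    by (rule meroE)
  then have "F \<noteq> 0" using assms(2) by auto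
  obtain m k where "is_ord \<gamma> m (fps_to_fls F)" "is_ord \<gamma> k (fps_to_fls G)"
    using is_ord_entire_exists * \<open>F \<noteq> 0\<close> by blast
  from is_ord_mult[OF this(1) is_ord_inverse[OF this(2)]] show ?thesis
    unfolding *(4) divide_inverse by blast
qed

lemma is_ord_mero_order_self: "h \<in> mero \<Longrightarrow> h \<noteq> 0 \<Longrightarrow> is_ord \<gamma> (mero_order \<gamma> h) h"
  using is_ord_exists is_ord_mero_order by metis

lemma vge_0 [simp]: "vge \<gamma> m 0"
  unfolding vge_def by (intro exI[of _ 0] exI[of _ 1]) simp

lemma vge_mult:
  assumes "vge \<gamma> m g" "vge \<gamma> k h"
  shows "vge \<gamma> (m + k) (g * h)"
proof -
  from assms obtain F G F' G' where *: "F \<in> entire" "G \<in> entire" "ev G \<gamma> \<noteq> 0"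
    "F' \<in> entire" "G' \<in> entire" "ev G' \<gamma> \<noteq> 0"
    and gh: "g = lin \<gamma> powi m * fps_to_fls F / fps_to_fls G"
      "h = lin \<gamma> powi k * fps_to_fls F' / fps_to_fls G'" unfolding vge_def by blast
  show ?thesis
    unfolding vge_def gh
    by (intro exI[of _ "F * F'"] exI[of _ "G * G'"])
       (use * in \<open>simp add: ev_mult fls_times_fps_to_fls power_int_add mult_ac\<close>)
qed

lemma vge_add:
  assumes "vge \<gamma> m g" "vge \<gamma> m h"
  shows "vge \<gamma> m (g + h)"
proof -
  from assms obtain F G F' G' where *: "F \<in> entire" "G \<in> entire" "ev G \<gamma> \<noteq> 0"
    "F' \<in> entire" "G' \<in> entire" "ev G' \<gamma> \<noteq> 0"
    and gh: "g = lin \<gamma> powi m * fps_to_fls F / fps_to_fls G"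
      "h = lin \<gamma> powi m * fps_to_fls F' / fps_to_fls G'" unfolding vge_def by blast
  have nz: "fps_to_fls G \<noteq> 0" "fps_to_fls G' \<noteq> 0" using *(3,6) by auto
  have "g + h = lin \<gamma> powi m * fps_to_fls (F * G' + F' * G) / fps_to_fls (G * G')"
    unfolding gh using nz by (simp add: add_frac_eq fls_times_fps_to_fls algebra_simps)
  then show ?thesis
    unfolding vge_def
    by (intro exI[of _ "F * G' + F' * G"] exI[of _ "G * G'"]) (use * in \<open>simp add: ev_mult\<close>)
qed

lemma vge_lin_power: "vge \<gamma> m (lin \<gamma> powi m)"
  unfolding vge_def by (intro exI[of _ 1]) simp

lemma vge_entire [simp]: "F \<in> entire \<Longrightarrow> vge \<gamma> 0 (fps_to_fls F)"
  unfolding vge_def by (intro exI[of _ F] exI[of _ 1]) simp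

lemma vge_const [simp]: "vge \<gamma> 0 (fls_const c)"
  using vge_entire[of "fps_const c"] by simp

lemma vge_of_int [simp]: "vge \<gamma> 0 (of_int m)"
  using vge_const[of \<gamma> "of_int m"] by (simp add: fls_of_int)

lemma vge_mono:
  assumes "vge \<gamma> m h" "k \<le> m"
  shows "vge \<gamma> k h"
proof -
  have "vge \<gamma> 0 (fps_to_fls ((fps_X - fps_const \<gamma>) ^ nat (m - k)))" by simp
  then have "vge \<gamma> 0 (lin \<gamma> powi (m - k))"
    unfolding lin_eq fps_to_fls_power using assms(2) by (simp add: power_int_def)
  from vge_mult[OF this vge_lin_power[of \<gamma> k]] have *: "vge \<gamma> k (lin \<gamma> powi m)"
    using assms(2) by (simp flip: power_int_add)
  from assms(1) obtain F G where FG: "F \<in> entire" "G \<in> entire" "ev G \<gamma> \<noteq> 0"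
    "h = lin \<gamma> powi m * fps_to_fls F / fps_to_fls G" unfolding vge_def by blast
  then have "vge \<gamma> 0 (fps_to_fls F / fps_to_fls G)" unfolding vge_def by auto
  from vge_mult[OF * this] show ?thesis unfolding FG(4) by simp
qed

lemma vge_uminus: "vge \<gamma> m h \<Longrightarrow> vge \<gamma> m (- h)"
  using vge_mult[OF vge_of_int[of \<gamma> "- 1"], of m h] by simp

lemma vge_diff: "vge \<gamma> m g \<Longrightarrow> vge \<gamma> m h \<Longrightarrow> vge \<gamma> m (g - h)"
  using vge_add[of \<gamma> m g "- h"] by (simp add: vge_uminus)

lemma vge_deriv_0:
  assumes "vge \<gamma> 0 h"
  shows "vge \<gamma> 0 (fls_deriv h)"
proof -
  from assms obtain F G where FG: "F \<in> entire" "G \<in> entire" "ev G \<gamma> \<noteq> 0"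
    "h = fps_to_fls F / fps_to_fls G" unfolding vge_def by auto
  have "fls_deriv h = lin \<gamma> powi 0 * fps_to_fls (fps_deriv F * G - F * fps_deriv G) / fps_to_fls (G ^ 2)"
    using FG(3) unfolding FG(4)
    by (subst fls_deriv_divide_field) (auto simp: fls_deriv_fps_to_fls fls_times_fps_to_fls fps_to_fls_power)
  then show ?thesis
    unfolding vge_def
    by (intro exI[of _ "fps_deriv F * G - F * fps_deriv G"] exI[of _ "G ^ 2"]) (use FG in \<open>simp add: ev_power\<close>)
qed

lemma vge_factor:
  assumes "vge \<gamma> m h"
  shows "\<exists>u. vge \<gamma> 0 u \<and> h = lin \<gamma> powi m * u"
proof -
  from assms obtain F G where FG: "F \<in> entire" "G \<in> entire" "ev G \<gamma> \<noteq> 0"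
    "h = lin \<gamma> powi m * fps_to_fls F / fps_to_fls G" unfolding vge_def by blast
  then show ?thesis
    unfolding vge_def by (intro exI[of _ "fps_to_fls F / fps_to_fls G"]) auto
qed

lemma fls_deriv_lin_mult:
  "fls_deriv (lin \<gamma> powi m * u) = lin \<gamma> powi (m - 1) * (of_int m * u + lin \<gamma> * fls_deriv u)"
proof -
  have "lin \<gamma> powi m = lin \<gamma> powi (m - 1) * lin \<gamma>"
    using power_int_add[of "lin \<gamma>" "m - 1" 1] by simp
  then show ?thesis
    unfolding fls_deriv_mult fls_deriv_power_int_field[OF lin_nonzero] deriv_lin
    by (simp add: algebra_simps)
qed

lemma vge_lin [simp]: "vge \<gamma> 1 (lin \<gamma>)"
  using vge_lin_power[of \<gamma> 1] by simp

lemma vge_deriv: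
  assumes "vge \<gamma> m h"
  shows "vge \<gamma> (m - 1) (fls_deriv h)"
proof -
  obtain u where u: "vge \<gamma> 0 u" "h = lin \<gamma> powi m * u" using vge_factor[OF assms] by blast
  have "vge \<gamma> 0 (of_int m * u)" using vge_mult[OF vge_of_int u(1)] by simp
  moreover have "vge \<gamma> 0 (lin \<gamma> * fls_deriv u)"
    using vge_mult[OF vge_lin vge_deriv_0[OF u(1)]] by (auto intro: vge_mono)
  ultimately have "vge \<gamma> 0 (of_int m * u + lin \<gamma> * fls_deriv u)" by (rule vge_add)
  from vge_mult[OF vge_lin_power this] show ?thesis unfolding u(2) fls_deriv_lin_mult by simp
qed

lemma vge_iff:
  assumes "h \<in> mero" "h \<noteq> 0"
  shows "vge \<gamma> m h \<longleftrightarrow> m \<le> mero_order \<gamma> h"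
  using is_ord_mero_order_self[OF assms, of \<gamma>] is_ord_imp_vge is_ord_vge_le vge_mono by blast

lemma vge_mero: "vge \<gamma> m h \<Longrightarrow> h \<in> mero"
  unfolding vge_def by auto

lemma mero_order_mult [simp]:
  assumes "g \<in> mero" "h \<in> mero" "g \<noteq> 0" "h \<noteq> 0"
  shows "mero_order \<gamma> (g * h) = mero_order \<gamma> g + mero_order \<gamma> h"
  using is_ord_mult[OF is_ord_mero_order_self is_ord_mero_order_self] assms
  by (intro is_ord_mero_order) auto

lemma mero_order_inverse [simp]:
  assumes "h \<in> mero" "h \<noteq> 0"
  shows "mero_order \<gamma> (inverse h) = - mero_order \<gamma> h"
  using is_ord_inverse[OF is_ord_mero_order_self] assms by (intro is_ord_mero_order) auto

lemma mero_order_divide [simp]: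
  assumes "g \<in> mero" "h \<in> mero" "g \<noteq> 0" "h \<noteq> 0"
  shows "mero_order \<gamma> (g / h) = mero_order \<gamma> g - mero_order \<gamma> h"
  using assms by (simp add: divide_inverse)

lemma mero_order_const [simp]: "c \<noteq> 0 \<Longrightarrow> mero_order \<gamma> (fls_const c) = 0"
  by (intro is_ord_mero_order, unfold is_ord_def, intro exI[of _ "fps_const c"] exI[of _ 1]) simp

lemma mero_order_1 [simp]: "mero_order \<gamma> 1 = 0"
  using mero_order_const[of 1 \<gamma>] by simp

lemma mero_order_power [simp]:
  assumes "h \<in> mero" "h \<noteq> 0"
  shows "mero_order \<gamma> (h ^ n) = int n * mero_order \<gamma> h"
  using assms by (induction n) (simp_all add: algebra_simps)

lemma mero_order_prod:
  assumes "\<And>i. i \<in> I \<Longrightarrow> h i \<in> mero" "\<And>i. i \<in> I \<Longrightarrow> h i \<noteq> 0"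
  shows "mero_order \<gamma> (prod h I) = (\<Sum>i\<in>I. mero_order \<gamma> (h i))"
  using assms by (induction I rule: infinite_finite_induct) auto

lemma mero_order_uminus [simp]:
  assumes "h \<in> mero" "h \<noteq> 0"
  shows "mero_order \<gamma> (- h) = mero_order \<gamma> h"
proof -
  have "- h = fls_const (- 1) * h" by (simp add: fls_const_uminus)
  then show ?thesis using assms by (metis add_0 mero_const mero_order_const mero_order_mult
    fls_const_nonzero neg_equal_0_iff_equal zero_neq_one)
qed

lemma mero_order_add_ge:
  assumes "g \<in> mero" "h \<in> mero" "g \<noteq> 0" "h \<noteq> 0" "g + h \<noteq> 0"
  shows "min (mero_order \<gamma> g) (mero_order \<gamma> h) \<le> mero_order \<gamma> (g + h)"
proof -
  let ?m = "min (mero_order \<gamma> g) (mero_order \<gamma> h)"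
  have "vge \<gamma> ?m g" "vge \<gamma> ?m h" using assms by (simp_all add: vge_iff)
  then have "vge \<gamma> ?m (g + h)" by (rule vge_add)
  then show ?thesis using assms by (simp add: vge_iff)
qed

lemma mero_order_add_eq:
  assumes "g \<in> mero" "h \<in> mero" "g \<noteq> 0" "h \<noteq> 0" "mero_order \<gamma> g < mero_order \<gamma> h"
  shows "g + h \<noteq> 0" "mero_order \<gamma> (g + h) = mero_order \<gamma> g"
proof -
  show nz: "g + h \<noteq> 0"
  proof
    assume "g + h = 0"
    then have "h = - g" by (simp add: eq_neg_iff_add_eq_0 add.commute)
    then show False using assms by simp
  qed
  have "\<not> vge \<gamma> (mero_order \<gamma> g + 1) (g + h)"
  proof
    assume "vge \<gamma> (mero_order \<gamma> g + 1) (g + h)"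
    then have "vge \<gamma> (mero_order \<gamma> g + 1) (g + h - h)"
      using assms by (intro vge_diff) (simp_all add: vge_iff)
    then show False using assms by (simp add: vge_iff)
  qed
  then show "mero_order \<gamma> (g + h) = mero_order \<gamma> g"
    using mero_order_add_ge[OF assms(1-4) nz, of \<gamma>] assms nz by (simp add: vge_iff)
qed

lemma mero_order_deriv_ge:
  assumes "h \<in> mero" "h \<noteq> 0" "fls_deriv h \<noteq> 0"
  shows "mero_order \<gamma> h - 1 \<le> mero_order \<gamma> (fls_deriv h)"
    and "mero_order \<gamma> h = 0 \<Longrightarrow> 0 \<le> mero_order \<gamma> (fls_deriv h)"
  using assms vge_deriv[of \<gamma> _ h] vge_deriv_0[of \<gamma> h] by (simp_all add: vge_iff)

lemma mero_factor_lin: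
  assumes "h \<in> mero" "h \<noteq> 0"
  shows "\<exists>u. u \<in> mero \<and> u \<noteq> 0 \<and> mero_order \<gamma> u = 0 \<and> h = lin \<gamma> powi mero_order \<gamma> h * u"
proof -
  from is_ord_mero_order_self[OF assms, of \<gamma>] obtain F G where FG: "F \<in> entire" "G \<in> entire"
    "ev F \<gamma> \<noteq> 0" "ev G \<gamma> \<noteq> 0" "h = lin \<gamma> powi mero_order \<gamma> h * fps_to_fls F / fps_to_fls G"
    unfolding is_ord_def by blast
  have nz: "F \<noteq> 0" "G \<noteq> 0" using FG(3,4) by auto
  have "is_ord \<gamma> 0 (fps_to_fls F / fps_to_fls G)" unfolding is_ord_def using FG by auto
  then show ?thesis
    using FG(1,2,5) nz
    by (intro exI[of _ "fps_to_fls F / fps_to_fls G"]) (auto simp: is_ord_mero_order)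
qed

lemma mero_order_lin_self [simp]: "mero_order \<gamma> (lin \<gamma>) = 1"
  by (intro is_ord_mero_order) (auto simp: is_ord_def intro!: exI[of _ 1])

lemma mero_order_lin:
  "mero_order \<gamma> (lin c) = (if \<gamma> = c then 1 else 0)"
proof (cases "\<gamma> = c")
  case False
  then have "is_ord \<gamma> 0 (fps_to_fls (fps_X - fps_const c))"
    unfolding is_ord_def by (intro exI[of _ "fps_X - fps_const c"] exI[of _ 1]) simp
  then show ?thesis using False unfolding lin_eq by (simp add: is_ord_mero_order)
qed simp

lemma mero_order_lin_power_int [simp]: "mero_order \<gamma> (lin \<gamma> powi m) = m"
  by (intro is_ord_mero_order) (auto simp: is_ord_def intro!: exI[of _ 1])

text \<open>\<open>v\<close> is the cofactor in the derivative of
  \<open>lin \<gamma> powi m * u\<close>. In characteristic zero \<open>of_int m * u\<close> does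
  not vanish at \<open>\<gamma>\<close>, whereas the other summand does.\<close>

lemma mero_order_unit_deriv:
  fixes u :: "'a::{complete_ultrametric_field, field_char_0} fls"
  assumes "u \<in> mero" "u \<noteq> 0" "mero_order \<gamma> u = 0" "m \<noteq> 0"
  defines "v \<equiv> of_int m * u + lin \<gamma> * fls_deriv u"
  shows "v \<in> mero" "v \<noteq> 0" "mero_order \<gamma> v = 0"
proof -
  have m: "(of_int m :: 'a fls) = fls_const (of_int m)" by (simp add: fls_of_int)
  show "v \<in> mero" using assms by (simp add: v_def)
  have 1: "of_int m * u \<in> mero" "of_int m * u \<noteq> 0" "mero_order \<gamma> (of_int m * u) = 0"
    using assms(1-4) by (simp_all add: m)
  show "v \<noteq> 0" "mero_order \<gamma> v = 0"
  proof -
    have "v \<noteq> 0 \<and> mero_order \<gamma> v = 0"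
    proof (cases "fls_deriv u = 0")
      case False
      then have "mero_order \<gamma> (lin \<gamma> * fls_deriv u) \<ge> 1"
        using mero_order_deriv_ge(2)[OF assms(1,2) False, of \<gamma>] assms(1-3) by simp
      then show ?thesis
        using mero_order_add_eq[OF 1(1) _ 1(2), of "lin \<gamma> * fls_deriv u" \<gamma>] 1 assms(1) False
        by (simp add: v_def)
    qed (use 1 in \<open>simp add: v_def\<close>)
    then show "v \<noteq> 0" "mero_order \<gamma> v = 0" by auto
  qed
qed

lemma mero_order_deriv:
  fixes h :: "'a::{complete_ultrametric_field, field_char_0} fls"
  assumes "h \<in> mero" "h \<noteq> 0" "mero_order \<gamma> h \<noteq> 0"
  shows "fls_deriv h \<noteq> 0" "mero_order \<gamma> (fls_deriv h) = mero_order \<gamma> h - 1"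
proof -
  let ?m = "mero_order \<gamma> h"
  obtain u where u: "u \<in> mero" "u \<noteq> 0" "mero_order \<gamma> u = 0" "h = lin \<gamma> powi ?m * u"
    using mero_factor_lin[OF assms(1,2)] by blast
  have "fls_deriv h = fls_deriv (lin \<gamma> powi ?m * u)" using u(4) by simp
  also have "\<dots> = lin \<gamma> powi (?m - 1) * (of_int ?m * u + lin \<gamma> * fls_deriv u)"
    by (rule fls_deriv_lin_mult)
  finally have *: "fls_deriv h = lin \<gamma> powi (?m - 1) * (of_int ?m * u + lin \<gamma> * fls_deriv u)" .
  show "fls_deriv h \<noteq> 0" "mero_order \<gamma> (fls_deriv h) = ?m - 1"
    unfolding * using mero_order_unit_deriv[OF u(1-3) assms(3)] by simp_all
qed

subsection \<open>Gauss norms of meromorphic functions\<close>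

lemma gnorm_1 [simp]: "r > 0 \<Longrightarrow> gnorm r (1 :: 'a::complete_ultrametric_field fps) = 1"
  using gnorm_const[of r "1 :: 'a"] by simp

text \<open>Well defined because Gauss norms are multiplicative: equal fractions have equal cross
  products, hence equal quotients of norms (\<open>mnorm_eq\<close>).\<close>

definition mnorm :: "real \<Rightarrow> 'a::complete_ultrametric_field fls \<Rightarrow> real" where
  "mnorm r h = (THE x. \<exists>F G. F \<in> entire \<and> G \<in> entire \<and> G \<noteq> 0 \<and>
     h = fps_to_fls F / fps_to_fls G \<and> x = gnorm r F / gnorm r G)"

lemma mnorm_eq:
  assumes "F \<in> entire" "G \<in> entire" "G \<noteq> 0" "r > 0"
  shows "mnorm r (fps_to_fls F / fps_to_fls G) = gnorm r F / gnorm r G"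
  unfolding mnorm_def
proof (rule the_equality)
  fix x
  assume "\<exists>F' G'. F' \<in> entire \<and> G' \<in> entire \<and> G' \<noteq> 0 \<and>
     fps_to_fls F / fps_to_fls G = fps_to_fls F' / fps_to_fls G' \<and> x = gnorm r F' / gnorm r G'"
  then obtain F' G' where *: "F' \<in> entire" "G' \<in> entire" "G' \<noteq> 0"
    "fps_to_fls F / fps_to_fls G = fps_to_fls F' / fps_to_fls G'" "x = gnorm r F' / gnorm r G'"
    by blast
  have "fps_to_fls (F * G') = fps_to_fls (F' * G)"
    using *(3,4) assms(3) by (simp add: frac_eq_eq fls_times_fps_to_fls)
  then have "F * G' = F' * G" by (simp only: fps_to_fls_eq_iff)
  then have "gnorm r F * gnorm r G' = gnorm r F' * gnorm r G"
    using assms * by (metis gnorm_mult)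
  then show "x = gnorm r F / gnorm r G"
    using gnorm_pos[OF assms(2-4)] gnorm_pos[OF *(2,3) assms(4)] *(5) by (simp add: frac_eq_eq)
qed (use assms in blast)

lemma mnorm_entire [simp]: "F \<in> entire \<Longrightarrow> r > 0 \<Longrightarrow> mnorm r (fps_to_fls F) = gnorm r F"
  using mnorm_eq[of F 1 r] by simp

lemma mnorm_const [simp]: "r > 0 \<Longrightarrow> mnorm r (fls_const c) = absv c"
  using mnorm_entire[of "fps_const c" r] by simp

lemma mnorm_0 [simp]: "r > 0 \<Longrightarrow> mnorm r 0 = 0"
  and mnorm_1 [simp]: "r > 0 \<Longrightarrow> mnorm r 1 = 1"
  using mnorm_const[of r 0] mnorm_const[of r 1] by simp_all

lemma mnorm_mult:
  assumes "g \<in> mero" "h \<in> mero" "r > 0"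
  shows "mnorm r (g * h) = mnorm r g * mnorm r h"
proof -
  from assms obtain F G F' G' where *: "F \<in> entire" "G \<in> entire" "G \<noteq> 0" "g = fps_to_fls F / fps_to_fls G"
    "F' \<in> entire" "G' \<in> entire" "G' \<noteq> 0" "h = fps_to_fls F' / fps_to_fls G'"
    by (elim meroE)
  then have "g * h = fps_to_fls (F * F') / fps_to_fls (G * G')"
    by (simp add: fls_times_fps_to_fls)
  then have "mnorm r (g * h) = gnorm r (F * F') / gnorm r (G * G')"
    using * assms(3) mnorm_eq[of "F * F'" "G * G'" r] by simp
  then show ?thesis using * assms(3) by (simp add: mnorm_eq gnorm_mult)
qed

lemma mnorm_pos:
  assumes "h \<in> mero" "h \<noteq> 0" "r > 0"
  shows "mnorm r h > 0"
proof -
  from assms(1) obtain F G where *: "F \<in> entire" "G \<in> entire" "G \<noteq> 0" "h = fps_to_fls F / fps_to_fls G"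
    by (rule meroE)
  then show ?thesis using assms gnorm_pos[of F r] gnorm_pos[of G r] by (auto simp: mnorm_eq)
qed

lemma mnorm_nonneg: "h \<in> mero \<Longrightarrow> r > 0 \<Longrightarrow> mnorm r h \<ge> 0"
  using mnorm_pos[of h r] by (cases "h = 0") auto

lemma mnorm_inverse:
  assumes "h \<in> mero" "h \<noteq> 0" "r > 0"
  shows "mnorm r (inverse h) = inverse (mnorm r h)"
  using mnorm_mult[of h "inverse h" r] mnorm_pos[OF assms] assms by (simp add: field_simps)

lemma mnorm_divide:
  assumes "g \<in> mero" "h \<in> mero" "h \<noteq> 0" "r > 0"
  shows "mnorm r (g / h) = mnorm r g / mnorm r h"
  using assms by (simp add: divide_inverse mnorm_mult mnorm_inverse)

lemma mnorm_uminus [simp]: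
  assumes "h \<in> mero" "r > 0"
  shows "mnorm r (- h) = mnorm r h"
proof -
  have eq: "- h = fls_const (- 1) * h" by simp
  show ?thesis unfolding eq mnorm_mult[OF mero_const assms] mnorm_const[OF assms(2)] by simp
qed

lemma mnorm_add_le:
  assumes "g \<in> mero" "h \<in> mero" "r > 0"
  shows "mnorm r (g + h) \<le> max (mnorm r g) (mnorm r h)"
proof -
  from assms obtain F G F' G' where *: "F \<in> entire" "G \<in> entire" "G \<noteq> 0" "g = fps_to_fls F / fps_to_fls G"
    "F' \<in> entire" "G' \<in> entire" "G' \<noteq> 0" "h = fps_to_fls F' / fps_to_fls G'"
    by (elim meroE)
  then have eq: "g + h = fps_to_fls (F * G' + F' * G) / fps_to_fls (G * G')"
    by (simp add: add_frac_eq fls_times_fps_to_fls)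
  have pos: "gnorm r G > 0" "gnorm r G' > 0" using * assms gnorm_pos by auto
  have "mnorm r (g + h) = gnorm r (F * G' + F' * G) / gnorm r (G * G')"
    unfolding eq using * assms(3) by (intro mnorm_eq) simp_all
  also have "\<dots> \<le> max (gnorm r (F * G')) (gnorm r (F' * G)) / gnorm r (G * G')"
    using * assms(3) pos by (intro divide_right_mono gnorm_add_le) (simp_all add: gnorm_mult)
  also have "\<dots> = max (gnorm r F / gnorm r G) (gnorm r F' / gnorm r G')"
    using * assms(3) pos by (simp add: gnorm_mult max_divide_distrib_right)
  also have "\<dots> = max (mnorm r g) (mnorm r h)"
    using * assms(3) by (simp add: mnorm_eq)
  finally show ?thesis .
qed

lemma mnorm_diff_le:
  assumes "g \<in> mero" "h \<in> mero" "r > 0"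
  shows "mnorm r (g - h) \<le> max (mnorm r g) (mnorm r h)"
  using mnorm_add_le[of g "- h" r] assms by simp

lemma mnorm_add_eq:
  assumes "g \<in> mero" "h \<in> mero" "r > 0" "mnorm r h < mnorm r g"
  shows "mnorm r (g + h) = mnorm r g"
  using mnorm_add_le[OF assms(1-3)] mnorm_diff_le[of "g + h" h r] assms by simp

lemma mnorm_diff_eq:
  assumes "g \<in> mero" "h \<in> mero" "r > 0" "mnorm r h < mnorm r g"
  shows "mnorm r (g - h) = mnorm r g"
  using mnorm_add_eq[of g "- h" r] assms by simp

text \<open>The ultrametric lemma on the logarithmic derivative, without exceptional radii. The gain
  \<open>1 / r\<close> comes from the index shift in the derivative of a power series and survives
  the quotient rule; it is the origin of the term \<open>- ln r\<close>.\<close>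

lemma mnorm_deriv_le:
  assumes "h \<in> mero" "r > 0"
  shows "mnorm r (fls_deriv h) \<le> mnorm r h / r"
proof -
  from assms(1) obtain F G where *: "F \<in> entire" "G \<in> entire" "G \<noteq> 0" "h = fps_to_fls F / fps_to_fls G"
    by (rule meroE)
  have pos: "gnorm r G > 0" using * assms gnorm_pos by auto
  have eq: "fls_deriv h = fps_to_fls (fps_deriv F * G - F * fps_deriv G) / fps_to_fls (G ^ 2)"
    using * by (simp add: fls_deriv_divide_field fls_deriv_fps_to_fls fls_times_fps_to_fls fps_to_fls_power)
  have "gnorm r (fps_deriv F * G - F * fps_deriv G) =
      gnorm r (fps_deriv F * G + - F * fps_deriv G)" by simp
  also have "\<dots> \<le> max (gnorm r (fps_deriv F * G)) (gnorm r (- F * fps_deriv G))"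
    using * assms by (intro gnorm_add_le) simp_all
  also have "\<dots> = max (gnorm r (fps_deriv F) * gnorm r G) (gnorm r F * gnorm r (fps_deriv G))"
  proof -
    have "gnorm r (- F) = gnorm r F" by (simp add: gnorm_def)
    then show ?thesis
      using gnorm_mult[of "fps_deriv F" G r] gnorm_mult[of "- F" "fps_deriv G" r] * assms by simp
  qed
  also have "\<dots> \<le> gnorm r F / r * gnorm r G"
  proof (rule max.boundedI)
    show "gnorm r (fps_deriv F) * gnorm r G \<le> gnorm r F / r * gnorm r G"
      using * assms pos by (intro mult_right_mono gnorm_deriv_le) auto
    have "gnorm r F * gnorm r (fps_deriv G) \<le> gnorm r F * (gnorm r G / r)"
      using * assms by (intro mult_left_mono gnorm_deriv_le gnorm_nonneg) auto
    then show "gnorm r F * gnorm r (fps_deriv G) \<le> gnorm r F / r * gnorm r G" by simp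
  qed
  finally have le: "gnorm r (fps_deriv F * G - F * fps_deriv G) \<le> gnorm r F / r * gnorm r G" .
  have "mnorm r (fls_deriv h) = gnorm r (fps_deriv F * G - F * fps_deriv G) / gnorm r (G ^ 2)"
    unfolding eq using * assms by (intro mnorm_eq) simp_all
  also have "\<dots> \<le> gnorm r F / r * gnorm r G / gnorm r (G ^ 2)"
    using le * assms by (intro divide_right_mono gnorm_nonneg) auto
  also have "\<dots> = mnorm r h / r"
    using * assms pos by (simp add: mnorm_eq gnorm_mult power2_eq_square)
  finally show ?thesis .
qed

section \<open>Counting functions and Jensen's formula\<close>

text \<open>
  A divisor \<open>D\<close> is weighted as in the counting functions \<open>Z\<close> and \<open>N\<close>, except that the points of the
  closed unit disc all get the weight of the unit circle. This leaves bounded differences and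
  makes sense for zeroes and poles at the origin, too.
\<close>

definition cnt :: "real \<Rightarrow> ('a::complete_ultrametric_field \<Rightarrow> real) \<Rightarrow> real" where
  "cnt r D = (\<Sum>\<gamma> | D \<gamma> \<noteq> 0 \<and> absv \<gamma> \<le> r. D \<gamma> * (ln r - ln (max (absv \<gamma>) 1)))"

text \<open>A sum over an infinite set is 0 by convention, so \<open>cnt\<close> is additive and
  monotone only for divisors with finite support in each disc.\<close>

definition locfin :: "('a::complete_ultrametric_field \<Rightarrow> real) \<Rightarrow> bool" where
  "locfin D \<longleftrightarrow> (\<forall>r. finite {\<gamma>. D \<gamma> \<noteq> 0 \<and> absv \<gamma> \<le> r})"

lemma locfinD: "locfin D \<Longrightarrow> finite {\<gamma>. D \<gamma> \<noteq> 0 \<and> absv \<gamma> \<le> r}"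
  by (simp add: locfin_def)

lemma locfin_0 [simp]: "locfin (\<lambda>_. 0)"
  by (simp add: locfin_def)

lemma locfin_mono:
  assumes "locfin D" "\<And>\<gamma>. D \<gamma> = 0 \<Longrightarrow> E \<gamma> = 0"
  shows "locfin E"
  unfolding locfin_def
proof
  fix r
  show "finite {\<gamma>. E \<gamma> \<noteq> 0 \<and> absv \<gamma> \<le> r}"
    by (rule finite_subset[OF _ locfinD[OF assms(1), of r]]) (use assms(2) in auto)
qed

lemma locfin_add [simp]:
  assumes "locfin D" "locfin E"
  shows "locfin (\<lambda>\<gamma>. D \<gamma> + E \<gamma>)"
  unfolding locfin_def
proof
  fix r
  show "finite {\<gamma>. D \<gamma> + E \<gamma> \<noteq> 0 \<and> absv \<gamma> \<le> r}"
    by (rule finite_subset[OF _ finite_UnI[OF locfinD[OF assms(1), of r] locfinD[OF assms(2), of r]]]) auto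
qed

lemma locfin_cmult [simp]: "locfin D \<Longrightarrow> locfin (\<lambda>\<gamma>. c * D \<gamma>)"
  by (erule locfin_mono) simp

lemma locfin_diff [simp]: "locfin D \<Longrightarrow> locfin E \<Longrightarrow> locfin (\<lambda>\<gamma>. D \<gamma> - E \<gamma>)"
  using locfin_add[of D "\<lambda>\<gamma>. - 1 * E \<gamma>"] locfin_cmult[of E "- 1"] by simp

lemma locfin_sum [simp]: "(\<And>i. i \<in> I \<Longrightarrow> locfin (D i)) \<Longrightarrow> locfin (\<lambda>\<gamma>. \<Sum>i\<in>I. D i \<gamma>)"
  by (induction I rule: infinite_finite_induct) auto

lemma cnt_eq_sum:
  assumes "finite A" "\<And>\<gamma>. D \<gamma> \<noteq> 0 \<Longrightarrow> absv \<gamma> \<le> r \<Longrightarrow> \<gamma> \<in> A" "\<And>\<gamma>. \<gamma> \<in> A \<Longrightarrow> absv \<gamma> \<le> r"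
  shows "cnt r D = (\<Sum>\<gamma>\<in>A. D \<gamma> * (ln r - ln (max (absv \<gamma>) 1)))"
  unfolding cnt_def using assms by (intro sum.mono_neutral_left) auto

lemma cnt_add_finite:
  assumes "finite {\<gamma>. D \<gamma> \<noteq> 0 \<and> absv \<gamma> \<le> r}" "finite {\<gamma>. E \<gamma> \<noteq> 0 \<and> absv \<gamma> \<le> r}"
  shows "cnt r (\<lambda>\<gamma>. D \<gamma> + E \<gamma>) = cnt r D + cnt r E"
proof -
  let ?A = "{\<gamma>. D \<gamma> \<noteq> 0 \<and> absv \<gamma> \<le> r} \<union> {\<gamma>. E \<gamma> \<noteq> 0 \<and> absv \<gamma> \<le> r}"
  have A: "finite ?A" using assms by simp
  have "cnt r (\<lambda>\<gamma>. D \<gamma> + E \<gamma>) = (\<Sum>\<gamma>\<in>?A. (D \<gamma> + E \<gamma>) * (ln r - ln (max (absv \<gamma>) 1)))"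
    by (rule cnt_eq_sum[OF A]) auto
  moreover have "cnt r D = (\<Sum>\<gamma>\<in>?A. D \<gamma> * (ln r - ln (max (absv \<gamma>) 1)))"
    by (rule cnt_eq_sum[OF A]) auto
  moreover have "cnt r E = (\<Sum>\<gamma>\<in>?A. E \<gamma> * (ln r - ln (max (absv \<gamma>) 1)))"
    by (rule cnt_eq_sum[OF A]) auto
  ultimately show ?thesis by (simp add: sum.distrib distrib_right)
qed

lemma cnt_add: "locfin D \<Longrightarrow> locfin E \<Longrightarrow> cnt r (\<lambda>\<gamma>. D \<gamma> + E \<gamma>) = cnt r D + cnt r E"
  by (simp add: cnt_add_finite locfinD)

lemma cnt_0 [simp]: "cnt r (\<lambda>_. 0) = 0"
  by (simp add: cnt_def)

lemma cnt_cmult: "cnt r (\<lambda>\<gamma>. c * D \<gamma>) = c * cnt r D"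
  by (cases "c = 0") (simp_all add: cnt_def sum_distrib_left mult.assoc)

lemma cnt_diff:
  assumes "locfin D" "locfin E"
  shows "cnt r (\<lambda>\<gamma>. D \<gamma> - E \<gamma>) = cnt r D - cnt r E"
  using cnt_add[of D "\<lambda>\<gamma>. - 1 * E \<gamma>" r] cnt_cmult[of r "- 1" E] locfin_cmult[of E "- 1"] assms by simp

lemma cnt_sum:
  assumes "\<And>i. i \<in> I \<Longrightarrow> locfin (D i)"
  shows "cnt r (\<lambda>\<gamma>. \<Sum>i\<in>I. D i \<gamma>) = (\<Sum>i\<in>I. cnt r (D i))"
  using assms by (induction I rule: infinite_finite_induct) (simp_all add: cnt_add)

lemma cnt_nonneg:
  assumes "\<And>\<gamma>. D \<gamma> \<ge> 0" "r \<ge> 1"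
  shows "cnt r D \<ge> 0"
  unfolding cnt_def
proof (rule sum_nonneg)
  fix \<gamma> assume "\<gamma> \<in> {\<gamma>. D \<gamma> \<noteq> 0 \<and> absv \<gamma> \<le> r}"
  then have "ln (max (absv \<gamma>) 1) \<le> ln r" using assms(2) by (subst ln_le_cancel_iff) auto
  then show "0 \<le> D \<gamma> * (ln r - ln (max (absv \<gamma>) 1))" using assms(1) by simp
qed

lemma cnt_mono:
  assumes "locfin D" "locfin E" "\<And>\<gamma>. D \<gamma> \<le> E \<gamma>" "r \<ge> 1"
  shows "cnt r D \<le> cnt r E"
  using cnt_nonneg[of "\<lambda>\<gamma>. E \<gamma> - D \<gamma>" r] assms by (simp add: cnt_diff)

definition dvs :: "'a::complete_ultrametric_field fls \<Rightarrow> 'a \<Rightarrow> real" where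
  "dvs h \<gamma> = real_of_int (mero_order \<gamma> h)"

lemma cnt_point:
  assumes "absv c \<le> r"
  shows "cnt r (\<lambda>\<gamma>. if \<gamma> = c then 1 else 0) = ln r - ln (max (absv c) 1)"
  using assms by (subst cnt_eq_sum[of "{c}"]) (auto split: if_splits)

text \<open>Induction on the number of zeroes in the disc, splitting off a linear factor.\<close>

lemma jensen_entire:
  fixes F :: "'a::{complete_ultrametric_field, alg_closed_field} fps"
  assumes "dominant r F M" "F \<in> entire" "r > 0"
  shows "finite {\<gamma>. dvs (fps_to_fls F) \<gamma> \<noteq> 0 \<and> absv \<gamma> \<le> r} \<and>
    (r \<ge> 1 \<longrightarrow> ln (gnorm r F) = ln (gnorm 1 F) + cnt r (dvs (fps_to_fls F)))"
  using assms
proof (induction M arbitrary: F)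
  case 0
  have "mero_order \<gamma> (fps_to_fls F) = 0" if "absv \<gamma> \<le> r" for \<gamma>
  proof (rule is_ord_mero_order)
    have "ev F \<gamma> \<noteq> 0"
      using absv_ev_dominant_0[OF 0(2,1) that 0(3)] dominant_nonzero(1)[OF 0(1,3)] by auto
    then show "is_ord \<gamma> 0 (fps_to_fls F)"
      unfolding is_ord_def using 0(2) by (intro exI[of _ F] exI[of _ 1]) simp
  qed
  then have empty: "{\<gamma>. dvs (fps_to_fls F) \<gamma> \<noteq> 0 \<and> absv \<gamma> \<le> r} = {}" by (auto simp: dvs_def)
  show ?case
  proof (intro conjI impI)
    show "finite {\<gamma>. dvs (fps_to_fls F) \<gamma> \<noteq> 0 \<and> absv \<gamma> \<le> r}" unfolding empty by simp
    assume "r \<ge> 1"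
    have "gnorm 1 F = absv (fps_nth F 0)"
    proof (rule antisym)
      show "gnorm 1 F \<le> absv (fps_nth F 0)"
      proof (rule gnorm_least)
        fix n
        have "absv (fps_nth F n) * 1 ^ n \<le> absv (fps_nth F n) * r ^ n"
          using \<open>r \<ge> 1\<close> by (intro mult_left_mono power_mono) auto
        also have "\<dots> \<le> absv (fps_nth F 0)" using 0(1) by (simp add: dominant_def)
        finally show "absv (fps_nth F n) * 1 ^ n \<le> absv (fps_nth F 0)" .
      qed
      show "absv (fps_nth F 0) \<le> gnorm 1 F" using gnorm_upper[OF 0(2), of 1 0] by simp
    qed
    moreover have "gnorm r F = absv (fps_nth F 0)" using gnorm_dominant[OF 0(1)] by simp
    moreover have "cnt r (dvs (fps_to_fls F)) = 0"
      unfolding cnt_def empty by simp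
    ultimately show "ln (gnorm r F) = ln (gnorm 1 F) + cnt r (dvs (fps_to_fls F))" by simp
  qed
next
  case (Suc M)
  obtain c where c: "absv c \<le> r" "ev F c = 0"
    using entire_zero_exists[OF Suc.prems(2,1) _ Suc.prems(3)] by auto
  obtain Q where Q: "Q \<in> entire" "F = (fps_X - fps_const c) * Q"
    using entire_factor_root[OF Suc.prems(2) c(2)] by blast
  have dom: "dominant r Q M"
    using dominant_linear_mult[OF Suc.prems(1)[unfolded Q(2)] Q(1) Suc.prems(3)] c by auto
  have "Q \<noteq> 0" using dominant_nonzero[OF dom Suc.prems(3)] by simp
  have eq: "dvs (fps_to_fls F) = (\<lambda>\<gamma>. (if \<gamma> = c then 1 else 0) + dvs (fps_to_fls Q) \<gamma>)"
  proof
    fix \<gamma>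
    have "fps_to_fls F = lin c * fps_to_fls Q"
      unfolding Q(2) fls_times_fps_to_fls lin_eq ..
    then show "dvs (fps_to_fls F) \<gamma> = (if \<gamma> = c then 1 else 0) + dvs (fps_to_fls Q) \<gamma>"
      using Q(1) \<open>Q \<noteq> 0\<close> by (simp add: dvs_def mero_order_lin)
  qed
  have IH: "finite {\<gamma>. dvs (fps_to_fls Q) \<gamma> \<noteq> 0 \<and> absv \<gamma> \<le> r}"
    "r \<ge> 1 \<Longrightarrow> ln (gnorm r Q) = ln (gnorm 1 Q) + cnt r (dvs (fps_to_fls Q))"
    using Suc.IH[OF dom Q(1) Suc.prems(3)] by auto
  have fin1: "finite {\<gamma>. (if \<gamma> = c then 1 else 0 :: real) \<noteq> 0 \<and> absv \<gamma> \<le> r}"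
    by (rule finite_subset[of _ "{c}"]) auto
  show ?case
  proof (intro conjI impI)
    show "finite {\<gamma>. dvs (fps_to_fls F) \<gamma> \<noteq> 0 \<and> absv \<gamma> \<le> r}"
      unfolding eq by (rule finite_subset[OF _ finite_UnI[OF fin1 IH(1)]]) auto
    assume r: "r \<ge> 1"
    \<comment> \<open>The linear factor has norm \<open>r\<close> at radius \<open>r\<close>, but
      \<open>max (absv c) 1\<close> at radius 1. The quotient is the weight of \<open>c\<close> in
      \<open>cnt\<close>, which explains the cut-off at the unit circle.\<close>
    have "ln (gnorm r F) = ln r + ln (gnorm r Q)"
      unfolding Q(2) using Q(1) c r gnorm_pos[OF Q(1) \<open>Q \<noteq> 0\<close>, of r]
      by (simp add: gnorm_mult gnorm_linear ln_mult max_absorb1)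
    moreover have "ln (gnorm 1 F) = ln (max (absv c) 1) + ln (gnorm 1 Q)"
      unfolding Q(2) using Q(1) gnorm_pos[OF Q(1) \<open>Q \<noteq> 0\<close>, of 1]
      by (simp add: gnorm_mult gnorm_linear ln_mult max.commute)
    moreover have "cnt r (dvs (fps_to_fls F)) = ln r - ln (max (absv c) 1) + cnt r (dvs (fps_to_fls Q))"
      unfolding eq using cnt_add_finite[OF fin1 IH(1)] c cnt_point[of c r] by simp
    ultimately show "ln (gnorm r F) = ln (gnorm 1 F) + cnt r (dvs (fps_to_fls F))"
      using IH(2)[OF r] by simp
  qed
qed

lemma locfin_dvs_entire:
  fixes F :: "'a::{complete_ultrametric_field, alg_closed_field} fps"
  assumes "F \<in> entire" "F \<noteq> 0"
  shows "locfin (dvs (fps_to_fls F))"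
  unfolding locfin_def
proof
  fix r :: real
  have "max r 1 > 0" by simp
  with assms obtain M where "dominant (max r 1) F M" using dominant_exists by blast
  from jensen_entire[OF this assms(1)]
  have "finite {\<gamma>. dvs (fps_to_fls F) \<gamma> \<noteq> 0 \<and> absv \<gamma> \<le> max r 1}" by simp
  then show "finite {\<gamma>. dvs (fps_to_fls F) \<gamma> \<noteq> 0 \<and> absv \<gamma> \<le> r}"
    by (rule rev_finite_subset) auto
qed

lemma dvs_divide:
  assumes "F \<in> entire" "F \<noteq> 0" "G \<in> entire" "G \<noteq> 0"
  shows "dvs (fps_to_fls F / fps_to_fls G) = (\<lambda>\<gamma>. dvs (fps_to_fls F) \<gamma> - dvs (fps_to_fls G) \<gamma>)"
  using assms by (simp add: dvs_def fun_eq_iff)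

lemma locfin_dvs [simp]:
  fixes h :: "'a::{complete_ultrametric_field, alg_closed_field} fls"
  assumes "h \<in> mero" "h \<noteq> 0"
  shows "locfin (dvs h)"
proof -
  from assms(1) obtain F G where *: "F \<in> entire" "G \<in> entire" "G \<noteq> 0" "h = fps_to_fls F / fps_to_fls G"
    by (rule meroE)
  then have "F \<noteq> 0" using assms(2) by auto
  then show ?thesis
    unfolding *(4) using * by (simp add: dvs_divide locfin_dvs_entire)
qed

lemma jensen:
  fixes h :: "'a::{complete_ultrametric_field, alg_closed_field} fls"
  assumes "h \<in> mero" "h \<noteq> 0" "r \<ge> 1"
  shows "ln (mnorm r h) = ln (mnorm 1 h) + cnt r (dvs h)"
proof -
  from assms(1) obtain F G where *: "F \<in> entire" "G \<in> entire" "G \<noteq> 0" "h = fps_to_fls F / fps_to_fls G"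
    by (rule meroE)
  then have "F \<noteq> 0" using assms(2) by auto
  have r: "r > 0" using assms(3) by simp
  obtain M N where "dominant r F M" "dominant r G N"
    using dominant_exists * \<open>F \<noteq> 0\<close> r by blast
  then have "ln (gnorm r F) = ln (gnorm 1 F) + cnt r (dvs (fps_to_fls F))"
    "ln (gnorm r G) = ln (gnorm 1 G) + cnt r (dvs (fps_to_fls G))"
    using jensen_entire * r assms(3) by blast+
  moreover have "gnorm r F > 0" "gnorm r G > 0" "gnorm 1 F > 0" "gnorm 1 G > 0"
    using gnorm_pos[of _ r] gnorm_pos[of _ 1] * \<open>F \<noteq> 0\<close> r by auto
  ultimately show ?thesis
    unfolding *(4) using * \<open>F \<noteq> 0\<close> r
    by (simp add: mnorm_eq ln_divide_pos dvs_divide cnt_diff locfin_dvs_entire)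
qed

section \<open>Translations\<close>

text \<open>For \<open>absv c \<le> r\<close> the translation maps the disc of radius
  \<open>r\<close> to itself. In Horner form each step multiplies by a linear polynomial of norm
  \<open>r\<close>, exactly as without the translation.\<close>

lemma gnorm_pcompose_le:
  assumes "r > 0" "absv c \<le> r"
  shows "gnorm r (fps_of_poly (pcompose p [:c, 1:])) \<le> gnorm r (fps_of_poly p)"
proof (induction p)
  case (pCons a p)
  let ?q = "pcompose p [:c, 1:]"
  have upper: "absv (coeff (pCons a p) n) * r ^ n \<le> gnorm r (fps_of_poly (pCons a p))" for n
    using gnorm_upper[of "fps_of_poly (pCons a p)" r n] assms by simp
  have "fps_of_poly [:c, 1:] = fps_X - fps_const (- c)"
    by (simp add: fps_of_poly_pCons flip: fps_const_neg)
  then have eq: "fps_of_poly (pcompose (pCons a p) [:c, 1:]) =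
      fps_const a + (fps_X - fps_const (- c)) * fps_of_poly ?q"
    by (simp add: pcompose_pCons fps_of_poly_add fps_of_poly_mult fps_of_poly_const)
  have "gnorm r (fps_of_poly (pcompose (pCons a p) [:c, 1:])) \<le>
      max (gnorm r (fps_const a)) (gnorm r ((fps_X - fps_const (- c)) * fps_of_poly ?q))"
    unfolding eq using assms by (intro gnorm_add_le entire_mult entire_diff) simp_all
  also have "\<dots> = max (absv a) (r * gnorm r (fps_of_poly ?q))"
    using gnorm_mult[of "fps_X - fps_const (- c)" "fps_of_poly ?q" r] gnorm_linear[of r "- c"] assms
    by (simp add: max_absorb1 del: fps_const_neg)
  also have "\<dots> \<le> gnorm r (fps_of_poly (pCons a p))"
  proof (rule max.boundedI)
    show "absv a \<le> gnorm r (fps_of_poly (pCons a p))" using upper[of 0] by simp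
    have "gnorm r (fps_of_poly p) \<le> gnorm r (fps_of_poly (pCons a p)) / r"
    proof (rule gnorm_least)
      fix n
      show "absv (fps_nth (fps_of_poly p) n) * r ^ n \<le> gnorm r (fps_of_poly (pCons a p)) / r"
        using upper[of "Suc n"] assms by (simp add: field_simps)
    qed
    then have "r * gnorm r (fps_of_poly p) \<le> gnorm r (fps_of_poly (pCons a p))"
      using assms by (simp add: field_simps)
    moreover have "r * gnorm r (fps_of_poly ?q) \<le> r * gnorm r (fps_of_poly p)"
      using pCons.IH assms by (intro mult_left_mono) auto
    ultimately show "r * gnorm r (fps_of_poly ?q) \<le> gnorm r (fps_of_poly (pCons a p))" by linarith
  qed
  finally show ?case .
qed simp

text \<open>Instead of rearranging a double series, the truncations are translated. Since this does
  not increase norms of radius at least \<open>absv c\<close>, the translates form a Cauchy sequence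
  for all these norms, and their coefficientwise limit is the function sought.\<close>

lemma entire_translate_exists:
  fixes F :: "'a::complete_ultrametric_field fps"
  assumes F: "F \<in> entire"
  shows "\<exists>G\<in>entire. \<forall>x. ev G x = ev F (x + c)"
proof -
  define p where "p n = trunc_poly n F" for n
  define q where "q n = pcompose (p n) [:c, 1:]" for n
  have close: "\<exists>N. \<forall>m\<ge>N. \<forall>n\<ge>N. gnorm r (fps_of_poly (q m - q n)) \<le> e"
    if r: "r > 0" "absv c \<le> r" and e: "e > 0" for r e
  proof -
    obtain N where N: "\<And>n. n \<ge> N \<Longrightarrow> gnorm r (F - fps_of_poly (p n)) \<le> e"
      using gnorm_trunc_poly[OF F r(1) e] unfolding p_def by blast
    have "gnorm r (fps_of_poly (q m - q n)) \<le> e" if "m \<ge> N" "n \<ge> N" for m n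
    proof -
      have "gnorm r (fps_of_poly (q m - q n)) \<le> gnorm r (fps_of_poly (p m - p n))"
        unfolding q_def pcompose_diff[symmetric] using r by (intro gnorm_pcompose_le)
      also have "fps_of_poly (p m - p n) = (F - fps_of_poly (p n)) + - (F - fps_of_poly (p m))"
        by (simp add: fps_of_poly_diff)
      also have "gnorm r \<dots> \<le> max (gnorm r (F - fps_of_poly (p n))) (gnorm r (- (F - fps_of_poly (p m))))"
        using F r by (intro gnorm_add_le entire_uminus entire_diff) simp_all
      also have "gnorm r (- (F - fps_of_poly (p m))) = gnorm r (F - fps_of_poly (p m))"
        by (simp only: gnorm_def fps_neg_nth absv_minus)
      finally show ?thesis using N[OF that(1)] N[OF that(2)] by simp
    qed
    then show ?thesis by blast
  qed
  have conv: "convergent (\<lambda>n. coeff (q n) i)" for i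
  proof (rule Cauchy_convergent, rule metric_CauchyI)
    fix e :: real assume "e > 0"
    define r where "r = max 1 (absv c)"
    have r: "r > 0" "absv c \<le> r" "1 \<le> r" by (auto simp: r_def)
    obtain N where N: "\<And>m n. m \<ge> N \<Longrightarrow> n \<ge> N \<Longrightarrow> gnorm r (fps_of_poly (q m - q n)) \<le> e / 2"
      using close[OF r(1,2), of "e / 2"] \<open>e > 0\<close> by auto
    have "dist (coeff (q m) i) (coeff (q n) i) < e" if "m \<ge> N" "n \<ge> N" for m n
    proof -
      have "absv (coeff (q m - q n) i) * 1 \<le> absv (coeff (q m - q n) i) * r ^ i"
        using r by (intro mult_left_mono) auto
      also have "\<dots> \<le> gnorm r (fps_of_poly (q m - q n))"
        using gnorm_upper[of "fps_of_poly (q m - q n)" r i] r by simp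
      also have "\<dots> \<le> e / 2" using N that by simp
      finally show ?thesis using \<open>e > 0\<close> by (simp add: dist_absv)
    qed
    then show "\<exists>M. \<forall>m\<ge>M. \<forall>n\<ge>M. dist (coeff (q m) i) (coeff (q n) i) < e" by blast
  qed
  define G where "G = Abs_fps (\<lambda>i. lim (\<lambda>n. coeff (q n) i))"
  have lim: "(\<lambda>n. coeff (q n) i) \<longlonglongrightarrow> fps_nth G i" for i
    using conv[of i] by (simp add: G_def convergent_LIMSEQ_iff)
  have approx: "\<exists>N. \<forall>n\<ge>N. \<forall>i. absv (fps_nth (G - fps_of_poly (q n)) i) * r ^ i \<le> e"
    if r: "r > 0" "absv c \<le> r" and e: "e > 0" for r e
  proof -
    obtain N where N: "\<And>m n. m \<ge> N \<Longrightarrow> n \<ge> N \<Longrightarrow> gnorm r (fps_of_poly (q m - q n)) \<le> e"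
      using close[OF r e] by auto
    have "absv (fps_nth (G - fps_of_poly (q n)) i) * r ^ i \<le> e" if "n \<ge> N" for n i
    proof -
      have "absv (fps_nth G i - coeff (q n) i) \<le> e / r ^ i"
      proof (rule absv_le_if_tendsto)
        show "(\<lambda>m. coeff (q (m + N)) i - coeff (q n) i) \<longlonglongrightarrow> fps_nth G i - coeff (q n) i"
          by (intro tendsto_diff LIMSEQ_ignore_initial_segment[OF lim] tendsto_const)
        fix m
        have "absv (coeff (q (m + N) - q n) i) * r ^ i \<le> gnorm r (fps_of_poly (q (m + N) - q n))"
          using gnorm_upper[of "fps_of_poly (q (m + N) - q n)" r i] r by simp
        also have "\<dots> \<le> e" using N that by simp
        finally show "absv (coeff (q (m + N)) i - coeff (q n) i) \<le> e / r ^ i"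
          using r by (simp add: field_simps)
      qed
      then show ?thesis using r by (simp add: field_simps)
    qed
    then show ?thesis by blast
  qed
  have G: "G \<in> entire"
  proof (rule entire_epsI)
    fix r e :: real assume r: "r > 0" and e: "e > 0"
    define s where "s = max r (absv c)"
    have s: "s > 0" "absv c \<le> s" "r \<le> s" using r by (auto simp: s_def)
    obtain n where n: "\<And>i. absv (fps_nth (G - fps_of_poly (q n)) i) * s ^ i \<le> e"
      using approx[OF s(1,2) e] by auto
    have "absv (fps_nth G i) * r ^ i \<le> e" if "i \<ge> Suc (degree (q n))" for i
    proof -
      have "absv (fps_nth G i) * r ^ i \<le> absv (fps_nth G i) * s ^ i"
        using r s by (intro mult_left_mono power_mono) auto
      then show ?thesis using n[of i] that by (simp add: coeff_eq_0)
    qed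
    then show "\<exists>N. \<forall>i\<ge>N. absv (fps_nth G i) * r ^ i \<le> e" by blast
  qed
  have "ev G x = ev F (x + c)" for x
  proof -
    define r where "r = max 1 (max (absv c) (absv x))"
    have r: "r > 0" "absv c \<le> r" "absv x \<le> r" by (auto simp: r_def)
    have xc: "absv (x + c) \<le> r" using absv_add_le_max[of x c] r by simp
    have "absv (ev G x - ev F (x + c)) \<le> e" if e: "e > 0" for e
    proof -
      obtain N where N: "\<And>n i. n \<ge> N \<Longrightarrow> absv (fps_nth (G - fps_of_poly (q n)) i) * r ^ i \<le> e"
        using approx[OF r(1,2) e] by auto
      obtain N' where N': "\<And>n. n \<ge> N' \<Longrightarrow> gnorm r (F - fps_of_poly (p n)) \<le> e"
        using gnorm_trunc_poly[OF F r(1) e] unfolding p_def by blast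
      define n where "n = max N N'"
      have "absv (ev (G - fps_of_poly (q n)) x) \<le> gnorm r (G - fps_of_poly (q n))"
        using G r by (intro absv_ev_le) auto
      also have "\<dots> \<le> e" by (rule gnorm_least, rule N) (simp add: n_def)
      finally have 1: "absv (ev G x - poly (p n) (x + c)) \<le> e"
        using G by (simp add: ev_diff q_def poly_pcompose add.commute)
      have "absv (ev (F - fps_of_poly (p n)) (x + c)) \<le> gnorm r (F - fps_of_poly (p n))"
        using F r xc by (intro absv_ev_le) auto
      also have "\<dots> \<le> e" by (rule N') (simp add: n_def)
      finally have 2: "absv (ev F (x + c) - poly (p n) (x + c)) \<le> e"
        using F by (simp add: ev_diff)
      show ?thesis
        using 1 2 absv_diff_le_max[of "ev G x - poly (p n) (x + c)" "ev F (x + c) - poly (p n) (x + c)"]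
        by simp
    qed
    then have "absv (ev G x - ev F (x + c)) \<le> 0" by (rule dense_ge)
    then have "absv (ev G x - ev F (x + c)) = 0" by (rule antisym) simp
    then show ?thesis by simp
  qed
  then show ?thesis using G by blast
qed

text \<open>The zeroes of a non-zero entire function are locally finite, but the unit disc contains
  all natural numbers, which are infinitely many in characteristic zero.\<close>

lemma entire_eq_0I:
  fixes F :: "'a::{complete_ultrametric_field, alg_closed_field, field_char_0} fps"
  assumes F: "F \<in> entire" and zero: "\<And>x. ev F x = 0"
  shows "F = 0"
proof (rule ccontr)
  assume "F \<noteq> 0"
  have "dvs (fps_to_fls F) x \<noteq> 0" for x
  proof -
    obtain Q where Q: "Q \<in> entire" "F = (fps_X - fps_const x) * Q"
      using entire_factor_root[OF F zero] by blast
    have "Q \<noteq> 0" using Q(2) \<open>F \<noteq> 0\<close> by auto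
    have "vge x (1 + 0) (lin x * fps_to_fls Q)" using Q(1) by (intro vge_mult) simp_all
    then have "vge x 1 (fps_to_fls F)" unfolding Q(2) fls_times_fps_to_fls lin_eq by simp
    then show ?thesis using F \<open>F \<noteq> 0\<close> by (simp add: vge_iff dvs_def)
  qed
  then have "{x. absv x \<le> 1} = {x. dvs (fps_to_fls F) x \<noteq> 0 \<and> absv x \<le> 1}" by auto
  then have "finite {x :: 'a. absv x \<le> 1}"
    using locfinD[OF locfin_dvs_entire[OF F \<open>F \<noteq> 0\<close>], of 1] by simp
  then have "finite (range (of_nat :: nat \<Rightarrow> 'a))"
    by (rule rev_finite_subset) (auto simp: absv_of_nat_le_1)
  moreover have "infinite (range (of_nat :: nat \<Rightarrow> 'a))"
    using finite_imageD[OF _ inj_of_nat] infinite_UNIV_nat by blast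
  ultimately show False by blast
qed

lemma entire_eqI:
  fixes F G :: "'a::{complete_ultrametric_field, alg_closed_field, field_char_0} fps"
  assumes "F \<in> entire" "G \<in> entire" "\<And>x. ev F x = ev G x"
  shows "F = G"
  using entire_eq_0I[of "F - G"] assms by (simp add: ev_diff)

text \<open>Shows that the description in \<open>translate\<close> is unique. Cross products of two
  representations agree at all points after translating, hence as power series by
  \<open>entire_eqI\<close>.\<close>

lemma translate_eq:
  fixes F G F' G' :: "'a::{complete_ultrametric_field, alg_closed_field, field_char_0} fps"
  assumes "F \<in> entire" "G \<in> entire" "F' \<in> entire" "G' \<in> entire" "G \<noteq> 0"
    and "\<And>x. ev F' x = ev F (x + c)" "\<And>x. ev G' x = ev G (x + c)"
  shows "G' \<noteq> 0" "translate c (fps_to_fls F / fps_to_fls G) = fps_to_fls F' / fps_to_fls G'"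
proof -
  have ev_shift_back: "ev H x = ev H (x - c + c)" for H :: "'a fps" and x by simp
  show nz: "G' \<noteq> 0"
  proof
    assume "G' = 0"
    then have "ev G (x + c) = 0" for x using assms(7)[of x] by simp
    then have "ev G x = 0" for x using ev_shift_back[of G x] by metis
    then show False using entire_eq_0I[OF assms(2)] assms(5) by blast
  qed
  show "translate c (fps_to_fls F / fps_to_fls G) = fps_to_fls F' / fps_to_fls G'"
    unfolding translate_def
  proof (rule the_equality)
    show "\<exists>F1 G1 F1' G1'. F1 \<in> entire \<and> G1 \<in> entire \<and> F1' \<in> entire \<and> G1' \<in> entire \<and>
       G1 \<noteq> 0 \<and> G1' \<noteq> 0 \<and> (\<forall>x. ev F1' x = ev F1 (x + c)) \<and> (\<forall>x. ev G1' x = ev G1 (x + c)) \<and>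
       fps_to_fls F / fps_to_fls G = fps_to_fls F1 / fps_to_fls G1 \<and>
       fps_to_fls F' / fps_to_fls G' = fps_to_fls F1' / fps_to_fls G1'"
      using assms nz by blast
  next
    fix h'
    assume "\<exists>F1 G1 F1' G1'. F1 \<in> entire \<and> G1 \<in> entire \<and> F1' \<in> entire \<and> G1' \<in> entire \<and>
       G1 \<noteq> 0 \<and> G1' \<noteq> 0 \<and> (\<forall>x. ev F1' x = ev F1 (x + c)) \<and> (\<forall>x. ev G1' x = ev G1 (x + c)) \<and>
       fps_to_fls F / fps_to_fls G = fps_to_fls F1 / fps_to_fls G1 \<and>
       h' = fps_to_fls F1' / fps_to_fls G1'"
    then obtain F1 G1 F1' G1' where *: "F1 \<in> entire" "G1 \<in> entire" "F1' \<in> entire" "G1' \<in> entire"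
       "G1 \<noteq> 0" "G1' \<noteq> 0" "\<And>x. ev F1' x = ev F1 (x + c)" "\<And>x. ev G1' x = ev G1 (x + c)"
       "fps_to_fls F / fps_to_fls G = fps_to_fls F1 / fps_to_fls G1"
       "h' = fps_to_fls F1' / fps_to_fls G1'" by blast
    have "fps_to_fls (F * G1) = fps_to_fls (F1 * G)"
      using *(5,9) assms(5) by (simp add: frac_eq_eq fls_times_fps_to_fls)
    then have eq: "F * G1 = F1 * G" by (simp only: fps_to_fls_eq_iff)
    have "F' * G1' = F1' * G'"
    proof (rule entire_eqI)
      fix x
      have "ev (F * G1) (x + c) = ev (F1 * G) (x + c)" by (simp only: eq)
      then show "ev (F' * G1') x = ev (F1' * G') x" using assms * by (simp add: ev_mult)
    qed (use assms * in simp_all)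
    then have "fps_to_fls F' * fps_to_fls G1' = fps_to_fls F1' * fps_to_fls G'"
      by (metis fls_times_fps_to_fls)
    then show "h' = fps_to_fls F' / fps_to_fls G'"
      unfolding *(10) using nz *(6) by (simp add: frac_eq_eq)
  qed
qed

lemma is_ord_translate:
  fixes h :: "'a::{complete_ultrametric_field, alg_closed_field, field_char_0} fls"
  assumes "is_ord (\<gamma> + c) m h"
  shows "is_ord \<gamma> m (translate c h)"
proof -
  from assms obtain F G where FG: "F \<in> entire" "G \<in> entire" "ev F (\<gamma> + c) \<noteq> 0" "ev G (\<gamma> + c) \<noteq> 0"
    and h: "h = lin (\<gamma> + c) powi m * fps_to_fls F / fps_to_fls G" unfolding is_ord_def by blast
  obtain F' G' where F'G': "F' \<in> entire" "G' \<in> entire" "\<And>x. ev F' x = ev F (x + c)"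
    "\<And>x. ev G' x = ev G (x + c)"
    using entire_translate_exists FG(1,2) by metis
  have nz: "F \<noteq> 0" "G \<noteq> 0" using FG(3,4) by auto
  let ?t = "\<lambda>\<gamma>. fps_X - fps_const \<gamma> :: 'a fps"
  have t_nz: "?t z \<noteq> 0" for z
    using lin_nonzero[of z] unfolding lin_eq by (metis fps_zero_to_fls)
  have "translate c h = lin \<gamma> powi m * fps_to_fls F' / fps_to_fls G'"
  proof (cases "m \<ge> 0")
    case True
    define k where "k = nat m"
    have m: "m = int k" using True by (simp add: k_def)
    have "h = fps_to_fls (?t (\<gamma> + c) ^ k * F) / fps_to_fls G"
      unfolding h m power_int_of_nat lin_eq by (simp only: fls_times_fps_to_fls fps_to_fls_power)
    also have "translate c \<dots> = fps_to_fls (?t \<gamma> ^ k * F') / fps_to_fls G'"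
      using FG F'G' nz by (intro translate_eq(2)) (simp_all add: ev_mult ev_power)
    also have "\<dots> = lin \<gamma> powi m * fps_to_fls F' / fps_to_fls G'"
      unfolding m power_int_of_nat lin_eq by (simp only: fls_times_fps_to_fls fps_to_fls_power)
    finally show ?thesis .
  next
    \<comment> \<open>A negative power of the linear factor belongs to the denominator, since
      \<open>translate_eq\<close> speaks of quotients of entire functions.\<close>
    case False
    define k where "k = nat (- m)"
    have m: "m = - int k" using False by (simp add: k_def)
    have "h = fps_to_fls F / fps_to_fls (?t (\<gamma> + c) ^ k * G)"
      unfolding h m power_int_minus power_int_of_nat fls_times_fps_to_fls fps_to_fls_power lin_eq[symmetric]
      by (simp add: field_simps)
    also have "translate c \<dots> = fps_to_fls F' / fps_to_fls (?t \<gamma> ^ k * G')"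
      using FG F'G' nz t_nz by (intro translate_eq(2)) (simp_all add: ev_mult ev_power)
    also have "\<dots> = lin \<gamma> powi m * fps_to_fls F' / fps_to_fls G'"
      unfolding m power_int_minus power_int_of_nat fls_times_fps_to_fls fps_to_fls_power lin_eq[symmetric]
      by (simp add: field_simps)
    finally show ?thesis .
  qed
  then show ?thesis
    unfolding is_ord_def using F'G' FG(3,4) by (intro exI[of _ F'] exI[of _ G']) simp
qed

lemma mero_order_translate:
  fixes h :: "'a::{complete_ultrametric_field, alg_closed_field, field_char_0} fls"
  assumes "h \<in> mero" "h \<noteq> 0"
  shows "mero_order \<gamma> (translate c h) = mero_order (\<gamma> + c) h"
  using is_ord_translate[OF is_ord_mero_order_self[OF assms]] by (rule is_ord_mero_order)

lemma translate_mero: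
  fixes h :: "'a::{complete_ultrametric_field, alg_closed_field, field_char_0} fls"
  assumes "h \<in> mero" "h \<noteq> 0"
  shows "translate c h \<in> mero" "translate c h \<noteq> 0"
proof -
  have "is_ord 0 (mero_order (0 + c) h) (translate c h)"
    by (intro is_ord_translate is_ord_mero_order_self assms)
  then show "translate c h \<in> mero" "translate c h \<noteq> 0"
    using is_ord_imp_vge vge_mero is_ord_nonzero by blast+
qed

section \<open>The characteristic function\<close>

definition zd :: "'a::complete_ultrametric_field fls \<Rightarrow> 'a \<Rightarrow> real" where
  "zd h \<gamma> = max 0 (dvs h \<gamma>)"

definition pd :: "'a::complete_ultrametric_field fls \<Rightarrow> 'a \<Rightarrow> real" where
  "pd h \<gamma> = max 0 (- dvs h \<gamma>)"

text \<open>A variant of \<open>T_char\<close> that needs no assumption on the origin.\<close>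

definition nev :: "real \<Rightarrow> 'a::complete_ultrametric_field fls \<Rightarrow> real" where
  "nev r h = cnt r (pd h) + max 0 (ln (mnorm r h))"

lemma locfin_zd [simp]: "h \<in> mero \<Longrightarrow> h \<noteq> 0 \<Longrightarrow> locfin (zd (h :: 'a::{complete_ultrametric_field, alg_closed_field, field_char_0} fls))"
  using locfin_dvs[of h] by (rule locfin_mono) (auto simp: zd_def)

lemma locfin_pd [simp]: "h \<in> mero \<Longrightarrow> h \<noteq> 0 \<Longrightarrow> locfin (pd (h :: 'a::{complete_ultrametric_field, alg_closed_field, field_char_0} fls))"
  using locfin_dvs[of h] by (rule locfin_mono) (auto simp: pd_def)

text \<open>Translation by \<open>c\<close> permutes the disc of radius
  \<open>r \<ge> absv c\<close>, and the weights of \<open>\<gamma>\<close> and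
  \<open>\<gamma> - c\<close> agree once \<open>absv \<gamma>\<close> exceeds 1 and
  \<open>absv c\<close>. Only the finitely many remaining points contribute to \<open>C\<close>,
  independently of \<open>r\<close>. The abstract \<open>ord\<close> lets the lemma serve zeroes as
  well as poles.\<close>

lemma Z_count_translate:
  fixes k :: "'a::{complete_ultrametric_field, alg_closed_field, field_char_0} fls"
  assumes ord: "\<And>\<gamma>. mero_order \<gamma> k = ord (\<gamma> + c)" and lf: "locfin (\<lambda>\<gamma>. of_int (ord \<gamma>))"
  shows "\<exists>C. \<forall>r\<ge>max 1 (absv c). Z_count r k = cnt r (\<lambda>\<gamma>. max 0 (of_int (ord \<gamma>))) + C"
proof -
  define R where "R = max 1 (absv c)"
  define S where "S r = {\<gamma>. ord \<gamma> > 0 \<and> absv \<gamma> \<le> r}" for r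
  have fin: "finite (S r)" for r
    by (rule finite_subset[OF _ locfinD[OF lf, of r]]) (auto simp: S_def)
  define C where "C = (\<Sum>\<gamma>\<in>S R. of_int (ord \<gamma>) * (ln (max (absv \<gamma>) 1) - ln (absv (\<gamma> - c))))"
  have "Z_count r k = cnt r (\<lambda>\<gamma>. max 0 (of_int (ord \<gamma>))) + C" if r: "r \<ge> R" for r
  proof -
    have c: "absv c \<le> r" using r by (simp add: R_def)
    have iff: "absv \<gamma> \<le> r \<longleftrightarrow> absv (\<gamma> + c) \<le> r" for \<gamma>
      using absv_add_le_max[of \<gamma> c] absv_diff_le_max[of "\<gamma> + c" c] c by auto
    have "Z_count r k = (\<Sum>\<gamma> | ord (\<gamma> + c) > 0 \<and> absv (\<gamma> + c) \<le> r.
        of_int (ord (\<gamma> + c)) * (ln r - ln (absv \<gamma>)))"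
      unfolding Z_count_def ord using iff by simp
    also have "\<dots> = (\<Sum>\<gamma>\<in>S r. of_int (ord \<gamma>) * (ln r - ln (absv (\<gamma> - c))))"
      by (rule sum.reindex_bij_witness[of _ "\<lambda>\<gamma>. \<gamma> - c" "\<lambda>\<gamma>. \<gamma> + c"]) (auto simp: S_def)
    also have "\<dots> = (\<Sum>\<gamma>\<in>S r. of_int (ord \<gamma>) * (ln r - ln (max (absv \<gamma>) 1)) +
        of_int (ord \<gamma>) * (ln (max (absv \<gamma>) 1) - ln (absv (\<gamma> - c))))"
      by (intro sum.cong) (auto simp: algebra_simps)
    also have "\<dots> = (\<Sum>\<gamma>\<in>S r. of_int (ord \<gamma>) * (ln r - ln (max (absv \<gamma>) 1))) +
        (\<Sum>\<gamma>\<in>S r. of_int (ord \<gamma>) * (ln (max (absv \<gamma>) 1) - ln (absv (\<gamma> - c))))"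
      by (rule sum.distrib)
    also have "(\<Sum>\<gamma>\<in>S r. of_int (ord \<gamma>) * (ln r - ln (max (absv \<gamma>) 1))) =
        (\<Sum>\<gamma>\<in>S r. max 0 (of_int (ord \<gamma>)) * (ln r - ln (max (absv \<gamma>) 1)))"
      by (intro sum.cong) (auto simp: S_def)
    also have "\<dots> = cnt r (\<lambda>\<gamma>. max 0 (of_int (ord \<gamma>)))"
      by (rule cnt_eq_sum[symmetric, OF fin]) (auto simp: S_def max_def split: if_splits)
    also have "(\<Sum>\<gamma>\<in>S r. of_int (ord \<gamma>) * (ln (max (absv \<gamma>) 1) - ln (absv (\<gamma> - c)))) = C"
      unfolding C_def
    proof (rule sum.mono_neutral_right[OF fin])
      show "S R \<subseteq> S r" using r by (auto simp: S_def)
      show "\<forall>\<gamma>\<in>S r - S R. of_int (ord \<gamma>) * (ln (max (absv \<gamma>) 1) - ln (absv (\<gamma> - c))) = 0"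
      proof
        fix \<gamma> assume "\<gamma> \<in> S r - S R"
        then have "absv \<gamma> > R" by (auto simp: S_def)
        then have "absv (\<gamma> - c) = absv \<gamma>" "max (absv \<gamma>) 1 = absv \<gamma>"
          by (auto simp: R_def intro!: absv_diff_eq_left)
        then show "of_int (ord \<gamma>) * (ln (max (absv \<gamma>) 1) - ln (absv (\<gamma> - c))) = 0" by simp
      qed
    qed
    finally show ?thesis .
  qed
  then show ?thesis unfolding R_def by blast
qed

text \<open>By Jensen's formula the counts of zeroes and of poles differ by
  \<open>ln (mnorm r h)\<close> up to a constant. The maximum of the two is thus the count of poles
  plus the positive part of that logarithm, as in \<open>nev\<close>.\<close>

lemma T_char_translate:
  fixes h :: "'a::{complete_ultrametric_field, alg_closed_field, field_char_0} fls"
  assumes "h \<in> mero" "h \<noteq> 0"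
  shows "\<exists>C. \<forall>r\<ge>max 1 (absv c). \<bar>T_char r (translate c h) - nev r h\<bar> \<le> C"
proof -
  let ?k = "translate c h"
  note k = translate_mero[OF assms, of c]
  have "\<exists>C. \<forall>r\<ge>max 1 (absv c). Z_count r ?k = cnt r (\<lambda>\<gamma>. max 0 (of_int (mero_order \<gamma> h))) + C"
    using locfin_dvs[OF assms]
    by (intro Z_count_translate) (simp_all add: mero_order_translate[OF assms] dvs_def[abs_def])
  then obtain C1 where C1: "\<And>r. r \<ge> max 1 (absv c) \<Longrightarrow> Z_count r ?k = cnt r (zd h) + C1"
    unfolding zd_def[abs_def] dvs_def by blast
  have "\<exists>C. \<forall>r\<ge>max 1 (absv c). Z_count r (1 / ?k) = cnt r (\<lambda>\<gamma>. max 0 (of_int (- mero_order \<gamma> h))) + C"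
    using locfin_cmult[OF locfin_dvs[OF assms], of "- 1"] k
    by (intro Z_count_translate) (simp_all add: mero_order_translate[OF assms] dvs_def[abs_def])
  then obtain C2 where C2: "\<And>r. r \<ge> max 1 (absv c) \<Longrightarrow> N_count r ?k = cnt r (pd h) + C2"
    unfolding pd_def[abs_def] dvs_def N_count_def by auto
  define A where "A = ln (absv (fls_nth ?k 0))"
  have "\<bar>T_char r ?k - nev r h\<bar> \<le> \<bar>C1\<bar> + \<bar>A\<bar> + \<bar>C2\<bar> + \<bar>ln (mnorm 1 h)\<bar>" if r: "r \<ge> max 1 (absv c)" for r
  proof -
    have "dvs h = (\<lambda>\<gamma>. zd h \<gamma> - pd h \<gamma>)" by (auto simp: zd_def pd_def)
    then have "cnt r (dvs h) = cnt r (zd h) - cnt r (pd h)" using assms by (simp add: cnt_diff)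
    then have "ln (mnorm r h) = ln (mnorm 1 h) + cnt r (zd h) - cnt r (pd h)"
      using jensen[OF assms, of r] r by simp
    then show ?thesis
      unfolding T_char_def nev_def C1[OF r] C2[OF r] A_def[symmetric] by linarith
  qed
  then show ?thesis by blast
qed

text \<open>A limit of quotients is of use only where the denominators are positive. The growth
  hypothesis pushes \<open>nev r f\<close> above the bounded difference of the two characteristics,
  and then the limit becomes a linear inequality.\<close>

lemma small_wrt_nev:
  fixes f \<alpha> :: "'a::{complete_ultrametric_field, alg_closed_field, field_char_0} fls"
  assumes small: "small_wrt \<alpha> f" and f: "f \<in> mero" "f \<noteq> 0" and \<alpha>: "\<alpha> \<in> mero" "\<alpha> \<noteq> 0"
    and growth: "\<And>r. r \<ge> 1 \<Longrightarrow> ln r \<le> A * nev r f + B" "A > 0" and e: "e > 0"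
  shows "\<exists>C R. \<forall>r\<ge>R. nev r \<alpha> \<le> e * nev r f + C"
proof -
  obtain c where lim: "((\<lambda>r. T_char r (translate c \<alpha>) / T_char r (translate c f)) \<longlongrightarrow> 0) at_top"
    using small unfolding small_wrt_def by blast
  obtain C1 where C1: "\<And>r. r \<ge> max 1 (absv c) \<Longrightarrow> \<bar>T_char r (translate c f) - nev r f\<bar> \<le> C1"
    using T_char_translate[OF f, of c] by blast
  obtain C2 where C2: "\<And>r. r \<ge> max 1 (absv c) \<Longrightarrow> \<bar>T_char r (translate c \<alpha>) - nev r \<alpha>\<bar> \<le> C2"
    using T_char_translate[OF \<alpha>, of c] by blast
  obtain R1 where R1: "\<And>r. r \<ge> R1 \<Longrightarrow> T_char r (translate c \<alpha>) / T_char r (translate c f) < e"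
    using order_tendstoD(2)[OF lim e] unfolding eventually_at_top_linorder by blast
  \<comment> \<open>The exponential is chosen such that growth gives
    \<open>nev r f \<ge> C1 + 1\<close>, hence a positive denominator.\<close>
  define R where "R = max (max 1 (absv c)) (max R1 (exp (A * (C1 + 1) + B)))"
  have "nev r \<alpha> \<le> e * nev r f + (e * C1 + C2)" if "r \<ge> R" for r
  proof -
    have r: "r \<ge> max 1 (absv c)" "r \<ge> R1" "r \<ge> exp (A * (C1 + 1) + B)" "r \<ge> 1"
      using that by (auto simp: R_def)
    have "A * (C1 + 1) + B \<le> ln r" using r(3,4) by (subst ln_ge_iff) auto
    then have "A * (C1 + 1) \<le> A * nev r f" using growth(1)[OF r(4)] by linarith
    then have "C1 + 1 \<le> nev r f" using growth(2) by simp
    then have pos: "T_char r (translate c f) > 0" using C1[OF r(1)] by linarith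
    then have "T_char r (translate c \<alpha>) < e * T_char r (translate c f)"
      using R1[OF r(2)] by (simp add: pos_divide_less_eq)
    also have "\<dots> \<le> e * (nev r f + C1)" using C1[OF r(1)] e by (intro mult_left_mono) linarith+
    finally show ?thesis using C2[OF r(1)] by (simp add: distrib_left)
  qed
  then show ?thesis by blast
qed

section \<open>First main theorem and estimates of divisors\<close>

lemma nev_nonneg: "r \<ge> 1 \<Longrightarrow> nev r h \<ge> 0"
  unfolding nev_def by (intro add_nonneg_nonneg cnt_nonneg) (simp_all add: pd_def)

lemma zd_nonneg [simp]: "0 \<le> zd h \<gamma>" and pd_nonneg [simp]: "0 \<le> pd h \<gamma>"
  by (simp_all add: zd_def pd_def)

lemma dvs_mult: "g \<in> mero \<Longrightarrow> h \<in> mero \<Longrightarrow> g \<noteq> 0 \<Longrightarrow> h \<noteq> 0 \<Longrightarrow> dvs (g * h) \<gamma> = dvs g \<gamma> + dvs h \<gamma>"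
  by (simp add: dvs_def)

lemma dvs_power: "h \<in> mero \<Longrightarrow> h \<noteq> 0 \<Longrightarrow> dvs (h ^ n) \<gamma> = real n * dvs h \<gamma>"
  by (simp add: dvs_def)

lemma dvs_prod:
  assumes "\<And>i. i \<in> I \<Longrightarrow> h i \<in> mero" "\<And>i. i \<in> I \<Longrightarrow> h i \<noteq> 0"
  shows "dvs (prod h I) \<gamma> = (\<Sum>i\<in>I. dvs (h i) \<gamma>)"
  using assms by (simp add: dvs_def mero_order_prod)

lemma cnt_zd:
  fixes h :: "'a::{complete_ultrametric_field, alg_closed_field, field_char_0} fls"
  assumes "h \<in> mero" "h \<noteq> 0" "r \<ge> 1"
  shows "cnt r (zd h) = ln (mnorm r h) - ln (mnorm 1 h) + cnt r (pd h)"
proof -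
  have "dvs h = (\<lambda>\<gamma>. zd h \<gamma> - pd h \<gamma>)" by (auto simp: zd_def pd_def)
  then have "cnt r (dvs h) = cnt r (zd h) - cnt r (pd h)" using assms by (simp add: cnt_diff)
  then show ?thesis using jensen[OF assms] by simp
qed

text \<open>The first main theorem for the value 0: Jensen's formula with the logarithm replaced by
  its positive part.\<close>

lemma cnt_zd_le_nev:
  fixes h :: "'a::{complete_ultrametric_field, alg_closed_field, field_char_0} fls"
  assumes "h \<in> mero" "h \<noteq> 0"
  shows "\<exists>C. \<forall>r\<ge>1. cnt r (zd h) \<le> nev r h + C"
  using cnt_zd[OF assms] unfolding nev_def by (intro exI[of _ "\<bar>ln (mnorm 1 h)\<bar>"]) force

lemma cnt_pd_le_nev: "cnt r (pd h) \<le> nev r h"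
  unfolding nev_def by simp

lemma ln_mnorm_mult:
  assumes "g \<in> mero" "h \<in> mero" "g \<noteq> 0" "h \<noteq> 0" "r > 0"
  shows "ln (mnorm r (g * h)) = ln (mnorm r g) + ln (mnorm r h)"
  using assms mnorm_pos[of g r] mnorm_pos[of h r] by (simp add: mnorm_mult ln_mult)

lemma nev_mult_le:
  fixes g h :: "'a::{complete_ultrametric_field, alg_closed_field, field_char_0} fls"
  assumes "g \<in> mero" "h \<in> mero" "g \<noteq> 0" "h \<noteq> 0" "r \<ge> 1"
  shows "nev r (g * h) \<le> nev r g + nev r h"
proof -
  have "cnt r (pd (g * h)) \<le> cnt r (\<lambda>\<gamma>. pd g \<gamma> + pd h \<gamma>)"
  proof (rule cnt_mono)
    show "pd (g * h) \<gamma> \<le> pd g \<gamma> + pd h \<gamma>" for \<gamma>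
      using assms by (simp add: pd_def dvs_mult)
  qed (use assms in simp_all)
  also have "\<dots> = cnt r (pd g) + cnt r (pd h)" using assms by (simp add: cnt_add)
  finally show ?thesis
    using ln_mnorm_mult[OF assms(1-4), of r] assms(5) unfolding nev_def by simp
qed

lemma cnt_abs_dvs_le:
  fixes h :: "'a::{complete_ultrametric_field, alg_closed_field, field_char_0} fls"
  assumes "h \<in> mero" "h \<noteq> 0"
  shows "locfin (\<lambda>\<gamma>. \<bar>dvs h \<gamma>\<bar>)" "\<exists>C. \<forall>r\<ge>1. cnt r (\<lambda>\<gamma>. \<bar>dvs h \<gamma>\<bar>) \<le> 2 * nev r h + C"
proof -
  have eq: "(\<lambda>\<gamma>. \<bar>dvs h \<gamma>\<bar>) = (\<lambda>\<gamma>. zd h \<gamma> + pd h \<gamma>)" by (auto simp: zd_def pd_def)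
  then show "locfin (\<lambda>\<gamma>. \<bar>dvs h \<gamma>\<bar>)" using assms by simp
  obtain C where C: "\<And>r. r \<ge> 1 \<Longrightarrow> cnt r (zd h) \<le> nev r h + C"
    using cnt_zd_le_nev[OF assms] by blast
  have "cnt r (\<lambda>\<gamma>. \<bar>dvs h \<gamma>\<bar>) \<le> 2 * nev r h + C" if "r \<ge> 1" for r
    unfolding eq using assms C[OF that] cnt_pd_le_nev[of r h] by (simp add: cnt_add)
  then show "\<exists>C. \<forall>r\<ge>1. cnt r (\<lambda>\<gamma>. \<bar>dvs h \<gamma>\<bar>) \<le> 2 * nev r h + C" by blast
qed

section \<open>The second main theorem\<close>

text \<open>Non-constancy is expressed throughout by a non-zero derivative. What follows uses of
  \<open>f - c\<close> that it has the derivative and the poles of \<open>f\<close>.\<close>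

lemma mero_order_diff_const:
  fixes f :: "'a::{complete_ultrametric_field, alg_closed_field, field_char_0} fls"
  assumes f: "f \<in> mero" "fls_deriv f \<noteq> 0"
  shows "f \<noteq> 0" "f - fls_const c \<noteq> 0" "f - fls_const c \<in> mero" "fls_deriv (f - fls_const c) = fls_deriv f"
    and "mero_order \<gamma> f < 0 \<Longrightarrow> mero_order \<gamma> (f - fls_const c) = mero_order \<gamma> f"
    and "mero_order \<gamma> (f - fls_const c) < 0 \<Longrightarrow> mero_order \<gamma> f < 0"
proof -
  show nz: "f \<noteq> 0" "f - fls_const c \<noteq> 0" using f(2) by auto
  show mero: "f - fls_const c \<in> mero" using f(1) by simp
  show "fls_deriv (f - fls_const c) = fls_deriv f" by simp
  show "mero_order \<gamma> (f - fls_const c) = mero_order \<gamma> f" if "mero_order \<gamma> f < 0"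
  proof (cases "c = 0")
    case False
    then show ?thesis
      using mero_order_add_eq(2)[of f "fls_const (- c)" \<gamma>] f(1) nz(1) that mero_order_const[of "- c" \<gamma>]
        mero_const[of "- c"] by simp
  qed simp
  show "mero_order \<gamma> f < 0" if "mero_order \<gamma> (f - fls_const c) < 0"
  proof (rule ccontr)
    assume "\<not> mero_order \<gamma> f < 0"
    then have "vge \<gamma> 0 f" using f(1) nz(1) by (simp add: vge_iff)
    then have "vge \<gamma> 0 (f - fls_const c)" by (intro vge_diff) simp_all
    then show False using that mero nz(2) by (simp add: vge_iff)
  qed
qed

lemma mero_order_zero_unique:
  fixes f :: "'a::{complete_ultrametric_field, alg_closed_field, field_char_0} fls"
  assumes f: "f \<in> mero" "fls_deriv f \<noteq> 0" and "c \<noteq> d" "mero_order \<gamma> (f - fls_const c) > 0"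
  shows "mero_order \<gamma> (f - fls_const d) = 0"
proof -
  note * = mero_order_diff_const[OF f]
  have nz: "fls_const (c - d) \<noteq> 0" using \<open>c \<noteq> d\<close> by simp
  have "mero_order \<gamma> (fls_const (c - d) + (f - fls_const c)) = mero_order \<gamma> (fls_const (c - d))"
    using * nz assms \<open>c \<noteq> d\<close> mero_order_const[of "c - d" \<gamma>]
    by (intro mero_order_add_eq(2)) (simp_all del: fls_const_eq_0_iff)
  moreover have "fls_const (c - d) + (f - fls_const c) = f - fls_const d"
    by (simp flip: fls_minus_const)
  ultimately show ?thesis using mero_order_const[of "c - d" \<gamma>] \<open>c \<noteq> d\<close> by simp
qed

lemma dvs_deriv_cases:
  fixes f :: "'a::{complete_ultrametric_field, alg_closed_field, field_char_0} fls"
  assumes f: "f \<in> mero" "fls_deriv f \<noteq> 0"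
  shows "dvs f \<gamma> < 0 \<Longrightarrow> dvs (fls_deriv f) \<gamma> = dvs f \<gamma> - 1"
    and "dvs f \<gamma> \<ge> 0 \<Longrightarrow> dvs (fls_deriv f) \<gamma> \<ge> 0"
    and "dvs (f - fls_const c) \<gamma> > 0 \<Longrightarrow> dvs (fls_deriv f) \<gamma> = dvs (f - fls_const c) \<gamma> - 1"
proof -
  note * = mero_order_diff_const[OF f]
  show "dvs (fls_deriv f) \<gamma> = dvs f \<gamma> - 1" if "dvs f \<gamma> < 0"
    using that mero_order_deriv(2)[OF f(1) *(1), of \<gamma>] by (simp add: dvs_def)
  show "dvs (fls_deriv f) \<gamma> \<ge> 0" if "dvs f \<gamma> \<ge> 0"
  proof -
    have "vge \<gamma> 0 f" using that f *(1) by (simp add: vge_iff dvs_def)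
    then have "vge \<gamma> 0 (fls_deriv f)" by (rule vge_deriv_0)
    then show ?thesis using f by (simp add: vge_iff dvs_def)
  qed
  show "dvs (fls_deriv f) \<gamma> = dvs (f - fls_const c) \<gamma> - 1" if "dvs (f - fls_const c) \<gamma> > 0"
    using that mero_order_deriv(2)[OF *(3,2), of \<gamma> c] by (simp add: dvs_def)
qed

lemma dvs_ge_1: "dvs h \<gamma> > 0 \<Longrightarrow> dvs h \<gamma> \<ge> 1" and dvs_le_minus_1: "dvs h \<gamma> < 0 \<Longrightarrow> dvs h \<gamma> \<le> - 1"
  by (simp_all add: dvs_def)

lemma mnorm_diff_const_eq:
  assumes "f \<in> mero" "r > 0" "absv c < mnorm r f"
  shows "mnorm r (f - fls_const c) = mnorm r f"
  using assms by (intro mnorm_diff_eq) simp_all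

text \<open>The divisor that Jensen's formula attaches to the norm estimate
  \<open>smt_mnorm\<close>. Its last term is not estimated away: the zeroes of \<open>f'\<close>
  outside the given values are needed in \<open>smt_divisor_le_tr2\<close> and in the product
  case.\<close>

definition smt_divisor ::
  "'b set \<Rightarrow> ('b \<Rightarrow> 'a::complete_ultrametric_field) \<Rightarrow> 'a fls \<Rightarrow> 'a \<Rightarrow> real" where
  "smt_divisor I a f \<gamma> = (real (card I) - 1) * pd f \<gamma> + (\<Sum>i\<in>I. dvs (f - fls_const (a i)) \<gamma>) - dvs (fls_deriv f) \<gamma>"

text \<open>Multiplicities cancel. At a pole of order \<open>p\<close> the sum is
  \<open>(q - 1) * p - q * p + (p + 1) = 1\<close> with \<open>q = card I\<close>; at a zero of
  order \<open>m\<close> of one \<open>f - a i\<close> it is \<open>m - (m - 1) = 1\<close>.\<close>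

lemma smt_divisor_eq:
  fixes f :: "'a::{complete_ultrametric_field, alg_closed_field, field_char_0} fls"
  assumes f: "f \<in> mero" "fls_deriv f \<noteq> 0" and I: "finite I" "inj_on a I"
  shows "dvs f \<gamma> < 0 \<Longrightarrow> smt_divisor I a f \<gamma> = 1"
    and "i \<in> I \<Longrightarrow> dvs (f - fls_const (a i)) \<gamma> > 0 \<Longrightarrow> smt_divisor I a f \<gamma> = 1"
    and "dvs f \<gamma> \<ge> 0 \<Longrightarrow> (\<And>i. i \<in> I \<Longrightarrow> dvs (f - fls_const (a i)) \<gamma> \<le> 0) \<Longrightarrow>
      smt_divisor I a f \<gamma> = - dvs (fls_deriv f) \<gamma>"
proof -
  note * = mero_order_diff_const[OF f] and d = dvs_deriv_cases[OF f]
  have ge0: "dvs (f - fls_const c) \<gamma> \<ge> 0" if "dvs f \<gamma> \<ge> 0" for c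
    using that *(6)[of \<gamma> c] unfolding dvs_def by linarith
  show "smt_divisor I a f \<gamma> = 1" if "dvs f \<gamma> < 0"
  proof -
    have "dvs (f - fls_const (a i)) \<gamma> = dvs f \<gamma>" for i
      using that *(5)[of \<gamma>] by (simp add: dvs_def)
    then show ?thesis
      using d(1)[OF that] that by (simp add: smt_divisor_def pd_def algebra_simps)
  qed
  show "smt_divisor I a f \<gamma> = 1" if i: "i \<in> I" "dvs (f - fls_const (a i)) \<gamma> > 0"
  proof -
    have "dvs f \<gamma> \<ge> 0" using i(2) *(5)[of \<gamma> "a i"] unfolding dvs_def by linarith
    moreover have "dvs (f - fls_const (a j)) \<gamma> = 0" if "j \<in> I - {i}" for j
      using mero_order_zero_unique[OF f, of "a i" "a j" \<gamma>] that I(2) i by (auto simp: dvs_def inj_on_def)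
    ultimately show ?thesis
      using d(3)[OF i(2)] i(1) I(1) by (simp add: smt_divisor_def pd_def sum.remove[of I i])
  qed
  show "smt_divisor I a f \<gamma> = - dvs (fls_deriv f) \<gamma>"
    if "dvs f \<gamma> \<ge> 0" "\<And>i. i \<in> I \<Longrightarrow> dvs (f - fls_const (a i)) \<gamma> \<le> 0"
  proof -
    have "dvs (f - fls_const (a i)) \<gamma> = 0" if "i \<in> I" for i
      using \<open>dvs f \<gamma> \<ge> 0\<close> ge0 \<open>\<And>i. i \<in> I \<Longrightarrow> dvs (f - fls_const (a i)) \<gamma> \<le> 0\<close>[OF that] by (meson antisym)
    then show ?thesis using that(1) by (simp add: smt_divisor_def pd_def)
  qed
qed

lemma smt_divisor_le:
  fixes f :: "'a::{complete_ultrametric_field, alg_closed_field, field_char_0} fls"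
  assumes f: "f \<in> mero" "fls_deriv f \<noteq> 0" and I: "finite I" "inj_on a I"
  shows "smt_divisor I a f \<gamma> \<le> min 1 (pd f \<gamma>) + (\<Sum>i\<in>I. min 1 (zd (f - fls_const (a i)) \<gamma>))"
proof -
  note eq = smt_divisor_eq[OF f I, where \<gamma> = \<gamma>]
  have nn: "(\<Sum>i\<in>J. min 1 (zd (f - fls_const (a i)) \<gamma>)) \<ge> 0" for J
    by (intro sum_nonneg) simp
  show ?thesis
  proof (cases "dvs f \<gamma> < 0")
    case True
    then show ?thesis using eq(1)[OF True] dvs_le_minus_1[OF True] nn[of I] by (simp add: pd_def)
  next
    case False
    show ?thesis
    proof (cases "\<exists>i\<in>I. dvs (f - fls_const (a i)) \<gamma> > 0")
      case True
      then obtain i where i: "i \<in> I" "dvs (f - fls_const (a i)) \<gamma> > 0" by blast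
      have "min 1 (zd (f - fls_const (a i)) \<gamma>) = 1"
        using dvs_ge_1[OF i(2)] by (simp add: zd_def)
      then show ?thesis
        using eq(2)[OF i] nn[of "I - {i}"] I(1) i(1) pd_nonneg[of f \<gamma>] by (simp add: sum.remove[of I i])
    next
      case no: False
      have 0: "0 \<le> dvs f \<gamma>" using False by simp
      have "smt_divisor I a f \<gamma> = - dvs (fls_deriv f) \<gamma>"
        by (rule eq(3)[OF 0]) (use no in \<open>auto simp: not_less\<close>)
      then show ?thesis
        using dvs_deriv_cases(2)[OF f 0] nn[of I] pd_nonneg[of f \<gamma>] by linarith
    qed
  qed
qed

lemma smt_divisor_le_1:
  fixes f :: "'a::{complete_ultrametric_field, alg_closed_field, field_char_0} fls"
  assumes f: "f \<in> mero" "fls_deriv f \<noteq> 0" and I: "finite I" "inj_on a I"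
  shows "smt_divisor I a f \<gamma> \<le> 1"
proof -
  note eq = smt_divisor_eq[OF f I, where \<gamma> = \<gamma>]
  consider "dvs f \<gamma> < 0" | i where "i \<in> I" "dvs (f - fls_const (a i)) \<gamma> > 0" |
    "dvs f \<gamma> \<ge> 0" "\<And>i. i \<in> I \<Longrightarrow> dvs (f - fls_const (a i)) \<gamma> \<le> 0" by force
  then show ?thesis
  proof cases
    case 3
    then have "smt_divisor I a f \<gamma> = - dvs (fls_deriv f) \<gamma>" by (intro eq(3)) auto
    then show ?thesis using dvs_deriv_cases(2)[OF f 3(1)] by linarith
  qed (use eq in auto)
qed

lemma ln_mnorm_deriv_le:
  fixes f :: "'a::{complete_ultrametric_field, alg_closed_field, field_char_0} fls"
  assumes f: "f \<in> mero" "fls_deriv f \<noteq> 0" and r: "r \<ge> 1"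
  shows "ln (mnorm r (fls_deriv f)) \<le> ln (mnorm r f)"
proof -
  have "mnorm r (fls_deriv f) \<le> mnorm r f / r" using mnorm_deriv_le[OF f(1)] r by simp
  also have "\<dots> \<le> mnorm r f"
    using mnorm_pos[OF f(1) mero_order_diff_const(1)[OF f], of r] r by (simp add: field_simps)
  finally show ?thesis using mnorm_pos[of "fls_deriv f" r] f r by simp
qed

text \<open>
  If \<open>\<bar>f\<bar>\<^sub>r\<close> is large, then \<open>\<bar>f - a\<^sub>i\<bar>\<^sub>r = \<bar>f\<bar>\<^sub>r\<close> for all \<open>i\<close>. Otherwise \<open>f\<close> is close to at most one
  of the \<open>a\<^sub>i\<close>, and \<open>f\<close> and \<open>f - a\<^sub>i\<close> have the same derivative.
\<close>

lemma smt_mnorm: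
  fixes f :: "'a::{complete_ultrametric_field, alg_closed_field, field_char_0} fls"
  assumes f: "f \<in> mero" "fls_deriv f \<noteq> 0" and I: "finite I" "I \<noteq> {}" "inj_on a I"
  shows "\<exists>C. \<forall>r\<ge>1. (real (card I) - 1) * max 0 (ln (mnorm r f)) \<le>
    (\<Sum>i\<in>I. ln (mnorm r (f - fls_const (a i)))) - ln (mnorm r (fls_deriv f)) - ln r + C"
proof -
  note * = mero_order_diff_const[OF f]
  define q where "q = real (card I)"
  have q: "q \<ge> 1" using I unfolding q_def by (simp add: Suc_leI card_gt_0_iff)
  define R where "R = Max (insert 1 ((\<lambda>i. absv (a i)) ` I))"
  have R: "x \<le> R" if "x = 1 \<or> x \<in> (\<lambda>i. absv (a i)) ` I" for x
    unfolding R_def by (rule Max_ge) (use I(1) that in auto)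
  have R: "R \<ge> 1" "\<And>i. i \<in> I \<Longrightarrow> absv (a i) \<le> R" using R by auto
  \<comment> \<open>The element 1 keeps the set non-empty if \<open>I\<close> is a singleton, so
    that its minimum exists.\<close>
  define S where "S = insert 1 ((\<lambda>(i, j). absv (a i - a j)) ` {(i, j). i \<in> I \<and> j \<in> I \<and> i \<noteq> j})"
  have fS: "finite S"
    unfolding S_def
    by (intro finite.insertI finite_imageI finite_subset[OF _ finite_cartesian_product[OF I(1) I(1)]]) auto
  define \<delta> where "\<delta> = Min S"
  have "\<delta> \<in> S" unfolding \<delta>_def using fS by (intro Min_in) (auto simp: S_def)
  then have \<delta>: "\<delta> > 0" using I(3) by (auto simp: S_def inj_on_def)
  have \<delta>_le: "\<delta> \<le> absv (a i - a j)" if "i \<in> I" "j \<in> I" "i \<noteq> j" for i j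
    unfolding \<delta>_def by (rule Min_le[OF fS]) (use that in \<open>auto simp: S_def\<close>)
  define C where "C = (q - 1) * (ln R + \<bar>ln \<delta>\<bar>)"
  have "(q - 1) * max 0 (ln (mnorm r f)) \<le>
    (\<Sum>i\<in>I. ln (mnorm r (f - fls_const (a i)))) - ln (mnorm r (fls_deriv f)) - ln r + C"
    if r: "r \<ge> 1" for r
  proof -
    have r0: "r > 0" using r by simp
    \<comment> \<open>The gain \<open>1 / r\<close> is available relative to whichever
      \<open>f - c\<close> is most favourable, as all of them share one derivative.\<close>
    have der: "ln (mnorm r (fls_deriv f)) \<le> ln (mnorm r (f - fls_const c)) - ln r" for c
    proof -
      have "mnorm r (fls_deriv f) \<le> mnorm r (f - fls_const c) / r"
        using mnorm_deriv_le[OF *(3)[of c] r0] *(4)[of c] by simp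
      then have "ln (mnorm r (fls_deriv f)) \<le> ln (mnorm r (f - fls_const c) / r)"
        using mnorm_pos[of "fls_deriv f" r] f r0 by simp
      also have "\<dots> = ln (mnorm r (f - fls_const c)) - ln r"
        using mnorm_pos[OF *(3)[of c] *(2)[of c] r0] r0 by (simp add: ln_divide_pos)
      finally show ?thesis .
    qed
    show ?thesis
    proof (cases "mnorm r f > R")
      case True
      have eq: "mnorm r (f - fls_const (a i)) = mnorm r f" if "i \<in> I" for i
        by (rule mnorm_diff_const_eq[OF f(1) r0]) (use R(2)[OF that] True in simp)
      have "(\<Sum>i\<in>I. ln (mnorm r (f - fls_const (a i)))) = q * ln (mnorm r f)"
        by (simp add: eq q_def)
      moreover have "ln (mnorm r f) \<ge> 0" using True R(1) by simp
      moreover have "C \<ge> 0" unfolding C_def using q R(1) by (intro mult_nonneg_nonneg) auto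
      ultimately show ?thesis using der[of 0] by (simp add: algebra_simps)
    next
      case False
      \<comment> \<open>\<open>a j\<close> is nearest to \<open>f\<close> in norm. For
        \<open>i \<noteq> j\<close> the difference of \<open>f - a i\<close> and
        \<open>f - a j\<close> is a constant of absolute value at least \<open>\<delta>\<close>, so
        the larger norm, that of \<open>f - a i\<close>, is at least
        \<open>\<delta>\<close>.\<close>
      obtain j where j: "j \<in> I" "\<And>i. i \<in> I \<Longrightarrow> mnorm r (f - fls_const (a j)) \<le> mnorm r (f - fls_const (a i))"
        using ex_min_if_finite[of "(\<lambda>i. mnorm r (f - fls_const (a i))) ` I"] I by (auto simp: not_less)
      have "ln (mnorm r (f - fls_const (a i))) \<ge> - \<bar>ln \<delta>\<bar>" if i: "i \<in> I - {j}" for i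
      proof -
        have "\<delta> \<le> absv (a j - a i)" using \<delta>_le i j(1) by auto
        also have "\<dots> = mnorm r ((f - fls_const (a i)) - (f - fls_const (a j)))"
          using r0 by (simp add: fls_minus_const del: fls_const_nth)
        also have "\<dots> \<le> max (mnorm r (f - fls_const (a i))) (mnorm r (f - fls_const (a j)))"
          by (intro mnorm_diff_le *(3) r0)
        also have "\<dots> = mnorm r (f - fls_const (a i))" using j(2) i by (simp add: max_absorb1)
        finally have "ln \<delta> \<le> ln (mnorm r (f - fls_const (a i)))" using \<delta> by simp
        then show ?thesis by linarith
      qed
      then have "(\<Sum>i\<in>I-{j}. ln (mnorm r (f - fls_const (a i)))) \<ge> (\<Sum>i\<in>I-{j}. - \<bar>ln \<delta>\<bar>)"
        by (intro sum_mono)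
      moreover have "(\<Sum>i\<in>I-{j}. - \<bar>ln \<delta>\<bar>) = - (q - 1) * \<bar>ln \<delta>\<bar>"
        using I(1,2) j(1) by (simp add: q_def of_nat_diff Suc_leI card_gt_0_iff algebra_simps)
      moreover have "(q - 1) * max 0 (ln (mnorm r f)) \<le> (q - 1) * ln R"
      proof (rule mult_left_mono)
        show "max 0 (ln (mnorm r f)) \<le> ln R"
          using False R(1) mnorm_pos[OF f(1) *(1) r0] by simp
      qed (use q in simp)
      moreover have "(\<Sum>i\<in>I. ln (mnorm r (f - fls_const (a i)))) =
          ln (mnorm r (f - fls_const (a j))) + (\<Sum>i\<in>I-{j}. ln (mnorm r (f - fls_const (a i))))"
        using I(1) j(1) by (rule sum.remove)
      ultimately show ?thesis using der[of "a j"] by (simp add: C_def algebra_simps)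
    qed
  qed
  then show ?thesis unfolding q_def by blast
qed

lemma locfin_smt_divisor [simp]:
  fixes f :: "'a::{complete_ultrametric_field, alg_closed_field, field_char_0} fls"
  assumes "f \<in> mero" "fls_deriv f \<noteq> 0"
  shows "locfin (smt_divisor I a f)"
  unfolding smt_divisor_def[abs_def]
  using assms mero_order_diff_const[OF assms]
  by (intro locfin_diff locfin_add locfin_cmult locfin_sum locfin_pd locfin_dvs) auto

text \<open>Jensen's formula turns the norms of \<open>smt_mnorm\<close> into counting functions;
  the norms at radius 1 go into the constant. A single value is allowed: then the left side is 0 and
  the inequality bounds \<open>ln r\<close>.\<close>

theorem second_main_theorem:
  fixes f :: "'a::{complete_ultrametric_field, alg_closed_field, field_char_0} fls"
  assumes f: "f \<in> mero" "fls_deriv f \<noteq> 0" and I: "finite I" "I \<noteq> {}" "inj_on a I"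
  shows "\<exists>C. \<forall>r\<ge>1. (real (card I) - 1) * nev r f \<le> cnt r (smt_divisor I a f) - ln r + C"
proof -
  note * = mero_order_diff_const[OF f]
  obtain C where C: "\<And>r. r \<ge> 1 \<Longrightarrow> (real (card I) - 1) * max 0 (ln (mnorm r f)) \<le>
    (\<Sum>i\<in>I. ln (mnorm r (f - fls_const (a i)))) - ln (mnorm r (fls_deriv f)) - ln r + C"
    using smt_mnorm[OF f I] by blast
  define B where "B = (\<Sum>i\<in>I. ln (mnorm 1 (f - fls_const (a i)))) - ln (mnorm 1 (fls_deriv f))"
  have "(real (card I) - 1) * nev r f \<le> cnt r (smt_divisor I a f) - ln r + (C + B)" if r: "r \<ge> 1" for r
  proof -
    have "cnt r (smt_divisor I a f) = (real (card I) - 1) * cnt r (pd f) +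
        (\<Sum>i\<in>I. cnt r (dvs (f - fls_const (a i)))) - cnt r (dvs (fls_deriv f))"
      unfolding smt_divisor_def[abs_def] using f *
      by (subst cnt_diff) (simp_all add: cnt_add cnt_cmult cnt_sum)
    also have "(\<Sum>i\<in>I. cnt r (dvs (f - fls_const (a i)))) =
        (\<Sum>i\<in>I. ln (mnorm r (f - fls_const (a i)))) - (\<Sum>i\<in>I. ln (mnorm 1 (f - fls_const (a i))))"
      unfolding sum_subtractf[symmetric]
      by (intro sum.cong refl) (use jensen[OF *(3,2) r] in simp)
    also have "cnt r (dvs (fls_deriv f)) = ln (mnorm r (fls_deriv f)) - ln (mnorm 1 (fls_deriv f))"
      using jensen[of "fls_deriv f" r] f r by simp
    finally show ?thesis
      using C[OF r] unfolding nev_def B_def by (simp add: algebra_simps)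
  qed
  then show ?thesis by blast
qed

lemma locfin_min [simp]: "locfin D \<Longrightarrow> c > 0 \<Longrightarrow> locfin (\<lambda>\<gamma>. min c (D \<gamma>))"
  by (erule locfin_mono) simp

text \<open>The second main theorem with one value, where only the error term and the zeroes and
  poles of \<open>f\<close> remain. This is what finally contradicts a bounded
  characteristic.\<close>

lemma nev_growth:
  fixes f :: "'a::{complete_ultrametric_field, alg_closed_field, field_char_0} fls"
  assumes f: "f \<in> mero" "fls_deriv f \<noteq> 0"
  shows "\<exists>C. \<forall>r\<ge>1. ln r \<le> 2 * nev r f + C"
proof -
  note * = mero_order_diff_const[OF f]
  obtain C where C: "\<And>r. r \<ge> 1 \<Longrightarrow> (real (card {0 :: nat}) - 1) * nev r f \<le>
      cnt r (smt_divisor {0 :: nat} (\<lambda>_. 0) f) - ln r + C"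
    using second_main_theorem[OF f, of "{0 :: nat}" "\<lambda>_. 0"] by auto
  obtain C' where C': "\<And>r. r \<ge> 1 \<Longrightarrow> cnt r (zd f) \<le> nev r f + C'"
    using cnt_zd_le_nev[OF f(1) *(1)] by blast
  have "ln r \<le> 2 * nev r f + (C + C')" if r: "r \<ge> 1" for r
  proof -
    have "cnt r (smt_divisor {0 :: nat} (\<lambda>_. 0) f) \<le> cnt r (\<lambda>\<gamma>. pd f \<gamma> + zd f \<gamma>)"
    proof (rule cnt_mono)
      show "smt_divisor {0 :: nat} (\<lambda>_. 0) f \<gamma> \<le> pd f \<gamma> + zd f \<gamma>" for \<gamma>
        using smt_divisor_le[OF f, of "{0 :: nat}" "\<lambda>_. 0" \<gamma>] by simp
    qed (use f * r in simp_all)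
    also have "\<dots> = cnt r (pd f) + cnt r (zd f)" using f * by (simp add: cnt_add)
    finally show ?thesis using C[OF r] C'[OF r] cnt_pd_le_nev[of r f] by simp
  qed
  then show ?thesis by blast
qed

text \<open>By Jensen's formula zeroes are counted by norm and poles. A pole of order
  \<open>p\<close> becomes one of order \<open>p + 1 \<le> 2 * p\<close>, and the norm does not
  grow.\<close>

lemma cnt_zd_deriv_le:
  fixes f :: "'a::{complete_ultrametric_field, alg_closed_field, field_char_0} fls"
  assumes f: "f \<in> mero" "fls_deriv f \<noteq> 0"
  shows "\<exists>C. \<forall>r\<ge>1. cnt r (zd (fls_deriv f)) \<le> 2 * nev r f + C"
proof -
  note * = mero_order_diff_const[OF f]
  have le: "pd (fls_deriv f) \<gamma> \<le> 2 * pd f \<gamma>" for \<gamma>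
    using dvs_deriv_cases(1,2)[OF f, of \<gamma>] dvs_le_minus_1[of f \<gamma>] unfolding pd_def
    by (cases "dvs f \<gamma> < 0") auto
  have "cnt r (zd (fls_deriv f)) \<le> 2 * nev r f + \<bar>ln (mnorm 1 (fls_deriv f))\<bar>" if r: "r \<ge> 1" for r
  proof -
    have "cnt r (zd (fls_deriv f)) = ln (mnorm r (fls_deriv f)) - ln (mnorm 1 (fls_deriv f)) + cnt r (pd (fls_deriv f))"
      using cnt_zd[of "fls_deriv f" r] f r by simp
    moreover have "cnt r (pd (fls_deriv f)) \<le> cnt r (\<lambda>\<gamma>. 2 * pd f \<gamma>)"
      using le f * r by (intro cnt_mono) simp_all
    moreover have "ln (mnorm r (fls_deriv f)) \<le> ln (mnorm r f)"
      by (rule ln_mnorm_deriv_le[OF f r])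
    moreover have "ln (mnorm r f) \<le> 2 * max 0 (ln (mnorm r f))" by simp
    ultimately show ?thesis unfolding nev_def by (simp add: cnt_cmult)
  qed
  then show ?thesis by blast
qed

text \<open>The first main theorem for the value \<open>c\<close>: subtracting a constant leaves the
  poles alone and changes the positive part of the logarithm by a bounded amount.\<close>

lemma cnt_zd_diff_const_le:
  fixes f :: "'a::{complete_ultrametric_field, alg_closed_field, field_char_0} fls"
  assumes f: "f \<in> mero" "fls_deriv f \<noteq> 0"
  shows "\<exists>C. \<forall>r\<ge>1. cnt r (zd (f - fls_const c)) \<le> nev r f + C"
proof -
  note * = mero_order_diff_const[OF f]
  obtain C where C: "\<And>r. r \<ge> 1 \<Longrightarrow> cnt r (zd (f - fls_const c)) \<le> nev r (f - fls_const c) + C"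
    using cnt_zd_le_nev[OF *(3,2)] by blast
  have pd: "pd (f - fls_const c) = pd f"
  proof
    fix \<gamma>
    show "pd (f - fls_const c) \<gamma> = pd f \<gamma>"
    proof (cases "mero_order \<gamma> f < 0")
      case True
      then show ?thesis using *(5)[OF True, of c] by (simp add: pd_def dvs_def)
    next
      case False
      then have "\<not> mero_order \<gamma> (f - fls_const c) < 0" using *(6) by blast
      then show ?thesis using False by (simp add: pd_def dvs_def)
    qed
  qed
  have "nev r (f - fls_const c) \<le> nev r f + max 0 (ln (absv c))" if r: "r \<ge> 1" for r
  proof -
    have le: "mnorm r (f - fls_const c) \<le> max (mnorm r f) (absv c)"
      using mnorm_diff_le[OF f(1) mero_const, of r c] r by simp
    have pos: "mnorm r (f - fls_const c) > 0" "mnorm r f > 0"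
      using mnorm_pos[OF *(3,2)] mnorm_pos[OF f(1) *(1)] r by auto
    have "ln (mnorm r (f - fls_const c)) \<le> max (ln (mnorm r f)) (max 0 (ln (absv c)))"
    proof (cases "mnorm r (f - fls_const c) \<le> mnorm r f")
      case True
      then show ?thesis using pos by (simp add: le_max_iff_disj)
    next
      case False
      then have "mnorm r (f - fls_const c) \<le> absv c" using le by simp
      then have "ln (mnorm r (f - fls_const c)) \<le> ln (absv c)"
        using pos by (subst ln_le_cancel_iff) linarith+
      then show ?thesis by simp
    qed
    then show ?thesis unfolding nev_def pd by simp
  qed
  then have "\<forall>r\<ge>1. cnt r (zd (f - fls_const c)) \<le> nev r f + (max 0 (ln (absv c)) + C)"
    using C by fastforce
  then show ?thesis by blast
qed

section \<open>Functions sharing the value 1\<close>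

lemma vge_divide_unit:
  assumes "vge \<gamma> m g" "h \<in> mero" "h \<noteq> 0" "mero_order \<gamma> h = 0"
  shows "vge \<gamma> m (g / h)"
  using vge_mult[OF assms(1), of 0 "inverse h"] assms(2-4) by (simp add: vge_iff divide_inverse)

lemma vge_log_deriv:
  assumes "h \<in> mero" "h \<noteq> 0"
  shows "vge \<gamma> (- 1) (fls_deriv h / h)" "mero_order \<gamma> h = 0 \<Longrightarrow> vge \<gamma> 0 (fls_deriv h / h)"
proof -
  have "vge \<gamma> (mero_order \<gamma> h) h" "vge \<gamma> (- mero_order \<gamma> h) (inverse h)"
    using assms by (simp_all add: vge_iff)
  from vge_mult[OF vge_deriv[OF this(1)] this(2)] show "vge \<gamma> (- 1) (fls_deriv h / h)"
    by (simp add: divide_inverse)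
  show "vge \<gamma> 0 (fls_deriv h / h)" if "mero_order \<gamma> h = 0"
    using assms that by (intro vge_divide_unit vge_deriv_0) (simp_all add: vge_iff)
qed

text \<open>
  The logarithmic derivative of \<open>h' / h\<^sup>2\<close>. At a zero of \<open>h\<close> its polar part depends only on the
  multiplicity, and the next term vanishes if the multiplicity is 1.
\<close>

definition ldd :: "'a::field fls \<Rightarrow> 'a fls" where
  "ldd h = fls_deriv (fls_deriv h) / fls_deriv h - 2 * (fls_deriv h / h)"

lemma ldd_mero [simp]: "h \<in> mero \<Longrightarrow> ldd h \<in> mero"
  unfolding ldd_def using mero_of_int[of 2] by (intro mero_diff mero_mult mero_divide mero_deriv) simp_all

lemma vge_2: "vge \<gamma> 0 2"
  using vge_of_int[of \<gamma> 2] by simp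

lemma vge_ldd:
  assumes "h \<in> mero" "fls_deriv h \<noteq> 0"
  shows "vge \<gamma> (- 1) (ldd h)"
    and "mero_order \<gamma> h = 0 \<Longrightarrow> mero_order \<gamma> (fls_deriv h) = 0 \<Longrightarrow> vge \<gamma> 0 (ldd h)"
proof -
  have nz: "h \<noteq> 0" using assms by auto
  show "vge \<gamma> (- 1) (ldd h)"
    unfolding ldd_def
    using vge_mult[OF vge_2 vge_log_deriv(1)[OF assms(1) nz]] vge_log_deriv(1)[of "fls_deriv h"] assms
    by (intro vge_diff) simp_all
  show "vge \<gamma> 0 (ldd h)" if "mero_order \<gamma> h = 0" "mero_order \<gamma> (fls_deriv h) = 0"
    unfolding ldd_def
    using vge_mult[OF vge_2 vge_log_deriv(2)[OF assms(1) nz that(1)]]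
      vge_log_deriv(2)[of "fls_deriv h", OF _ _ that(2)] assms
    by (intro vge_diff) simp_all
qed

text \<open>With \<open>h = t^m u\<close> and \<open>h' = t^(m-1) v\<close>, where \<open>u\<close>
  and \<open>v\<close> are units at \<open>\<gamma>\<close>, the residues \<open>m - 1\<close> and
  \<open>m\<close> of the two logarithmic derivatives combine to \<open>- (m + 1)\<close>. For
  \<open>m = 1\<close> one has \<open>v = u + t u'\<close>, and the numerator of the regular part
  becomes \<open>t (u u'' - 2 u'^2)\<close>. For \<open>m = - 1\<close> the polar part disappears,
  so simple poles do no harm.\<close>

lemma ldd_expansion:
  fixes h :: "'a::{complete_ultrametric_field, alg_closed_field, field_char_0} fls"
  assumes h: "h \<in> mero" "h \<noteq> 0" and m: "mero_order \<gamma> h = m" "m \<noteq> 0"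
  shows "\<exists>w. ldd h = - of_int (m + 1) / lin \<gamma> + w \<and> vge \<gamma> 0 w \<and> (m = 1 \<longrightarrow> vge \<gamma> 1 w)"
proof -
  let ?t = "lin \<gamma>"
  obtain u where u: "u \<in> mero" "u \<noteq> 0" "mero_order \<gamma> u = 0" "h = ?t powi m * u"
    using mero_factor_lin[OF h, of \<gamma>] m by auto
  define v where "v = of_int m * u + ?t * fls_deriv u"
  have v: "v \<in> mero" "v \<noteq> 0" "mero_order \<gamma> v = 0"
    using mero_order_unit_deriv[OF u(1-3) m(2)] unfolding v_def by auto
  have h': "fls_deriv h = ?t powi (m - 1) * v"
    unfolding u(4) v_def by (rule fls_deriv_lin_mult)
  have h'': "fls_deriv (fls_deriv h) = ?t powi (m - 1 - 1) * (of_int (m - 1) * v + ?t * fls_deriv v)"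
    unfolding h' by (rule fls_deriv_lin_mult)
  have pow: "?t powi m = ?t powi (m - 1 - 1) * ?t ^ 2" "?t powi (m - 1) = ?t powi (m - 1 - 1) * ?t"
    using power_int_add[of ?t "m - 1 - 1" 2] power_int_add[of ?t "m - 1 - 1" 1] by simp_all
  define w where "w = fls_deriv v / v - 2 * (fls_deriv u / u)"
  have 1: "fls_deriv (fls_deriv h) / fls_deriv h = of_int (m - 1) / ?t + fls_deriv v / v"
    unfolding h'' unfolding h' pow(2) using v(2) by (simp add: field_simps)
  have 2: "fls_deriv h / h = of_int m / ?t + fls_deriv u / u"
    unfolding h' unfolding u(4) pow v_def using u(2) by (simp add: field_simps power2_eq_square)
  have "ldd h = - of_int (m + 1) / ?t + w"
    unfolding ldd_def 1 2 w_def by (simp add: field_simps)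
  moreover have "vge \<gamma> 0 w"
    unfolding w_def
    using vge_mult[OF vge_2 vge_log_deriv(2)[OF u(1-3)]] vge_log_deriv(2)[OF v]
    by (intro vge_diff) simp_all
  moreover have "vge \<gamma> 1 w" if "m = 1"
  proof -
    have v1: "v = u + ?t * fls_deriv u" by (simp add: v_def that)
    have v': "fls_deriv v = 2 * fls_deriv u + ?t * fls_deriv (fls_deriv u)"
      unfolding v1 by (simp add: algebra_simps)
    let ?n = "fls_deriv (fls_deriv u) * u - 2 * (fls_deriv u * fls_deriv u)"
    have "w = (fls_deriv v * u - 2 * (fls_deriv u * v)) / (u * v)"
      unfolding w_def using u(2) v(2) by (simp add: field_simps)
    also have "fls_deriv v * u - 2 * (fls_deriv u * v) = ?t * ?n"
      unfolding v' unfolding v1 by (simp add: algebra_simps)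
    finally have w: "w = ?t * ?n / (u * v)" .
    have u0: "vge \<gamma> 0 u" using u by (simp add: vge_iff)
    have "vge \<gamma> 0 ?n"
      using vge_mult[OF vge_deriv_0[OF vge_deriv_0[OF u0]] u0]
        vge_mult[OF vge_2 vge_mult[OF vge_deriv_0[OF u0] vge_deriv_0[OF u0]]]
      by (intro vge_diff) simp_all
    then have "vge \<gamma> 1 (?t * ?n)" using vge_mult[OF vge_lin, of \<gamma> 0 ?n] by simp
    then show ?thesis unfolding w using u v by (intro vge_divide_unit) simp_all
  qed
  ultimately show ?thesis by blast
qed

lemma mnorm_log_deriv_le:
  assumes "h \<in> mero" "h \<noteq> 0" "r > 0"
  shows "mnorm r (fls_deriv h / h) \<le> 1 / r"
  using mnorm_deriv_le[OF assms(1,3)] mnorm_pos[OF assms] assms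
  by (simp add: mnorm_divide field_simps)

text \<open>Keeps the norm of the auxiliary function \<open>\<psi>\<close> at most 1 for
  \<open>r \<ge> 1\<close>, so that up to a constant it has no more zeroes than poles.\<close>

lemma mnorm_ldd_le:
  fixes h :: "'a::{complete_ultrametric_field, alg_closed_field, field_char_0} fls"
  assumes "h \<in> mero" "fls_deriv h \<noteq> 0" "r > 0"
  shows "mnorm r (ldd h) \<le> 1 / r"
proof -
  have nz: "h \<noteq> 0" using assms by auto
  have two: "(2 :: 'a fls) = fls_const (of_nat 2)" by simp
  have "mnorm r (2 * (fls_deriv h / h)) = absv (of_nat 2 :: 'a) * mnorm r (fls_deriv h / h)"
    unfolding two using assms by (subst mnorm_mult) (simp_all del: fls_const_numeral of_nat_numeral)
  also have "\<dots> \<le> 1 * mnorm r (fls_deriv h / h)"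
    using absv_of_nat_le_1[where 'a = 'a, of 2] assms mnorm_nonneg[of "fls_deriv h / h" r]
    by (intro mult_right_mono) simp_all
  also have "\<dots> \<le> 1 / r" using mnorm_log_deriv_le[OF assms(1) nz assms(3)] by simp
  finally have 1: "mnorm r (2 * (fls_deriv h / h)) \<le> 1 / r" .
  have 2: "mnorm r (fls_deriv (fls_deriv h) / fls_deriv h) \<le> 1 / r"
    using mnorm_log_deriv_le[of "fls_deriv h" r] assms by simp
  have "mnorm r (ldd h) \<le> max (mnorm r (fls_deriv (fls_deriv h) / fls_deriv h)) (mnorm r (2 * (fls_deriv h / h)))"
    unfolding ldd_def two using assms by (intro mnorm_diff_le mero_mult mero_const) simp_all
  then show ?thesis using 1 2 by linarith
qed

text \<open>A simple zero or pole of \<open>F\<close> costs the second main theorem one unit and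
  leaves \<open>ldd (F - 1)\<close> regular. At a multiple one \<open>ldd (F - 1)\<close> may have a
  pole, and the second unit pays for it.\<close>

definition tr2 :: "'a::complete_ultrametric_field fls \<Rightarrow> 'a \<Rightarrow> real" where
  "tr2 h \<gamma> = min 2 \<bar>dvs h \<gamma>\<bar>"

lemma tr2_nonneg [simp]: "0 \<le> tr2 h \<gamma>"
  by (simp add: tr2_def)

lemma locfin_tr2 [simp]:
  fixes h :: "'a::{complete_ultrametric_field, alg_closed_field, field_char_0} fls"
  assumes "h \<in> mero" "h \<noteq> 0"
  shows "locfin (tr2 h)"
  using locfin_dvs[OF assms] by (rule locfin_mono) (simp add: tr2_def)

text \<open>The second main theorem for the values 0 and \<open>w\<close>: zeroes and poles of
  \<open>F\<close> are covered by \<open>tr2 F\<close>, and the \<open>w\<close>-points, counted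
  once, by \<open>tr2 G\<close>.\<close>

lemma nev_le_two_values:
  fixes F G :: "'a::{complete_ultrametric_field, alg_closed_field, field_char_0} fls"
  assumes F: "F \<in> mero" "fls_deriv F \<noteq> 0" and G: "G \<in> mero" "G \<noteq> 0" and w: "w \<noteq> 0"
    and le: "\<And>\<gamma>. dvs (F - fls_const w) \<gamma> > 0 \<Longrightarrow> dvs G \<gamma> \<noteq> 0"
  shows "\<exists>C. \<forall>r\<ge>1. nev r F \<le> cnt r (tr2 F) + cnt r (tr2 G) + C"
proof -
  have FI: "F \<noteq> 0" using F by auto
  obtain C where C: "\<And>r. r \<ge> 1 \<Longrightarrow> (real (card {0, w}) - 1) * nev r F \<le>
      cnt r (smt_divisor {0, w} (\<lambda>x. x) F) - ln r + C"
    using second_main_theorem[OF F, of "{0, w}" "\<lambda>x. x"] by auto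
  have pt: "smt_divisor {0, w} (\<lambda>x. x) F \<gamma> \<le> tr2 F \<gamma> + tr2 G \<gamma>" for \<gamma>
  proof -
    have "smt_divisor {0, w} (\<lambda>x. x) F \<gamma> \<le>
        min 1 (pd F \<gamma>) + (min 1 (zd F \<gamma>) + min 1 (zd (F - fls_const w) \<gamma>))"
      using smt_divisor_le[OF F, of "{0, w}" "\<lambda>x. x" \<gamma>] w by simp
    moreover have "min 1 (pd F \<gamma>) + min 1 (zd F \<gamma>) \<le> tr2 F \<gamma>"
      by (simp add: pd_def zd_def tr2_def min_def max_def)
    moreover have "min 1 (zd (F - fls_const w) \<gamma>) \<le> tr2 G \<gamma>"
    proof (cases "dvs (F - fls_const w) \<gamma> > 0")
      case True
      then have "tr2 G \<gamma> \<ge> 1"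
        using le[OF True] dvs_ge_1[of G \<gamma>] dvs_le_minus_1[of G \<gamma>] unfolding tr2_def by linarith
      then show ?thesis by simp
    qed (simp add: zd_def)
    ultimately show ?thesis by linarith
  qed
  have "nev r F \<le> cnt r (tr2 F) + cnt r (tr2 G) + C" if r: "r \<ge> 1" for r
  proof -
    have "cnt r (smt_divisor {0, w} (\<lambda>x. x) F) \<le> cnt r (\<lambda>\<gamma>. tr2 F \<gamma> + tr2 G \<gamma>)"
      using pt F FI G r by (intro cnt_mono) simp_all
    also have "\<dots> = cnt r (tr2 F) + cnt r (tr2 G)" using F FI G by (simp add: cnt_add)
    moreover have "0 \<le> ln r" using r by simp
    ultimately show ?thesis using C[OF r] w by simp
  qed
  then show ?thesis by blast
qed

text \<open>\<open>A = H' / H^2\<close> has logarithmic derivative \<open>ldd H\<close>, so the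
  quotient \<open>A / B\<close> is constant. As \<open>A\<close> is the negative derivative of
  \<open>1 / H\<close>, a second integration gives the relation.\<close>

lemma ldd_eq_imp_moebius:
  fixes F G :: "'a::{complete_ultrametric_field, alg_closed_field, field_char_0} fls"
  assumes F: "F \<in> mero" "fls_deriv F \<noteq> 0" and G: "G \<in> mero" "fls_deriv G \<noteq> 0"
    and eq: "ldd (F - 1) = ldd (G - 1)"
  shows "\<exists>c e. c \<noteq> 0 \<and> 1 / (F - 1) = fls_const c / (G - 1) + fls_const e"
proof -
  let ?H = "F - 1" and ?K = "G - 1"
  have nz: "?H \<noteq> 0" "?K \<noteq> 0" using F G by auto
  define A where "A = fls_deriv ?H / ?H ^ 2"
  define B where "B = fls_deriv ?K / ?K ^ 2"
  have A0: "A \<noteq> 0" and B0: "B \<noteq> 0" using F G nz by (simp_all add: A_def B_def)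
  have ld: "fls_deriv (fls_deriv h / h ^ 2) = ldd h * (fls_deriv h / h ^ 2)"
    if "h \<noteq> 0" "fls_deriv h \<noteq> 0" for h :: "'a fls"
    using that by (simp add: fls_deriv_divide_field fls_deriv_power ldd_def field_simps power2_eq_square)
  have A': "fls_deriv A = ldd ?H * A" and B': "fls_deriv B = ldd ?K * B"
    unfolding A_def B_def by (rule ld; use F G nz in simp)+
  have "fls_deriv (A / B) = 0"
    using B0 by (simp add: fls_deriv_divide_field A' B' eq)
  then obtain c where c: "A / B = fls_const c" unfolding fls_deriv_eq_0_iff by blast
  then have AB: "A = fls_const c * B" using B0 by (simp add: field_simps)
  then have "c \<noteq> 0" using A0 by auto
  have di: "fls_deriv (1 / h) = - (fls_deriv h / h ^ 2)" if "h \<noteq> 0" for h :: "'a fls"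
    using that by (simp add: fls_deriv_divide_field)
  have "fls_deriv (1 / ?H) = fls_deriv (fls_const c * (1 / ?K))"
    unfolding fls_deriv_mult di[OF nz(1)] di[OF nz(2)] A_def[symmetric] B_def[symmetric] using AB by simp
  then obtain e where "1 / ?H = fls_const e + fls_const c * (1 / ?K)"
    unfolding fls_deriv_eq_iff_ex by blast
  then have "1 / ?H = fls_const c / ?K + fls_const e" by (simp add: add.commute)
  then show ?thesis using \<open>c \<noteq> 0\<close> by blast
qed

text \<open>
  Outside the two exceptional cases there is \<open>w \<noteq> 0\<close> such that all zeroes of \<open>F - w\<close> are zeroes or
  poles of \<open>G\<close>.
\<close>

lemma moebius_cases:
  fixes F G :: "'a::{complete_ultrametric_field, alg_closed_field, field_char_0} fls"
  assumes F: "F \<in> mero" "fls_deriv F \<noteq> 0" and G: "G \<in> mero" "fls_deriv G \<noteq> 0"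
    and c: "c \<noteq> 0" and eq: "1 / (F - 1) = fls_const c / (G - 1) + fls_const e"
  shows "F = G \<or> F * G = 1 \<or> (\<exists>C. \<forall>r\<ge>1. nev r F \<le> cnt r (tr2 F) + cnt r (tr2 G) + C)"
proof -
  note FG = mero_order_diff_const[OF F] mero_order_diff_const[OF G]
  have nz: "F - 1 \<noteq> 0" "G - 1 \<noteq> 0" using F G by auto
  have G0: "G \<noteq> 0" using G by auto
  have eq': "G - 1 = (F - 1) * (fls_const c + fls_const e * (G - 1))"
    using eq nz by (simp add: field_simps)
  define D where "D = fls_const c + fls_const e * (G - 1)"
  have D: "D \<noteq> 0" "D \<in> mero" "G - 1 = (F - 1) * D" using eq' nz G by (auto simp: D_def)
  have two_values: ?thesis
    if "w \<noteq> 0" "\<And>\<gamma>. dvs (F - fls_const w) \<gamma> > 0 \<Longrightarrow> dvs G \<gamma> \<noteq> 0" for w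
    using nev_le_two_values[OF F G(1) G0 that] by blast
  show ?thesis
  proof (cases "e = 0")
    case True
    have GF: "G - 1 = fls_const c * (F - 1)" using eq' True by (simp add: mult.commute)
    show ?thesis
    proof (cases "c = 1")
      case True
      then show ?thesis using GF by simp
    next
      case False
      \<comment> \<open>The value of \<open>F\<close> where \<open>G = 0\<close>.\<close>
      define w where "w = 1 - 1 / c"
      have w: "w \<noteq> 0" using False c by (simp add: w_def)
      have cc: "fls_const c * fls_const w = fls_const c - 1"
        using c by (simp add: w_def right_diff_distrib flip: fls_minus_const fls_const_1)
      have "G = fls_const c * (F - fls_const w)"
        unfolding right_diff_distrib cc using GF by (simp add: algebra_simps)
      then have "dvs G \<gamma> = dvs (F - fls_const w) \<gamma>" for \<gamma>
        using c FG(2)[of w] FG(3)[of w] by (simp add: dvs_def)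
      then show ?thesis using two_values[OF w] by auto
    qed
  next
    case e: False
    show ?thesis
    proof (cases "e = - 1")
      case True
      then have D': "D = fls_const (c + 1) - G" by (simp add: D_def flip: fls_plus_const)
      have FD: "F * D = fls_const c"
        using D(3) unfolding D' by (simp add: algebra_simps flip: fls_plus_const)
      show ?thesis
      proof (cases "c = - 1")
        case True
        then have "F * G = 1" using FD D' by simp
        then show ?thesis by simp
      next
        case False
        then have c1: "c + 1 \<noteq> 0" by (simp add: eq_neg_iff_add_eq_0)
        \<comment> \<open>Again the value of \<open>F\<close> where \<open>G = 0\<close>; at poles
          of \<open>G\<close> the relation gives \<open>F = 0\<close>, which is of no use
          here.\<close>
        define w where "w = c / (c + 1)"
        have w: "w \<noteq> 0" using c c1 by (simp add: w_def)
        have "(F - fls_const w) * D = fls_const w * G"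
        proof -
          have "fls_const w * fls_const (c + 1) = fls_const c" using c1 by (simp add: w_def)
          moreover have "(F - fls_const w) * D = F * D - fls_const w * fls_const (c + 1) + fls_const w * G"
            unfolding D' by (simp add: algebra_simps)
          ultimately show ?thesis using FD by simp
        qed
        then have "dvs ((F - fls_const w) * D) \<gamma> = dvs (fls_const w * G) \<gamma>" for \<gamma> by simp
        then have dvs: "dvs (F - fls_const w) \<gamma> + dvs D \<gamma> = dvs G \<gamma>" for \<gamma>
          using FG(2)[of w] FG(3)[of w] D(1,2) w G(1) G0 by (simp add: dvs_def flip: of_int_add)
        show ?thesis
        proof (rule two_values[OF w])
          fix \<gamma> assume pos: "dvs (F - fls_const w) \<gamma> > 0"
          show "dvs G \<gamma> \<noteq> 0"
          proof
            assume 0: "dvs G \<gamma> = 0"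
            then have "vge \<gamma> 0 G" using G(1) G0 by (simp add: vge_iff dvs_def)
            then have "vge \<gamma> 0 D" unfolding D' by (intro vge_diff vge_const)
            then have "dvs D \<gamma> \<ge> 0" using D(1,2) by (simp add: vge_iff dvs_def)
            then show False using dvs[of \<gamma>] pos 0 by simp
          qed
        qed
      qed
    next
      case False
      then have e1: "e + 1 \<noteq> 0" by (simp add: eq_neg_iff_add_eq_0)
      \<comment> \<open>The value of \<open>F\<close> at poles of \<open>G\<close>:
        \<open>(F - w) * D\<close> is constant, so a zero of \<open>F - w\<close> is a pole of
        \<open>D\<close> and thus of \<open>G\<close>.\<close>
      define w where "w = (e + 1) / e"
      have w: "w \<noteq> 0" using e e1 by (simp add: w_def)
      have ew: "fls_const e * fls_const w = fls_const e + 1"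
        using e by (simp add: w_def flip: fls_plus_const fls_const_1)
      have "fls_const e * ((F - fls_const w) * D) =
          fls_const e * ((F - 1) * D) - (fls_const e * fls_const w - fls_const e) * D"
        by (simp add: algebra_simps)
      also have "\<dots> = - fls_const c"
        unfolding ew D(3)[symmetric] by (simp add: D_def)
      finally have "fls_const e * ((F - fls_const w) * D) = fls_const (- c)" by simp
      then have "dvs (fls_const e * ((F - fls_const w) * D)) \<gamma> = dvs (fls_const (- c)) \<gamma>" for \<gamma>
        by simp
      moreover have "dvs (fls_const (- c)) \<gamma> = 0" for \<gamma>
        unfolding dvs_def using c by (subst mero_order_const) simp_all
      ultimately have dvs: "dvs (F - fls_const w) \<gamma> + dvs D \<gamma> = 0" for \<gamma>
        using FG(2)[of w] FG(3)[of w] D(1,2) e by (simp add: dvs_def flip: of_int_add)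
      show ?thesis
      proof (rule two_values[OF w])
        fix \<gamma> assume pos: "dvs (F - fls_const w) \<gamma> > 0"
        show "dvs G \<gamma> \<noteq> 0"
        proof
          assume "dvs G \<gamma> = 0"
          then have "vge \<gamma> 0 G" using G(1) G0 by (simp add: vge_iff dvs_def)
          then have "vge \<gamma> 0 (G - 1)" using vge_const[of \<gamma> 1] by (intro vge_diff) simp_all
          from vge_mult[OF vge_const this] have "vge \<gamma> 0 (fls_const e * (G - 1))" by simp
          then have "vge \<gamma> 0 D" unfolding D_def by (intro vge_add vge_const)
          then have "dvs D \<gamma> \<ge> 0" using D(1,2) by (simp add: vge_iff dvs_def)
          then show False using dvs[of \<gamma>] pos by simp
        qed
      qed
    qed
  qed
qed

text \<open>Away from 1-points, either \<open>tr2 F\<close> has a unit to spare over the divisor of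
  the second main theorem, or \<open>ldd (F - 1)\<close> is regular. The spare unit later pays for a
  simple pole of \<open>\<psi>\<close>.\<close>

lemma smt_divisor_le_tr2:
  fixes F :: "'a::{complete_ultrametric_field, alg_closed_field, field_char_0} fls"
  assumes F: "F \<in> mero" "fls_deriv F \<noteq> 0" and no1: "dvs (F - 1) \<gamma> \<le> 0"
  shows "smt_divisor {0, 1} (\<lambda>x. x) F \<gamma> \<le> tr2 F \<gamma> - 1 \<or>
    smt_divisor {0, 1} (\<lambda>x. x) F \<gamma> \<le> tr2 F \<gamma> \<and> vge \<gamma> 0 (ldd (F - 1))"
proof -
  note * = mero_order_diff_const[OF F]
  have H: "F - 1 \<in> mero" "F - 1 \<noteq> 0" "fls_deriv (F - 1) = fls_deriv F"
    using *(2)[of 1] *(3)[of 1] by simp_all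
  have H': "fls_deriv (F - 1) \<noteq> 0" using H(3) F(2) by simp
  note eq = smt_divisor_eq[OF F, of "{0, 1}" "\<lambda>x. x", where \<gamma> = \<gamma>]
  consider "dvs F \<gamma> < 0" | "dvs F \<gamma> > 0" | "dvs F \<gamma> = 0" by linarith
  then show ?thesis
  proof cases
    case 1
    have S: "smt_divisor {0, 1} (\<lambda>x. x) F \<gamma> = 1" using 1 by (intro eq(1)) simp_all
    show ?thesis
    proof (cases "dvs F \<gamma> = - 1")
      case True
      then have "mero_order \<gamma> (F - 1) = - 1" using *(5)[of \<gamma> 1] by (simp add: dvs_def)
      from ldd_expansion[OF H(1,2) this] have "vge \<gamma> 0 (ldd (F - 1))" by auto
      then show ?thesis using S True by (simp add: tr2_def)
    next
      case False
      then have "mero_order \<gamma> F \<noteq> - 1" "mero_order \<gamma> F < 0" using 1 by (auto simp: dvs_def)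
      then have "mero_order \<gamma> F \<le> - 2" by linarith
      then have "dvs F \<gamma> \<le> - 2" by (simp add: dvs_def)
      then show ?thesis using S by (simp add: tr2_def)
    qed
  next
    case 2
    have S: "smt_divisor {0, 1} (\<lambda>x. x) F \<gamma> = 1" using 2 by (intro eq(2)[of 0]) simp_all
    have ord: "mero_order \<gamma> (F - 1) = 0"
      using mero_order_zero_unique[OF F, of 0 1 \<gamma>] 2 by (simp add: dvs_def)
    show ?thesis
    proof (cases "dvs F \<gamma> = 1")
      case True
      then have "mero_order \<gamma> (fls_deriv (F - 1)) = 0"
        unfolding H(3) using dvs_deriv_cases(3)[OF F, of 0 \<gamma>] by (simp add: dvs_def)
      then have "vge \<gamma> 0 (ldd (F - 1))" by (intro vge_ldd(2) H(1) H' ord)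
      then show ?thesis using S True by (simp add: tr2_def)
    next
      case False
      then have "mero_order \<gamma> F \<noteq> 1" "mero_order \<gamma> F > 0" using 2 by (auto simp: dvs_def)
      then have "mero_order \<gamma> F \<ge> 2" by linarith
      then have "dvs F \<gamma> \<ge> 2" by (simp add: dvs_def)
      then show ?thesis using S by (simp add: tr2_def)
    qed
  next
    case 3
    have S: "smt_divisor {0, 1} (\<lambda>x. x) F \<gamma> = - dvs (fls_deriv F) \<gamma>"
      using 3 no1 by (intro eq(3)) auto
    have ord: "mero_order \<gamma> (F - 1) = 0"
      using *(6)[of \<gamma> 1] 3 no1 unfolding dvs_def by fastforce
    show ?thesis
    proof (cases "dvs (fls_deriv F) \<gamma> = 0")
      case True
      then have "mero_order \<gamma> (fls_deriv (F - 1)) = 0" unfolding H(3) by (simp add: dvs_def)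
      then have "vge \<gamma> 0 (ldd (F - 1))" by (intro vge_ldd(2) H(1) H' ord)
      then show ?thesis using S True by simp
    next
      case False
      then have "dvs (fls_deriv F) \<gamma> > 0" using dvs_deriv_cases(2)[OF F, of \<gamma>] 3 by simp
      then have "dvs (fls_deriv F) \<gamma> \<ge> 1" by (rule dvs_ge_1)
      then have "smt_divisor {0, 1} (\<lambda>x. x) F \<gamma> \<le> tr2 F \<gamma> - 1"
        using S tr2_nonneg[of F \<gamma>] by linarith
      then show ?thesis by blast
    qed
  qed
qed

text \<open>The second main theorem is added up for \<open>F\<close> and \<open>G\<close> with the
  values 0 and 1. The shared 1-points are charged to \<open>zd (G - 1)\<close> only once, which
  costs \<open>nev r G\<close> and cancels that term on the left, so \<open>nev r F\<close> alone
  remains.\<close>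

theorem nev_le_if_share_one:
  fixes F G :: "'a::{complete_ultrametric_field, alg_closed_field, field_char_0} fls"
  assumes F: "F \<in> mero" "fls_deriv F \<noteq> 0" and G: "G \<in> mero" "fls_deriv G \<noteq> 0"
    and E: "locfin E" "\<And>\<gamma>. E \<gamma> \<ge> 0"
    and share: "\<And>\<gamma>. E \<gamma> < 1 \<Longrightarrow> zd (F - 1) \<gamma> = zd (G - 1) \<gamma>"
  shows "F = G \<or> F * G = 1 \<or>
    (\<exists>C. \<forall>r\<ge>1. nev r F \<le> cnt r (tr2 F) + cnt r (tr2 G) + 3 * cnt r E + C)"
proof -
  let ?S = "smt_divisor {0, 1} (\<lambda>x. x)"
  define \<psi> where "\<psi> = ldd (F - 1) - ldd (G - 1)"
  have F0: "F \<noteq> 0" "F - 1 \<noteq> 0" "fls_deriv (F - 1) \<noteq> 0" "F - 1 \<in> mero"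
    and G0: "G \<noteq> 0" "G - 1 \<noteq> 0" "fls_deriv (G - 1) \<noteq> 0" "G - 1 \<in> mero" using F G by auto
  show ?thesis
  proof (cases "\<psi> = 0")
    case True
    then have "ldd (F - 1) = ldd (G - 1)" by (simp add: \<psi>_def)
    then obtain c e where "c \<noteq> 0" "1 / (F - 1) = fls_const c / (G - 1) + fls_const e"
      using ldd_eq_imp_moebius[OF F G] by blast
    from moebius_cases[OF F G this] consider "F = G" | "F * G = 1" |
      C where "\<And>r. r \<ge> 1 \<Longrightarrow> nev r F \<le> cnt r (tr2 F) + cnt r (tr2 G) + C" by blast
    then show ?thesis
    proof cases
      case 3
      have "nev r F \<le> cnt r (tr2 F) + cnt r (tr2 G) + 3 * cnt r E + C" if "r \<ge> 1" for r
        using 3[OF that] cnt_nonneg[of E r] E(2) that by simp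
      then show ?thesis by blast
    qed simp_all
  next
    case \<psi>0: False
    have \<psi>: "\<psi> \<in> mero" using F0 G0 by (simp add: \<psi>_def)
    have \<psi>m: "vge \<gamma> (- 1) \<psi>" for \<gamma>
      unfolding \<psi>_def using F0 G0 by (intro vge_diff vge_ldd(1))
    \<comment> \<open>At a common 1-point of multiplicity \<open>m\<close> both divisors are 1, and
      \<open>m + dvs \<psi> \<gamma> \<ge> 2\<close>, because \<open>\<psi>\<close> is regular there
      and vanishes if \<open>m = 1\<close>. At other points a pole of \<open>\<psi>\<close> is at
      most simple and paid for by a spare unit of \<open>tr2\<close>. Where
      \<open>E \<gamma> \<ge> 1\<close>, three units cover two divisors and one pole of
      \<open>\<psi>\<close>.\<close>
    have pt: "?S F \<gamma> + ?S G \<gamma> \<le> zd (G - 1) \<gamma> + dvs \<psi> \<gamma> + tr2 F \<gamma> + tr2 G \<gamma> + 3 * E \<gamma>" for \<gamma>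
    proof -
      have \<psi>1: "dvs \<psi> \<gamma> \<ge> - 1" using \<psi>m[of \<gamma>] \<psi> \<psi>0 by (simp add: vge_iff dvs_def)
      have S_le: "?S h \<gamma> \<le> 1" if "h \<in> mero" "fls_deriv h \<noteq> 0" for h :: "'a fls"
        using that by (intro smt_divisor_le_1) simp_all
      show ?thesis
      proof (cases "E \<gamma> < 1")
        case False
        then show ?thesis
          using S_le[OF F] S_le[OF G] \<psi>1 tr2_nonneg[of F \<gamma>] tr2_nonneg[of G \<gamma>] zd_nonneg[of "G - 1" \<gamma>]
          by linarith
      next
        case True
        note sh = share[OF True]
        show ?thesis
        proof (cases "dvs (F - 1) \<gamma> > 0")
          case pos: True
          define m where "m = mero_order \<gamma> (F - 1)"
          have m: "m > 0" using pos by (simp add: m_def dvs_def)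
          have mG: "mero_order \<gamma> (G - 1) = m" "zd (G - 1) \<gamma> = of_int m"
            using sh pos unfolding zd_def dvs_def m_def by (auto simp: max_def split: if_splits)
          obtain w1 where w1: "ldd (F - 1) = - of_int (m + 1) / lin \<gamma> + w1" "vge \<gamma> 0 w1" "m = 1 \<longrightarrow> vge \<gamma> 1 w1"
            using ldd_expansion[OF F0(4,2), of \<gamma> m] m m_def by auto
          obtain w2 where w2: "ldd (G - 1) = - of_int (m + 1) / lin \<gamma> + w2" "vge \<gamma> 0 w2" "m = 1 \<longrightarrow> vge \<gamma> 1 w2"
            using ldd_expansion[OF G0(4,2) mG(1)] m by auto
          have \<psi>w: "\<psi> = w1 - w2" unfolding \<psi>_def w1(1) w2(1) by simp
          have "vge \<gamma> 0 \<psi>" unfolding \<psi>w using w1 w2 by (intro vge_diff) simp_all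
          moreover have "vge \<gamma> 1 \<psi>" if "m = 1" unfolding \<psi>w using w1 w2 that by (intro vge_diff) simp_all
          ultimately have "dvs \<psi> \<gamma> + of_int m \<ge> 2"
            using \<psi> \<psi>0 m by (cases "m = 1") (simp_all add: vge_iff dvs_def)
          then show ?thesis
            using S_le[OF F] S_le[OF G] mG(2) tr2_nonneg[of F \<gamma>] tr2_nonneg[of G \<gamma>] E(2)[of \<gamma>] by linarith
        next
          case False
          then have F1: "dvs (F - 1) \<gamma> \<le> 0" by simp
          then have G1: "dvs (G - 1) \<gamma> \<le> 0" using sh by (simp add: zd_def max_def split: if_splits)
          from smt_divisor_le_tr2[OF F F1] smt_divisor_le_tr2[OF G G1]
          consider "?S F \<gamma> + ?S G \<gamma> \<le> tr2 F \<gamma> + tr2 G \<gamma> - 1" |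
            "?S F \<gamma> + ?S G \<gamma> \<le> tr2 F \<gamma> + tr2 G \<gamma>" "vge \<gamma> 0 (ldd (F - 1))" "vge \<gamma> 0 (ldd (G - 1))"
            by fastforce
          then show ?thesis
          proof cases
            case 1
            then show ?thesis using \<psi>1 zd_nonneg[of "G - 1" \<gamma>] E(2)[of \<gamma>] by linarith
          next
            case 2
            have "vge \<gamma> 0 \<psi>" unfolding \<psi>_def by (rule vge_diff[OF 2(2,3)])
            then have "dvs \<psi> \<gamma> \<ge> 0" using \<psi> \<psi>0 by (simp add: vge_iff dvs_def)
            then show ?thesis using 2(1) zd_nonneg[of "G - 1" \<gamma>] E(2)[of \<gamma>] by linarith
          qed
        qed
      qed
    qed
    obtain C1 where C1: "\<And>r. r \<ge> 1 \<Longrightarrow> (real (card {0 :: 'a, 1}) - 1) * nev r F \<le> cnt r (?S F) - ln r + C1"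
      using second_main_theorem[OF F, of "{0, 1}" "\<lambda>x. x"] by auto
    obtain C2 where C2: "\<And>r. r \<ge> 1 \<Longrightarrow> (real (card {0 :: 'a, 1}) - 1) * nev r G \<le> cnt r (?S G) - ln r + C2"
      using second_main_theorem[OF G, of "{0, 1}" "\<lambda>x. x"] by auto
    obtain C3 where C3: "\<And>r. r \<ge> 1 \<Longrightarrow> cnt r (zd (G - 1)) \<le> nev r G + C3"
      using cnt_zd_diff_const_le[OF G, of 1] by auto
    have "nev r F \<le> cnt r (tr2 F) + cnt r (tr2 G) + 3 * cnt r E + (C1 + C2 + C3 + \<bar>ln (mnorm 1 \<psi>)\<bar>)"
      if r: "r \<ge> 1" for r
    proof -
      have lnr: "ln r \<ge> 0" using r by simp
      have "cnt r (?S F) + cnt r (?S G) = cnt r (\<lambda>\<gamma>. ?S F \<gamma> + ?S G \<gamma>)"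
        using F G by (simp add: cnt_add)
      also have "\<dots> \<le> cnt r (\<lambda>\<gamma>. zd (G - 1) \<gamma> + dvs \<psi> \<gamma> + tr2 F \<gamma> + tr2 G \<gamma> + 3 * E \<gamma>)"
        using pt F G F0 G0 \<psi> \<psi>0 E(1) r by (intro cnt_mono) simp_all
      also have "\<dots> = cnt r (zd (G - 1)) + cnt r (dvs \<psi>) + cnt r (tr2 F) + cnt r (tr2 G) + 3 * cnt r E"
        using F G F0 G0 \<psi> \<psi>0 E(1) by (simp add: cnt_add cnt_cmult)
      finally have 1: "cnt r (?S F) + cnt r (?S G) \<le> \<dots>" .
      have "mnorm r \<psi> \<le> max (mnorm r (ldd (F - 1))) (mnorm r (ldd (G - 1)))"
        unfolding \<psi>_def using F0 G0 r by (intro mnorm_diff_le) simp_all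
      also have "\<dots> \<le> 1 / r" using mnorm_ldd_le[OF F0(4,3)] mnorm_ldd_le[OF G0(4,3)] r by simp
      also have "\<dots> \<le> 1" using r by simp
      finally have "ln (mnorm r \<psi>) \<le> 0" using mnorm_pos[OF \<psi> \<psi>0, of r] r by simp
      \<comment> \<open>The signed divisor: zeroes and poles of \<open>\<psi>\<close> together
        contribute only a constant.\<close>
      then have 2: "cnt r (dvs \<psi>) \<le> \<bar>ln (mnorm 1 \<psi>)\<bar>" using jensen[OF \<psi> \<psi>0 r] by linarith
      have "nev r F \<le> cnt r (?S F) - ln r + C1" "nev r G \<le> cnt r (?S G) - ln r + C2"
        using C1[OF r] C2[OF r] by simp_all
      then show ?thesis using 1 2 C3[OF r] lnr by linarith
    qed
    then show ?thesis by blast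
  qed
qed

section \<open>Polynomials in a meromorphic function\<close>

lemma poly_comp_0 [simp]: "poly_comp 0 f = 0"
  by (simp add: poly_comp_def)

lemma poly_comp_pCons [simp]: "poly_comp (pCons a p) f = fls_const a + f * poly_comp p f"
  by (cases "a = 0 \<and> p = 0") (auto simp: poly_comp_def map_poly_pCons)

lemma poly_comp_add: "poly_comp (p + q) f = poly_comp p f + poly_comp q f"
  by (induction p q rule: poly_induct2) (simp_all add: algebra_simps flip: fls_plus_const)

lemma poly_comp_smult: "poly_comp (smult c p) f = fls_const c * poly_comp p f"
  by (induction p) (simp_all add: algebra_simps)

lemma poly_comp_mult: "poly_comp (p * q) f = poly_comp p f * poly_comp q f"
  by (induction p) (simp_all add: poly_comp_add poly_comp_smult algebra_simps)

lemma poly_comp_1 [simp]: "poly_comp 1 f = 1"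
  by (simp flip: pCons_one)

lemma poly_comp_power: "poly_comp (p ^ n) f = poly_comp p f ^ n"
  by (induction n) (simp_all add: poly_comp_mult)

lemma poly_comp_prod: "poly_comp (prod p I) f = (\<Prod>i\<in>I. poly_comp (p i) f)"
  by (induction I rule: infinite_finite_induct) (simp_all add: poly_comp_mult)

lemma poly_comp_linear: "poly_comp [:- a, 1:] f = f - fls_const a"
  by simp

lemma poly_comp_diff_const: "poly_comp (p - [:c:]) f = poly_comp p f - fls_const c"
  using poly_comp_add[of "p - [:c:]" "[:c:]" f] by (simp add: algebra_simps)

lemma deriv_poly_comp: "fls_deriv (poly_comp p f) = fls_deriv f * poly_comp (pderiv p) f"
  by (induction p) (simp_all add: pderiv_pCons poly_comp_add algebra_simps)

lemma poly_comp_mero [simp]: "f \<in> mero \<Longrightarrow> poly_comp p f \<in> mero"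
  by (induction p) simp_all

lemma alg_closed_poly_induct [consumes 1, case_names const linear]:
  fixes p :: "'a::alg_closed_field poly"
  assumes "p \<noteq> 0"
    and const: "\<And>c. c \<noteq> 0 \<Longrightarrow> P [:c:]"
    and linear: "\<And>w p. p \<noteq> 0 \<Longrightarrow> P p \<Longrightarrow> P ([:- w, 1:] * p)"
  shows "P p"
  using assms(1)
proof (induction "degree p" arbitrary: p)
  case 0
  then obtain c where "p = [:c:]" using degree_eq_zeroE[of p] by auto
  then show ?case using 0 const by auto
next
  case (Suc n)
  then have "degree p > 0" by simp
  then obtain w where "poly p w = 0" using alg_closed_imp_poly_has_root by blast
  then obtain q where q: "p = [:- w, 1:] * q" by (auto simp: poly_eq_0_iff_dvd)
  have "q \<noteq> 0" using q Suc.prems by auto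
  then have "degree p = Suc (degree q)" unfolding q by (subst degree_mult_eq) auto
  then have "P q" using Suc \<open>q \<noteq> 0\<close> by simp
  then show ?case unfolding q using linear \<open>q \<noteq> 0\<close> by blast
qed

text \<open>Proved by multiplying with one linear factor at a time. The \<open>B\<close> constructed
  bounds all roots, so if \<open>f\<close> has larger norm, every factor has the norm of
  \<open>f\<close>. Below \<open>B\<close> only an upper estimate can hold, as \<open>f\<close> may
  be close to a root.\<close>

lemma poly_comp_props:
  fixes f :: "'a::{complete_ultrametric_field, alg_closed_field, field_char_0} fls" and p :: "'a poly"
  assumes f: "f \<in> mero" "fls_deriv f \<noteq> 0" and p: "p \<noteq> 0"
  shows "poly_comp p f \<noteq> 0"
    and "dvs f \<gamma> < 0 \<Longrightarrow> dvs (poly_comp p f) \<gamma> = real (degree p) * dvs f \<gamma>"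
    and "dvs f \<gamma> \<ge> 0 \<Longrightarrow> dvs (poly_comp p f) \<gamma> \<ge> 0"
    and "\<exists>B C. B \<ge> 1 \<and> C \<ge> 0 \<and> (\<forall>r\<ge>1.
      (mnorm r f > B \<longrightarrow> \<bar>ln (mnorm r (poly_comp p f)) - real (degree p) * ln (mnorm r f)\<bar> \<le> C) \<and>
      (mnorm r f \<le> B \<longrightarrow> ln (mnorm r (poly_comp p f)) \<le> C))"
proof -
  note * = mero_order_diff_const[OF f]
  define S where "S p \<longleftrightarrow> poly_comp p f \<noteq> 0 \<and>
    (\<forall>\<gamma>. (dvs f \<gamma> < 0 \<longrightarrow> dvs (poly_comp p f) \<gamma> = real (degree p) * dvs f \<gamma>) \<and>
         (dvs f \<gamma> \<ge> 0 \<longrightarrow> dvs (poly_comp p f) \<gamma> \<ge> 0)) \<and>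
    (\<exists>B C. B \<ge> 1 \<and> C \<ge> 0 \<and> (\<forall>r\<ge>1.
      (mnorm r f > B \<longrightarrow> \<bar>ln (mnorm r (poly_comp p f)) - real (degree p) * ln (mnorm r f)\<bar> \<le> C) \<and>
      (mnorm r f \<le> B \<longrightarrow> ln (mnorm r (poly_comp p f)) \<le> C)))" for p
  have "S p"
    using p
  proof (induction p rule: alg_closed_poly_induct)
    case (const c)
    have "\<exists>B C. B \<ge> 1 \<and> C \<ge> 0 \<and> (\<forall>r\<ge>1.
      (mnorm r f > B \<longrightarrow> \<bar>ln (absv c)\<bar> \<le> C) \<and> (mnorm r f \<le> B \<longrightarrow> ln (absv c) \<le> C))"
      by (rule exI[of _ 1], rule exI[of _ "\<bar>ln (absv c)\<bar>"]) (simp add: abs_ge_self)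
    then show ?case using const by (simp add: S_def dvs_def)
  next
    case (linear w p)
    define q where "q = [:- w, 1:] * p"
    let ?Q = "poly_comp p f" and ?w = "f - fls_const w"
    have deg: "degree q = Suc (degree p)" unfolding q_def using linear(1) by (subst degree_mult_eq) auto
    have Q: "poly_comp q f = ?w * ?Q" unfolding q_def poly_comp_mult poly_comp_linear ..
    have Q0: "?Q \<noteq> 0" using linear(2) by (simp add: S_def)
    have dvsQ: "dvs (poly_comp q f) \<gamma> = dvs ?w \<gamma> + dvs ?Q \<gamma>" for \<gamma>
      unfolding Q using f Q0 *(2)[of w] by (intro dvs_mult) simp_all
    obtain B C where BC: "B \<ge> 1" "C \<ge> 0"
      "\<And>r. r \<ge> 1 \<Longrightarrow> mnorm r f > B \<Longrightarrow> \<bar>ln (mnorm r ?Q) - real (degree p) * ln (mnorm r f)\<bar> \<le> C"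
      "\<And>r. r \<ge> 1 \<Longrightarrow> mnorm r f \<le> B \<Longrightarrow> ln (mnorm r ?Q) \<le> C"
      using linear(2) unfolding S_def by blast
    define B' where "B' = max B (absv w)"
    define C' where "C' = C + real (degree p) * ln B' + ln B'"
    have B': "B' \<ge> 1" "B' \<ge> B" "B' \<ge> absv w" using BC(1) by (auto simp: B'_def)
    have nn: "real (degree p) * ln B' \<ge> 0" "ln B' \<ge> 0" using B'(1) by simp_all
    then have C': "C' \<ge> 0" "C' \<ge> C" using BC(2) unfolding C'_def by simp_all
    have lnQ: "ln (mnorm r (poly_comp q f)) = ln (mnorm r ?w) + ln (mnorm r ?Q)" if "r \<ge> 1" for r
      unfolding Q using f Q0 *(2)[of w] that by (intro ln_mnorm_mult) simp_all
    have big: "\<bar>ln (mnorm r (poly_comp q f)) - real (degree q) * ln (mnorm r f)\<bar> \<le> C'"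
      if r: "r \<ge> 1" "mnorm r f > B'" for r
    proof -
      have "mnorm r ?w = mnorm r f" using f r B' by (intro mnorm_diff_const_eq) simp_all
      then have "ln (mnorm r (poly_comp q f)) - real (degree q) * ln (mnorm r f) =
          ln (mnorm r ?Q) - real (degree p) * ln (mnorm r f)"
        using lnQ[OF r(1)] deg by (simp add: algebra_simps)
      then show ?thesis using BC(3)[of r] r B' C' by simp
    qed
    have small: "ln (mnorm r (poly_comp q f)) \<le> C'" if r: "r \<ge> 1" "mnorm r f \<le> B'" for r
    proof -
      have pos: "mnorm r ?w > 0" "mnorm r f > 0"
        using mnorm_pos[OF *(3,2)[of w]] mnorm_pos[OF f(1) *(1)] r by auto
      have "mnorm r ?w \<le> B'"
        using mnorm_diff_le[OF f(1) mero_const, of r w] r B' by simp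
      then have 1: "ln (mnorm r ?w) \<le> ln B'" using pos B' by (subst ln_le_cancel_iff) linarith+
      have "ln (mnorm r ?Q) \<le> C + real (degree p) * ln B'"
      proof (cases "mnorm r f > B")
        case True
        have "ln (mnorm r f) \<le> ln B'" using pos B' r by (subst ln_le_cancel_iff) linarith+
        then have "real (degree p) * ln (mnorm r f) \<le> real (degree p) * ln B'"
          by (intro mult_left_mono) simp_all
        then show ?thesis using BC(3)[OF r(1) True] by linarith
      next
        case False
        then have "ln (mnorm r ?Q) \<le> C" using BC(4)[OF r(1)] by simp
        then show ?thesis using nn(1) by linarith
      qed
      then show ?thesis using 1 lnQ[OF r(1)] by (simp add: C'_def)
    qed
    have pole: "dvs (poly_comp q f) \<gamma> = real (degree q) * dvs f \<gamma>" if "dvs f \<gamma> < 0" for \<gamma>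
    proof -
      have "dvs ?w \<gamma> = dvs f \<gamma>" using that *(5)[of \<gamma> w] by (simp add: dvs_def)
      moreover have "dvs ?Q \<gamma> = real (degree p) * dvs f \<gamma>" using linear(2) that by (simp add: S_def)
      ultimately show ?thesis using dvsQ[of \<gamma>] deg by (simp add: algebra_simps)
    qed
    have nopole: "dvs (poly_comp q f) \<gamma> \<ge> 0" if "dvs f \<gamma> \<ge> 0" for \<gamma>
    proof -
      have "dvs ?w \<gamma> \<ge> 0" using that *(6)[of \<gamma> w] unfolding dvs_def by linarith
      moreover have "dvs ?Q \<gamma> \<ge> 0" using linear(2) that by (simp add: S_def)
      ultimately show ?thesis using dvsQ[of \<gamma>] by linarith
    qed
    have "poly_comp q f \<noteq> 0" unfolding Q using Q0 *(2)[of w] by simp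
    then have "S q" unfolding S_def using pole nopole big small B'(1) C'(1) by blast
    then show ?case unfolding q_def .
  qed
  then show "poly_comp p f \<noteq> 0"
    and "dvs f \<gamma> < 0 \<Longrightarrow> dvs (poly_comp p f) \<gamma> = real (degree p) * dvs f \<gamma>"
    and "dvs f \<gamma> \<ge> 0 \<Longrightarrow> dvs (poly_comp p f) \<gamma> \<ge> 0"
    and "\<exists>B C. B \<ge> 1 \<and> C \<ge> 0 \<and> (\<forall>r\<ge>1.
      (mnorm r f > B \<longrightarrow> \<bar>ln (mnorm r (poly_comp p f)) - real (degree p) * ln (mnorm r f)\<bar> \<le> C) \<and>
      (mnorm r f \<le> B \<longrightarrow> ln (mnorm r (poly_comp p f)) \<le> C))"
    unfolding S_def by auto
qed

lemma pd_poly_comp: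
  fixes f :: "'a::{complete_ultrametric_field, alg_closed_field, field_char_0} fls"
  assumes f: "f \<in> mero" "fls_deriv f \<noteq> 0" and p: "p \<noteq> 0"
  shows "pd (poly_comp p f) \<gamma> = real (degree p) * pd f \<gamma>"
proof (cases "dvs f \<gamma> < 0")
  case True
  have "real (degree p) * dvs f \<gamma> \<le> 0" using True by (intro mult_nonneg_nonpos) simp_all
  then show ?thesis using poly_comp_props(2)[OF f p True] True by (simp add: pd_def)
next
  case False
  then show ?thesis using poly_comp_props(3)[OF f p, of \<gamma>] by (simp add: pd_def)
qed

lemma nev_poly_comp:
  fixes f :: "'a::{complete_ultrametric_field, alg_closed_field, field_char_0} fls"
  assumes f: "f \<in> mero" "fls_deriv f \<noteq> 0" and p: "p \<noteq> 0"
  shows "\<exists>C. \<forall>r\<ge>1. \<bar>nev r (poly_comp p f) - real (degree p) * nev r f\<bar> \<le> C"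
proof -
  let ?d = "real (degree p)"
  obtain B C where BC: "B \<ge> 1" "C \<ge> 0"
    "\<And>r. r \<ge> 1 \<Longrightarrow> mnorm r f > B \<Longrightarrow> \<bar>ln (mnorm r (poly_comp p f)) - ?d * ln (mnorm r f)\<bar> \<le> C"
    "\<And>r. r \<ge> 1 \<Longrightarrow> mnorm r f \<le> B \<Longrightarrow> ln (mnorm r (poly_comp p f)) \<le> C"
    using poly_comp_props(4)[OF f p] by blast
  have "\<bar>nev r (poly_comp p f) - ?d * nev r f\<bar> \<le> C + ?d * ln B" if r: "r \<ge> 1" for r
  proof -
    have "cnt r (pd (poly_comp p f)) = ?d * cnt r (pd f)"
      unfolding cnt_cmult[symmetric] using pd_poly_comp[OF f p] by presburger
    then have eq: "nev r (poly_comp p f) - ?d * nev r f =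
        max 0 (ln (mnorm r (poly_comp p f))) - ?d * max 0 (ln (mnorm r f))"
      unfolding nev_def by (simp add: algebra_simps)
    have nn: "?d * ln B \<ge> 0" using BC(1) by simp
    show ?thesis
    proof (cases "mnorm r f > B")
      case True
      then have "ln (mnorm r f) \<ge> 0" using BC(1) by simp
      moreover from this have "?d * ln (mnorm r f) \<ge> 0" by simp
      ultimately show ?thesis using eq BC(3)[OF r True] nn by (simp add: max_def split: if_splits)
    next
      case False
      have "ln (mnorm r f) \<le> ln B"
        using False mero_order_diff_const(1)[OF f] mnorm_pos[OF f(1), of r] r
        by (subst ln_le_cancel_iff) simp_all
      then have "?d * max 0 (ln (mnorm r f)) \<le> ?d * ln B"
        using BC(1) by (intro mult_left_mono) simp_all
      moreover have "?d * max 0 (ln (mnorm r f)) \<ge> 0" by simp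
      moreover have "ln (mnorm r (poly_comp p f)) \<le> C" using BC(4)[OF r] False by simp
      ultimately show ?thesis using eq BC(2) by linarith
    qed
  qed
  then show ?thesis by blast
qed

text \<open>At poles of \<open>f\<close> the orders of \<open>f'\<close> and \<open>p(f)\<close> do
  not cancel, so the pole divisors add up; by Jensen's formula the poles and the norm of
  \<open>f'\<close> amount to its zeroes. These zeroes are kept because they also occur in the upper
  bound \<open>cnt_tr2_dprod_le\<close> and are to cancel there.\<close>

lemma nev_deriv_poly_comp_ge:
  fixes f :: "'a::{complete_ultrametric_field, alg_closed_field, field_char_0} fls"
  assumes f: "f \<in> mero" "fls_deriv f \<noteq> 0" and p: "p \<noteq> 0"
  shows "\<exists>C. \<forall>r\<ge>1. real (degree p) * nev r f + cnt r (zd (fls_deriv f)) \<le>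
    nev r (fls_deriv f * poly_comp p f) + C"
proof -
  let ?d = "real (degree p)" and ?\<Phi> = "fls_deriv f * poly_comp p f"
  note * = mero_order_diff_const[OF f]
  note pp = poly_comp_props[OF f p]
  obtain B C where BC: "B \<ge> 1" "C \<ge> 0"
    "\<And>r. r \<ge> 1 \<Longrightarrow> mnorm r f > B \<Longrightarrow> \<bar>ln (mnorm r (poly_comp p f)) - ?d * ln (mnorm r f)\<bar> \<le> C"
    using pp(4) by blast
  have pd: "pd ?\<Phi> \<gamma> = ?d * pd f \<gamma> + pd (fls_deriv f) \<gamma>" for \<gamma>
  proof -
    have eq: "dvs ?\<Phi> \<gamma> = dvs (fls_deriv f) \<gamma> + dvs (poly_comp p f) \<gamma>"
      using f pp(1) by (intro dvs_mult) simp_all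
    show ?thesis
    proof (cases "dvs f \<gamma> < 0")
      case True
      have "?d * dvs f \<gamma> \<le> 0" using True by (intro mult_nonneg_nonpos) simp_all
      then show ?thesis
        using eq pp(2)[OF True] dvs_deriv_cases(1)[OF f True] True by (simp add: pd_def)
    next
      case False
      then show ?thesis
        using eq pp(3)[of \<gamma>] dvs_deriv_cases(2)[OF f, of \<gamma>] by (simp add: pd_def)
    qed
  qed
  have "?d * nev r f + cnt r (zd (fls_deriv f)) \<le>
      nev r ?\<Phi> + (C + \<bar>ln (mnorm 1 (fls_deriv f))\<bar> + (?d + 1) * ln B)" if r: "r \<ge> 1" for r
  proof -
    have lnf': "ln (mnorm r (fls_deriv f)) \<le> ln (mnorm r f)"
      by (rule ln_mnorm_deriv_le[OF f r])
    have ln\<Phi>: "ln (mnorm r ?\<Phi>) = ln (mnorm r (fls_deriv f)) + ln (mnorm r (poly_comp p f))"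
      using f pp(1) r by (intro ln_mnorm_mult) simp_all
    have key: "?d * max 0 (ln (mnorm r f)) + ln (mnorm r (fls_deriv f)) \<le>
        max 0 (ln (mnorm r ?\<Phi>)) + (C + (?d + 1) * ln B)"
    proof (cases "mnorm r f > B")
      case True
      then have "ln (mnorm r f) \<ge> 0" using BC(1) by simp
      then have "max 0 (ln (mnorm r f)) = ln (mnorm r f)" by simp
      moreover have "(?d + 1) * ln B \<ge> 0" using BC(1) by simp
      ultimately show ?thesis using BC(3)[OF r True] ln\<Phi> by linarith
    next
      case False
      have le: "ln (mnorm r f) \<le> ln B"
        using False *(1) mnorm_pos[OF f(1), of r] r by (subst ln_le_cancel_iff) simp_all
      then have "?d * max 0 (ln (mnorm r f)) \<le> ?d * ln B"
        using BC(1) by (intro mult_left_mono) simp_all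
      then show ?thesis using lnf' le BC(2) by (simp add: distrib_right)
    qed
    have "cnt r (pd ?\<Phi>) = cnt r (\<lambda>\<gamma>. ?d * pd f \<gamma> + pd (fls_deriv f) \<gamma>)"
      using pd by presburger
    also have "\<dots> = ?d * cnt r (pd f) + cnt r (pd (fls_deriv f))"
      using f *(1) by (simp add: cnt_add cnt_cmult)
    finally have "nev r ?\<Phi> = ?d * cnt r (pd f) + cnt r (pd (fls_deriv f)) + max 0 (ln (mnorm r ?\<Phi>))"
      unfolding nev_def by simp
    moreover have "cnt r (zd (fls_deriv f)) =
        ln (mnorm r (fls_deriv f)) - ln (mnorm 1 (fls_deriv f)) + cnt r (pd (fls_deriv f))"
      using f r by (intro cnt_zd) simp_all
    ultimately show ?thesis using key unfolding nev_def by (simp add: distrib_left)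
  qed
  then show ?thesis by blast
qed

text \<open>The function \<open>f' P'(f)\<close> for \<open>P'(x) = b \<Prod>\<^sub>i (x - a\<^sub>i)^(k\<^sub>i)\<close>.\<close>

definition dprod :: "'b set \<Rightarrow> ('b \<Rightarrow> 'a::field) \<Rightarrow> ('b \<Rightarrow> nat) \<Rightarrow> 'a \<Rightarrow> 'a fls \<Rightarrow> 'a fls" where
  "dprod I a k b f = fls_deriv f * (fls_const b * (\<Prod>i\<in>I. (f - fls_const (a i)) ^ k i))"

lemma dprod_props:
  fixes f :: "'a::{complete_ultrametric_field, alg_closed_field, field_char_0} fls"
  assumes f: "f \<in> mero" "fls_deriv f \<noteq> 0" and I: "finite I" "inj_on a I" and b: "b \<noteq> 0"
  shows "dprod I a k b f \<in> mero" "dprod I a k b f \<noteq> 0"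
    and "dvs f \<gamma> < 0 \<Longrightarrow> dvs (dprod I a k b f) \<gamma> = (real (\<Sum>i\<in>I. k i) + 1) * dvs f \<gamma> - 1"
    and "i \<in> I \<Longrightarrow> dvs (f - fls_const (a i)) \<gamma> > 0 \<Longrightarrow>
      dvs (dprod I a k b f) \<gamma> = (real (k i) + 1) * dvs (f - fls_const (a i)) \<gamma> - 1"
    and "dvs f \<gamma> \<ge> 0 \<Longrightarrow> (\<And>i. i \<in> I \<Longrightarrow> dvs (f - fls_const (a i)) \<gamma> \<le> 0) \<Longrightarrow>
      dvs (dprod I a k b f) \<gamma> = dvs (fls_deriv f) \<gamma>"
proof -
  note * = mero_order_diff_const[OF f] and d = dvs_deriv_cases[OF f]
  show "dprod I a k b f \<in> mero" using f by (simp add: dprod_def)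
  show "dprod I a k b f \<noteq> 0" using f b *(2) I(1) by (simp add: dprod_def)
  have P: "(\<Prod>i\<in>I. (f - fls_const (a i)) ^ k i) \<in> mero" "(\<Prod>i\<in>I. (f - fls_const (a i)) ^ k i) \<noteq> 0"
    using f(1) *(2) I(1) by simp_all
  have "dvs (dprod I a k b f) \<gamma> = dvs (fls_deriv f) \<gamma> +
      dvs (fls_const b * (\<Prod>i\<in>I. (f - fls_const (a i)) ^ k i)) \<gamma>"
    unfolding dprod_def using f P b by (intro dvs_mult) simp_all
  also have "dvs (fls_const b * (\<Prod>i\<in>I. (f - fls_const (a i)) ^ k i)) \<gamma> =
      dvs (fls_const b) \<gamma> + dvs (\<Prod>i\<in>I. (f - fls_const (a i)) ^ k i) \<gamma>"
    using P b by (intro dvs_mult) simp_all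
  also have "dvs (fls_const b) \<gamma> = 0" using b by (simp add: dvs_def)
  also have "dvs (\<Prod>i\<in>I. (f - fls_const (a i)) ^ k i) \<gamma> = (\<Sum>i\<in>I. dvs ((f - fls_const (a i)) ^ k i) \<gamma>)"
    using f(1) *(2) by (intro dvs_prod) simp_all
  also have "\<dots> = (\<Sum>i\<in>I. real (k i) * dvs (f - fls_const (a i)) \<gamma>)"
    using f(1) *(2) by (intro sum.cong refl dvs_power) simp_all
  finally have eq: "dvs (dprod I a k b f) \<gamma> =
      dvs (fls_deriv f) \<gamma> + (\<Sum>i\<in>I. real (k i) * dvs (f - fls_const (a i)) \<gamma>)" by simp
  have ge0: "dvs (f - fls_const c) \<gamma> \<ge> 0" if "dvs f \<gamma> \<ge> 0" for c
    using that *(6)[of \<gamma> c] unfolding dvs_def by linarith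
  show "dvs (dprod I a k b f) \<gamma> = (real (\<Sum>i\<in>I. k i) + 1) * dvs f \<gamma> - 1" if "dvs f \<gamma> < 0"
  proof -
    have "dvs (f - fls_const c) \<gamma> = dvs f \<gamma>" for c
      using that *(5)[of \<gamma>] by (simp add: dvs_def)
    then show ?thesis using eq d(1)[OF that] by (simp add: sum_distrib_left algebra_simps)
  qed
  show "dvs (dprod I a k b f) \<gamma> = (real (k i) + 1) * dvs (f - fls_const (a i)) \<gamma> - 1"
    if i: "i \<in> I" "dvs (f - fls_const (a i)) \<gamma> > 0"
  proof -
    have "dvs (f - fls_const (a j)) \<gamma> = 0" if "j \<in> I - {i}" for j
      using mero_order_zero_unique[OF f, of "a i" "a j" \<gamma>] that I(2) i by (auto simp: dvs_def inj_on_def)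
    then show ?thesis
      using eq d(3)[OF i(2)] i(1) I(1) by (simp add: sum.remove[of I i] algebra_simps)
  qed
  show "dvs (dprod I a k b f) \<gamma> = dvs (fls_deriv f) \<gamma>"
    if "dvs f \<gamma> \<ge> 0" "\<And>i. i \<in> I \<Longrightarrow> dvs (f - fls_const (a i)) \<gamma> \<le> 0"
  proof -
    have "dvs (f - fls_const (a i)) \<gamma> = 0" if "i \<in> I" for i
      using \<open>dvs f \<gamma> \<ge> 0\<close> ge0 \<open>\<And>i. i \<in> I \<Longrightarrow> dvs (f - fls_const (a i)) \<gamma> \<le> 0\<close>[OF that] by (meson antisym)
    then show ?thesis using eq by simp
  qed
qed

text \<open>Truncation makes the exponents \<open>k i\<close> disappear: each pole of
  \<open>f\<close> and each zero of some \<open>f - a i\<close> contributes at most 2. Any other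
  zero is one of \<open>f'\<close>.\<close>

lemma cnt_tr2_dprod_le:
  fixes f :: "'a::{complete_ultrametric_field, alg_closed_field, field_char_0} fls"
  assumes f: "f \<in> mero" "fls_deriv f \<noteq> 0" and I: "finite I" "inj_on a I" and b: "b \<noteq> 0"
  shows "\<exists>C. \<forall>r\<ge>1. cnt r (tr2 (dprod I a k b f)) \<le>
    (2 + 2 * real (card I)) * nev r f + cnt r (zd (fls_deriv f)) + C"
proof -
  let ?\<Phi> = "dprod I a k b f"
  note * = mero_order_diff_const[OF f]
  note dp = dprod_props[OF f I b, where k = k]
  have pt: "tr2 ?\<Phi> \<gamma> \<le> 2 * pd f \<gamma> + 2 * (\<Sum>i\<in>I. zd (f - fls_const (a i)) \<gamma>) + zd (fls_deriv f) \<gamma>" for \<gamma>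
  proof -
    have nn: "(\<Sum>i\<in>J. zd (f - fls_const (a i)) \<gamma>) \<ge> 0" for J by (intro sum_nonneg) simp
    consider "dvs f \<gamma> < 0" | i where "i \<in> I" "dvs (f - fls_const (a i)) \<gamma> > 0" |
      "dvs f \<gamma> \<ge> 0" "\<And>i. i \<in> I \<Longrightarrow> dvs (f - fls_const (a i)) \<gamma> \<le> 0" by force
    then show ?thesis
    proof cases
      case 1
      have "tr2 ?\<Phi> \<gamma> \<le> 2" by (simp add: tr2_def)
      moreover have "pd f \<gamma> \<ge> 1" using dvs_le_minus_1[OF 1] by (simp add: pd_def)
      ultimately show ?thesis using nn[of I] zd_nonneg[of "fls_deriv f" \<gamma>] by linarith
    next
      case 2
      have "tr2 ?\<Phi> \<gamma> \<le> 2" by (simp add: tr2_def)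
      moreover have "zd (f - fls_const (a i)) \<gamma> \<ge> 1" using dvs_ge_1[OF 2(2)] by (simp add: zd_def)
      moreover have "(\<Sum>i\<in>I. zd (f - fls_const (a i)) \<gamma>) =
          zd (f - fls_const (a i)) \<gamma> + (\<Sum>i\<in>I-{i}. zd (f - fls_const (a i)) \<gamma>)"
        using I(1) 2(1) by (rule sum.remove)
      ultimately show ?thesis
        using nn[of "I - {i}"] zd_nonneg[of "fls_deriv f" \<gamma>] pd_nonneg[of f \<gamma>] by linarith
    next
      case 3
      have "dvs ?\<Phi> \<gamma> = dvs (fls_deriv f) \<gamma>" by (rule dp(5)[OF 3(1)]) (use 3(2) in blast)
      then have "tr2 ?\<Phi> \<gamma> \<le> zd (fls_deriv f) \<gamma>"
        using dvs_deriv_cases(2)[OF f 3(1)] by (simp add: tr2_def zd_def)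
      then show ?thesis using nn[of I] pd_nonneg[of f \<gamma>] by linarith
    qed
  qed
  have "\<exists>C. \<forall>i. \<forall>r\<ge>1. cnt r (zd (f - fls_const (a i))) \<le> nev r f + C i"
    using cnt_zd_diff_const_le[OF f] by (intro choice) blast
  then obtain C where C: "\<And>i r. r \<ge> 1 \<Longrightarrow> cnt r (zd (f - fls_const (a i))) \<le> nev r f + C i" by blast
  have "cnt r (tr2 ?\<Phi>) \<le> (2 + 2 * real (card I)) * nev r f + cnt r (zd (fls_deriv f)) + 2 * sum C I"
    if r: "r \<ge> 1" for r
  proof -
    have "cnt r (tr2 ?\<Phi>) \<le>
        cnt r (\<lambda>\<gamma>. 2 * pd f \<gamma> + 2 * (\<Sum>i\<in>I. zd (f - fls_const (a i)) \<gamma>) + zd (fls_deriv f) \<gamma>)"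
      using pt f *(1,2) dp(1,2) r by (intro cnt_mono) simp_all
    also have "\<dots> = 2 * cnt r (pd f) + 2 * (\<Sum>i\<in>I. cnt r (zd (f - fls_const (a i)))) + cnt r (zd (fls_deriv f))"
      using f *(1,2) by (simp add: cnt_add cnt_cmult cnt_sum)
    moreover have "(\<Sum>i\<in>I. cnt r (zd (f - fls_const (a i)))) \<le> (\<Sum>i\<in>I. nev r f + C i)"
      using C[OF r] by (intro sum_mono)
    moreover have "(\<Sum>i\<in>I. nev r f + C i) = real (card I) * nev r f + sum C I"
      by (simp add: sum.distrib)
    ultimately show ?thesis using cnt_pd_le_nev[of r f] by (simp add: distrib_right)
  qed
  then show ?thesis by blast
qed

section \<open>Sharing a small function\<close>

text \<open>Smallness with factor \<open>1 / (2 * A')\<close> turns the hypothesis into a bound of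
  \<open>nev r f\<close> by half of itself plus a constant, against \<open>nev_growth\<close>. The
  exclusions of the non-generic cases and the main estimates all end here.\<close>

lemma nev_not_le_small:
  fixes f \<alpha> :: "'a::{complete_ultrametric_field, alg_closed_field, field_char_0} fls"
  assumes f: "f \<in> mero" "fls_deriv f \<noteq> 0" and \<alpha>: "\<alpha> \<in> mero" "\<alpha> \<noteq> 0" and small: "small_wrt \<alpha> f"
    and le: "\<And>r. r \<ge> 1 \<Longrightarrow> nev r f \<le> A * nev r \<alpha> + C"
  shows False
proof -
  have f0: "f \<noteq> 0" using f by auto
  obtain C1 where C1: "\<And>r. r \<ge> 1 \<Longrightarrow> ln r \<le> 2 * nev r f + C1" using nev_growth[OF f] by blast
  define A' where "A' = max A 1"
  have A': "A' > 0" "A \<le> A'" by (auto simp: A'_def)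
  have "\<exists>C R. \<forall>r\<ge>R. nev r \<alpha> \<le> 1 / (2 * A') * nev r f + C"
    using A'(1) by (intro small_wrt_nev[OF small f(1) f0 \<alpha> C1]) simp_all
  then obtain C2 R where C2: "\<And>r. r \<ge> R \<Longrightarrow> nev r \<alpha> \<le> 1 / (2 * A') * nev r f + C2" by blast
  define K where "K = 2 * (A' * C2 + C)"
  \<comment> \<open>Large enough that \<open>ln r\<close> exceeds \<open>2 * K + C1\<close>, which
    \<open>nev_growth\<close> forbids as \<open>nev r f \<le> K\<close>.\<close>
  define r where "r = max (max 1 R) (exp (2 * K + C1 + 1))"
  have r: "r \<ge> 1" "r \<ge> R" "r \<ge> exp (2 * K + C1 + 1)" by (auto simp: r_def)
  have "A * nev r \<alpha> \<le> A' * nev r \<alpha>" using A' nev_nonneg[OF r(1)] by (intro mult_right_mono)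
  also have "\<dots> \<le> A' * (1 / (2 * A') * nev r f + C2)" using A' C2[OF r(2)] by (intro mult_left_mono) simp_all
  also have "\<dots> = nev r f / 2 + A' * C2" using A' by (simp add: field_simps)
  finally have "nev r f \<le> K" using le[OF r(1)] by (simp add: K_def)
  moreover have "2 * K + C1 + 1 \<le> ln r" using r by (subst ln_ge_iff) simp_all
  ultimately show False using C1[OF r(1)] by simp
qed

lemma transcendental_meroD:
  fixes f :: "'a::{complete_ultrametric_field, alg_closed_field, field_char_0} fls"
  assumes "transcendental_mero f"
  shows "f \<in> mero" "fls_deriv f \<noteq> 0"
proof -
  show "f \<in> mero" using assms by (simp add: transcendental_mero_def)
  show "fls_deriv f \<noteq> 0"
  proof
    assume "fls_deriv f = 0"
    then obtain c where "f = fls_const c" unfolding fls_deriv_eq_0_iff by blast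
    then have "f = fps_to_fls (fps_of_poly [:c:]) / fps_to_fls (fps_of_poly 1)"
      by (simp add: fps_of_poly_const)
    then have "rational_fun f" unfolding rational_fun_def by (metis zero_neq_one)
    then show False using assms by (simp add: transcendental_mero_def)
  qed
qed

lemma degree_prod_linear_powers:
  fixes a :: "'b \<Rightarrow> 'a::field"
  assumes "b \<noteq> 0"
  shows "smult b (\<Prod>i\<in>I. [:- a i, 1:] ^ k i) \<noteq> 0"
    and "finite I \<Longrightarrow> degree (smult b (\<Prod>i\<in>I. [:- a i, 1:] ^ k i)) = (\<Sum>i\<in>I. k i)"
proof -
  have nz: "(\<Prod>i\<in>J. [:- a i, 1:] ^ k i) \<noteq> 0" for J
    by (induction J rule: infinite_finite_induct) auto
  then show "smult b (\<Prod>i\<in>I. [:- a i, 1:] ^ k i) \<noteq> 0" using assms by simp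
  have "degree (\<Prod>i\<in>J. [:- a i, 1:] ^ k i) = (\<Sum>i\<in>J. k i)" if "finite J" for J
    using that by induction (simp_all add: degree_mult_eq nz degree_power_eq)
  then show "finite I \<Longrightarrow> degree (smult b (\<Prod>i\<in>I. [:- a i, 1:] ^ k i)) = (\<Sum>i\<in>I. k i)"
    using assms by simp
qed

lemma dprod_eq_poly_comp:
  "dprod I a k b f = fls_deriv f * poly_comp (smult b (\<Prod>i\<in>I. [:- a i, 1:] ^ k i)) f"
  unfolding dprod_def poly_comp_smult poly_comp_prod poly_comp_power poly_comp_linear ..

lemma nev_dprod_ge:
  fixes f :: "'a::{complete_ultrametric_field, alg_closed_field, field_char_0} fls"
  assumes f: "f \<in> mero" "fls_deriv f \<noteq> 0" and I: "finite I" and b: "b \<noteq> 0"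
  shows "\<exists>C. \<forall>r\<ge>1. real (\<Sum>i\<in>I. k i) * nev r f + cnt r (zd (fls_deriv f)) \<le>
    nev r (dprod I a k b f) + C"
  using nev_deriv_poly_comp_ge[OF f degree_prod_linear_powers(1)[OF b, where I = I and a = a and k = k]]
  unfolding dprod_eq_poly_comp degree_prod_linear_powers(2)[OF b I] .

text \<open>Otherwise \<open>f' P'(f)\<close> is a constant multiple of \<open>\<alpha>\<close>,
  while its characteristic is at least that of \<open>f\<close> up to a constant.\<close>

lemma dprod_divide_nonconst:
  fixes f \<alpha> :: "'a::{complete_ultrametric_field, alg_closed_field, field_char_0} fls"
  assumes f: "f \<in> mero" "fls_deriv f \<noteq> 0" and I: "finite I" "inj_on a I" and b: "b \<noteq> 0"
    and \<alpha>: "\<alpha> \<in> mero" "\<alpha> \<noteq> 0" and small: "small_wrt \<alpha> f" and d: "(\<Sum>i\<in>I. k i) \<ge> 1"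
  shows "fls_deriv (dprod I a k b f / \<alpha>) \<noteq> 0"
proof
  let ?\<Phi> = "dprod I a k b f"
  note dp = dprod_props(1,2)[OF f I b, of k]
  assume "fls_deriv (?\<Phi> / \<alpha>) = 0"
  then obtain c where c: "?\<Phi> / \<alpha> = fls_const c" unfolding fls_deriv_eq_0_iff by blast
  then have eq: "?\<Phi> = fls_const c * \<alpha>" using \<alpha> by (simp add: field_simps)
  then have "c \<noteq> 0" using dp by auto
  obtain C where C: "\<And>r. r \<ge> 1 \<Longrightarrow> real (\<Sum>i\<in>I. k i) * nev r f + cnt r (zd (fls_deriv f)) \<le> nev r ?\<Phi> + C"
    using nev_dprod_ge[OF f I(1) b] by blast
  have "nev r f \<le> 1 * nev r \<alpha> + (max 0 (ln (absv c)) + C)" if r: "r \<ge> 1" for r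
  proof -
    have "pd (fls_const c) = (\<lambda>_. 0)" using \<open>c \<noteq> 0\<close> by (simp add: pd_def dvs_def fun_eq_iff)
    then have "nev r (fls_const c) = max 0 (ln (absv c))" using r by (simp add: nev_def)
    moreover have "nev r ?\<Phi> \<le> nev r (fls_const c) + nev r \<alpha>"
      unfolding eq using \<open>c \<noteq> 0\<close> \<alpha> r by (intro nev_mult_le) simp_all
    moreover have "1 * nev r f \<le> real (\<Sum>i\<in>I. k i) * nev r f"
      using d nev_nonneg[OF r, of f] by (intro mult_right_mono) (simp_all del: of_nat_sum)
    moreover have "cnt r (zd (fls_deriv f)) \<ge> 0" using r by (intro cnt_nonneg) simp_all
    ultimately show ?thesis using C[OF r] by linarith
  qed
  from nev_not_le_small[OF f \<alpha> small this] show False .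
qed

lemma share_CM_zd:
  fixes \<Phi> \<Gamma> \<alpha> :: "'a::{complete_ultrametric_field, alg_closed_field, field_char_0} fls"
  assumes share: "share_CM \<Phi> \<Gamma> \<alpha>" and mero: "\<Phi> \<in> mero" "\<Gamma> \<in> mero" "\<alpha> \<in> mero" "\<alpha> \<noteq> 0"
    and ne: "\<Phi> \<noteq> \<alpha>" "\<Gamma> \<noteq> \<alpha>" and \<gamma>: "dvs \<alpha> \<gamma> = 0"
  shows "zd (\<Phi> / \<alpha> - 1) \<gamma> = zd (\<Gamma> / \<alpha> - 1) \<gamma>"
proof -
  have "zd (h / \<alpha> - 1) \<gamma> = real (nat (mero_order \<gamma> (h - \<alpha>)))" if "h \<in> mero" "h \<noteq> \<alpha>" for h
  proof -
    have "h / \<alpha> - 1 = (h - \<alpha>) / \<alpha>" using mero(4) by (simp add: field_simps)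
    then have "dvs (h / \<alpha> - 1) \<gamma> = dvs (h - \<alpha>) \<gamma> - dvs \<alpha> \<gamma>" using that mero by (simp add: dvs_def)
    then show ?thesis using \<gamma> by (simp add: zd_def dvs_def)
  qed
  moreover have "nat (mero_order \<gamma> (\<Phi> - \<alpha>)) = nat (mero_order \<gamma> (\<Gamma> - \<alpha>))"
    using share ne unfolding share_CM_def zero_mult_def by simp
  ultimately show ?thesis using mero ne by simp
qed

text \<open>Adding the bounds for \<open>F\<close> and \<open>G\<close> counts the truncated
  divisors twice: \<open>2 * (2 + 2 * card I)\<close> characteristics and two copies of the zeroes
  of the derivatives. One copy stands on the left in \<open>nev_dprod_ge\<close>, the other costs 2
  by \<open>cnt_zd_deriv_le\<close>. The total \<open>4 * card I + 6\<close> is one less than the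
  assumed degree.\<close>

lemma dprod_share_cases:
  fixes f g \<alpha> :: "'a::{complete_ultrametric_field, alg_closed_field, field_char_0} fls"
  assumes f: "f \<in> mero" "fls_deriv f \<noteq> 0" and g: "g \<in> mero" "fls_deriv g \<noteq> 0"
    and I: "finite I" "inj_on a I" and b: "b \<noteq> 0"
    and \<alpha>: "\<alpha> \<in> mero" "\<alpha> \<noteq> 0" and small: "small_wrt \<alpha> f" "small_wrt \<alpha> g"
    and d: "(\<Sum>i\<in>I. k i) \<ge> 4 * card I + 7"
    and share: "share_CM (dprod I a k b f) (dprod I a k b g) \<alpha>"
  shows "dprod I a k b f = dprod I a k b g \<or> dprod I a k b f * dprod I a k b g = \<alpha> ^ 2"
proof (rule ccontr)
  assume neither: "\<not> ?thesis"
  let ?\<Phi> = "dprod I a k b f" and ?\<Gamma> = "dprod I a k b g"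
  let ?q = "real (card I)" and ?d = "real (\<Sum>i\<in>I. k i)"
  define F where "F = ?\<Phi> / \<alpha>"
  define G where "G = ?\<Gamma> / \<alpha>"
  note p\<Phi> = dprod_props(1,2)[OF f I b, of k] and p\<Gamma> = dprod_props(1,2)[OF g I b, of k]
  have d1: "(\<Sum>i\<in>I. k i) \<ge> 1" using d by linarith
  have F: "F \<in> mero" "fls_deriv F \<noteq> 0"
    unfolding F_def using p\<Phi> \<alpha> dprod_divide_nonconst[OF f I b \<alpha> small(1) d1] by simp_all
  have G: "G \<in> mero" "fls_deriv G \<noteq> 0"
    unfolding G_def using p\<Gamma> \<alpha> dprod_divide_nonconst[OF g I b \<alpha> small(2) d1] by simp_all
  have FG0: "F \<noteq> 0" "G \<noteq> 0" using F G by auto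
  have "F \<noteq> 1" "G \<noteq> 1" using F(2) G(2) by auto
  then have ne: "?\<Phi> \<noteq> \<alpha>" "?\<Gamma> \<noteq> \<alpha>" using \<alpha>(2) by (auto simp: F_def G_def)
  \<comment> \<open>Integer-valued, so \<open>E \<gamma> < 1\<close> means that
    \<open>\<alpha>\<close> has neither zero nor pole at \<open>\<gamma>\<close>. It also bounds the
    change of \<open>tr2\<close> under division by \<open>\<alpha>\<close>.\<close>
  define E where "E = (\<lambda>\<gamma>. \<bar>dvs \<alpha> \<gamma>\<bar>)"
  have E: "locfin E" "\<And>\<gamma>. E \<gamma> \<ge> 0" unfolding E_def using cnt_abs_dvs_le(1)[OF \<alpha>] by simp_all
  obtain Ce where Ce: "\<And>r. r \<ge> 1 \<Longrightarrow> cnt r E \<le> 2 * nev r \<alpha> + Ce"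
    using cnt_abs_dvs_le(2)[OF \<alpha>] unfolding E_def by blast
  have sh: "zd (F - 1) \<gamma> = zd (G - 1) \<gamma>" if "E \<gamma> < 1" for \<gamma>
  proof -
    have "dvs \<alpha> \<gamma> = 0"
      using that dvs_ge_1[of \<alpha> \<gamma>] dvs_le_minus_1[of \<alpha> \<gamma>] unfolding E_def
      by (cases "dvs \<alpha> \<gamma> > 0"; cases "dvs \<alpha> \<gamma> < 0") auto
    then show ?thesis unfolding F_def G_def using share_CM_zd[OF share] p\<Phi> p\<Gamma> \<alpha> ne by blast
  qed
  have "F \<noteq> G" using neither \<alpha>(2) by (auto simp: F_def G_def)
  have "F * G \<noteq> 1" using neither \<alpha>(2) by (auto simp: F_def G_def field_simps power2_eq_square)
  then have "G * F \<noteq> 1" by (simp add: mult.commute)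
  obtain C1 where C1: "\<And>r. r \<ge> 1 \<Longrightarrow> nev r F \<le> cnt r (tr2 F) + cnt r (tr2 G) + 3 * cnt r E + C1"
    using nev_le_if_share_one[OF F G E sh] \<open>F \<noteq> G\<close> \<open>F * G \<noteq> 1\<close> by blast
  obtain C2 where C2: "\<And>r. r \<ge> 1 \<Longrightarrow> nev r G \<le> cnt r (tr2 G) + cnt r (tr2 F) + 3 * cnt r E + C2"
    using nev_le_if_share_one[OF G F E sh[symmetric]] \<open>F \<noteq> G\<close> \<open>G * F \<noteq> 1\<close> by blast
  have quot: "\<exists>C. \<forall>r\<ge>1. ?d * nev r h + cnt r (zd (fls_deriv h)) \<le> nev r (dprod I a k b h / \<alpha>) + nev r \<alpha> + C \<and>
      cnt r (tr2 (dprod I a k b h / \<alpha>)) \<le> (2 + 2 * ?q) * nev r h + cnt r (zd (fls_deriv h)) + cnt r E + C \<and>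
      cnt r (zd (fls_deriv h)) \<le> 2 * nev r h + C"
    if h: "h \<in> mero" "fls_deriv h \<noteq> 0" for h
  proof -
    let ?\<Psi> = "dprod I a k b h"
    note p = dprod_props(1,2)[OF h I b, of k]
    obtain C3 where C3: "\<And>r. r \<ge> 1 \<Longrightarrow> ?d * nev r h + cnt r (zd (fls_deriv h)) \<le> nev r ?\<Psi> + C3"
      using nev_dprod_ge[OF h I(1) b] by blast
    obtain C4 where C4: "\<And>r. r \<ge> 1 \<Longrightarrow> cnt r (tr2 ?\<Psi>) \<le> (2 + 2 * ?q) * nev r h + cnt r (zd (fls_deriv h)) + C4"
      using cnt_tr2_dprod_le[OF h I b] by blast
    obtain C5 where C5: "\<And>r. r \<ge> 1 \<Longrightarrow> cnt r (zd (fls_deriv h)) \<le> 2 * nev r h + C5"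
      using cnt_zd_deriv_le[OF h] by blast
    have tr: "tr2 (?\<Psi> / \<alpha>) \<gamma> \<le> tr2 ?\<Psi> \<gamma> + E \<gamma>" for \<gamma>
    proof -
      have "dvs (?\<Psi> / \<alpha>) \<gamma> = dvs ?\<Psi> \<gamma> - dvs \<alpha> \<gamma>" using p \<alpha> by (simp add: dvs_def)
      then show ?thesis unfolding tr2_def E_def by linarith
    qed
    let ?C = "\<bar>C3\<bar> + \<bar>C4\<bar> + \<bar>C5\<bar>"
    have "?d * nev r h + cnt r (zd (fls_deriv h)) \<le> nev r (?\<Psi> / \<alpha>) + nev r \<alpha> + ?C \<and>
      cnt r (tr2 (?\<Psi> / \<alpha>)) \<le> (2 + 2 * ?q) * nev r h + cnt r (zd (fls_deriv h)) + cnt r E + ?C \<and>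
      cnt r (zd (fls_deriv h)) \<le> 2 * nev r h + ?C" if r: "r \<ge> 1" for r
    proof (intro conjI)
      have "nev r (?\<Psi> / \<alpha> * \<alpha>) \<le> nev r (?\<Psi> / \<alpha>) + nev r \<alpha>"
        using p \<alpha> r by (intro nev_mult_le) simp_all
      then show "?d * nev r h + cnt r (zd (fls_deriv h)) \<le> nev r (?\<Psi> / \<alpha>) + nev r \<alpha> + ?C"
        using C3[OF r] \<alpha>(2) by simp
      have "cnt r (tr2 (?\<Psi> / \<alpha>)) \<le> cnt r (\<lambda>\<gamma>. tr2 ?\<Psi> \<gamma> + E \<gamma>)"
        using tr p \<alpha> E r by (intro cnt_mono) simp_all
      also have "\<dots> = cnt r (tr2 ?\<Psi>) + cnt r E" using p E by (simp add: cnt_add)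
      finally show "cnt r (tr2 (?\<Psi> / \<alpha>)) \<le> (2 + 2 * ?q) * nev r h + cnt r (zd (fls_deriv h)) + cnt r E + ?C"
        using C4[OF r] by linarith
      show "cnt r (zd (fls_deriv h)) \<le> 2 * nev r h + ?C" using C5[OF r] by linarith
    qed
    then show ?thesis by blast
  qed
  from quot[OF f] quot[OF g] obtain Cf Cg where Cf: "\<And>r. r \<ge> 1 \<Longrightarrow>
      ?d * nev r f + cnt r (zd (fls_deriv f)) \<le> nev r F + nev r \<alpha> + Cf \<and>
      cnt r (tr2 F) \<le> (2 + 2 * ?q) * nev r f + cnt r (zd (fls_deriv f)) + cnt r E + Cf \<and>
      cnt r (zd (fls_deriv f)) \<le> 2 * nev r f + Cf"
    and Cg: "\<And>r. r \<ge> 1 \<Longrightarrow>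
      ?d * nev r g + cnt r (zd (fls_deriv g)) \<le> nev r G + nev r \<alpha> + Cg \<and>
      cnt r (tr2 G) \<le> (2 + 2 * ?q) * nev r g + cnt r (zd (fls_deriv g)) + cnt r E + Cg \<and>
      cnt r (zd (fls_deriv g)) \<le> 2 * nev r g + Cg"
    unfolding F_def G_def by blast
  define C where "C = C1 + C2 + 4 * Cf + 4 * Cg + 10 * Ce"
  \<comment> \<open>\<open>E\<close> occurs 6 times from sharing and 4 times from the quotients by
    \<open>\<alpha>\<close>, each time at the cost of \<open>2 * nev r \<alpha>\<close>. The lower
    bounds for \<open>F\<close> and \<open>G\<close> add one \<open>nev r \<alpha>\<close>
    each.\<close>
  have "nev r f \<le> 22 * nev r \<alpha> + C" if r: "r \<ge> 1" for r
  proof -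
    have "real (4 * card I + 7) \<le> ?d" using d by (simp only: of_nat_le_iff)
    then have d': "4 * ?q + 7 \<le> ?d" by (simp del: of_nat_sum)
    have "(4 * ?q + 7) * nev r h \<le> ?d * nev r h" for h :: "'a fls"
      using nev_nonneg[OF r] d' by (intro mult_right_mono)
    from this[of f] this[of g]
    have "4 * (?q * nev r f) + 7 * nev r f \<le> ?d * nev r f" "4 * (?q * nev r g) + 7 * nev r g \<le> ?d * nev r g"
      by (simp_all add: algebra_simps)
    moreover have eq: "(2 + 2 * ?q) * nev r h = 2 * nev r h + 2 * (?q * nev r h)" for h :: "'a fls"
      by (simp add: algebra_simps)
    ultimately show ?thesis
      using C1[OF r] C2[OF r] Ce[OF r] conjunct1[OF Cf[OF r]] conjunct1[OF Cg[OF r]]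
        conjunct2[OF Cf[OF r]] conjunct2[OF Cg[OF r]] nev_nonneg[OF r, of g]
      unfolding C_def eq by linarith
  qed
  from nev_not_le_small[OF f \<alpha> small(1) this] show False .
qed

subsection \<open>The product case\<close>

text \<open>
  If \<open>f' P'(f) g' P'(g) = \<alpha>\<^sup>2\<close>, then, apart from the zeroes and poles of \<open>\<alpha>\<close>, the zeroes of
  \<open>f - a\<^sub>i\<close> are poles of \<open>g\<close>, and comparing orders they are of high multiplicity.
\<close>

lemma dprod_product_contradiction:
  fixes f g \<alpha> :: "'a::{complete_ultrametric_field, alg_closed_field, field_char_0} fls" and mm :: "'b \<Rightarrow> real"
  assumes f: "f \<in> mero" "fls_deriv f \<noteq> 0" and g: "g \<in> mero" "fls_deriv g \<noteq> 0"
    and I: "finite I" "inj_on a I" "I \<noteq> {}" and b: "b \<noteq> 0" and k: "\<And>i. i \<in> I \<Longrightarrow> k i > 0"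
    and \<alpha>: "\<alpha> \<in> mero" "\<alpha> \<noteq> 0" and small: "small_wrt \<alpha> f"
    and eq: "dprod I a k b f * dprod I a k b g = \<alpha> ^ 2"
    and mm_pos: "\<And>i. i \<in> I \<Longrightarrow> mm i > 0"
    and mm: "\<And>i m q :: nat. i \<in> I \<Longrightarrow> m > 0 \<Longrightarrow> q > 0 \<Longrightarrow>
      (k i + 1) * m = ((\<Sum>i\<in>I. k i) + 1) * q + 2 \<Longrightarrow> mm i \<le> real m"
    and sum: "2 * (\<Sum>i\<in>I. 1 / mm i) < real (card I) - 1"
  shows False
proof -
  let ?d = "real (\<Sum>i\<in>I. k i)" and ?q = "real (card I)"
  let ?S = "smt_divisor I a"
  \<comment> \<open>Weights such that a zero of \<open>h - a i\<close> of order at least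
    \<open>mm i\<close> counts at least 1, while by the first main theorem the total is at most the
    sum of all \<open>1 / mm i\<close> times the characteristic.\<close>
  define W where "W h \<gamma> = (\<Sum>i\<in>I. 1 / mm i * zd (h - fls_const (a i)) \<gamma>)" for h :: "'a fls" and \<gamma>
  define E where "E = (\<lambda>\<gamma>. \<bar>dvs \<alpha> \<gamma>\<bar>)"
  have E: "locfin E" "\<And>\<gamma>. E \<gamma> \<ge> 0" unfolding E_def using cnt_abs_dvs_le(1)[OF \<alpha>] by simp_all
  obtain Ce where Ce: "\<And>r. r \<ge> 1 \<Longrightarrow> cnt r E \<le> 2 * nev r \<alpha> + Ce"
    using cnt_abs_dvs_le(2)[OF \<alpha>] unfolding E_def by blast
  have W_nonneg: "W h \<gamma> \<ge> 0" for h \<gamma>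
    unfolding W_def using mm_pos by (intro sum_nonneg mult_nonneg_nonneg) (auto simp: less_imp_le)
  have W_ge1: "W h \<gamma> \<ge> 1" if "i \<in> I" "mm i \<le> zd (h - fls_const (a i)) \<gamma>" for h \<gamma> i
  proof -
    have "W h \<gamma> = 1 / mm i * zd (h - fls_const (a i)) \<gamma> +
        (\<Sum>i\<in>I-{i}. 1 / mm i * zd (h - fls_const (a i)) \<gamma>)"
      unfolding W_def using I(1) that(1) by (rule sum.remove)
    moreover have "(\<Sum>i\<in>I-{i}. 1 / mm i * zd (h - fls_const (a i)) \<gamma>) \<ge> 0"
      using mm_pos by (intro sum_nonneg mult_nonneg_nonneg) (auto simp: less_imp_le)
    moreover have "1 / mm i * zd (h - fls_const (a i)) \<gamma> \<ge> 1"
      using that mm_pos[OF that(1)] by (simp add: field_simps)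
    ultimately show ?thesis by linarith
  qed
  \<comment> \<open>A pole of \<open>u\<close> is a zero of the other product. If it is a zero of
    some \<open>w - a i\<close>, both divisors are 1 and \<open>W w \<gamma> \<ge> 1\<close>; this
    is the factor 2 in the hypothesis \<open>sum\<close>. Otherwise it is a zero of
    \<open>w'\<close>, which cancels the 1 from \<open>u\<close>.\<close>
  have pole: "?S u \<gamma> + ?S w \<gamma> \<le> 2 * W w \<gamma>"
    if u: "u \<in> mero" "fls_deriv u \<noteq> 0" and w: "w \<in> mero" "fls_deriv w \<noteq> 0"
      and 0: "dvs (dprod I a k b u) \<gamma> + dvs (dprod I a k b w) \<gamma> = 0" and p: "dvs u \<gamma> < 0"
    for u w :: "'a fls" and \<gamma>
  proof -
    note pu = dprod_props(3-5)[OF u I(1,2) b, where k = k and \<gamma> = \<gamma>]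
    note pw = dprod_props(3-5)[OF w I(1,2) b, where k = k and \<gamma> = \<gamma>]
    note Sw = smt_divisor_eq[OF w I(1,2), where \<gamma> = \<gamma>]
    have Su: "?S u \<gamma> = 1" by (rule smt_divisor_eq(1)[OF u I(1,2) p])
    have dw: "dvs (dprod I a k b w) \<gamma> = (?d + 1) * - dvs u \<gamma> + 1"
      using 0 pu(1)[OF p] by (simp add: algebra_simps)
    have "(?d + 1) * - dvs u \<gamma> \<ge> 0" using p by (intro mult_nonneg_nonneg) (simp_all del: of_nat_sum)
    then have dw_ge: "dvs (dprod I a k b w) \<gamma> \<ge> 1" using dw by linarith
    have w_nonneg: "dvs w \<gamma> \<ge> 0"
    proof (rule ccontr)
      assume "\<not> dvs w \<gamma> \<ge> 0"
      then have neg: "dvs w \<gamma> < 0" by simp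
      then have "(?d + 1) * dvs w \<gamma> \<le> 0" by (intro mult_nonneg_nonpos) (simp_all del: of_nat_sum)
      then show False using pw(1)[OF neg] dw_ge by linarith
    qed
    show ?thesis
    proof (cases "\<exists>i\<in>I. dvs (w - fls_const (a i)) \<gamma> > 0")
      case True
      then obtain i where i: "i \<in> I" "dvs (w - fls_const (a i)) \<gamma> > 0" by blast
      define m where "m = nat (mero_order \<gamma> (w - fls_const (a i)))"
      define q where "q = nat (- mero_order \<gamma> u)"
      have m: "dvs (w - fls_const (a i)) \<gamma> = real m" "m > 0" using i(2) by (simp_all add: m_def dvs_def)
      have q: "- dvs u \<gamma> = real q" "q > 0" using p by (simp_all add: q_def dvs_def)
      \<comment> \<open>A zero of order \<open>m\<close> against a pole of order \<open>q\<close>.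
        Differentiation lowers the first order by one and raises the second by one, hence the 2 in
        the hypothesis \<open>mm\<close>.\<close>
      have "(real (k i) + 1) * real m - 1 = (?d + 1) * real q + 1"
        using pw(2)[OF i] dw unfolding m(1) q(1) by simp
      then have "real ((k i + 1) * m) = real (((\<Sum>i\<in>I. k i) + 1) * q + 2)"
        by (simp add: algebra_simps)
      then have "(k i + 1) * m = ((\<Sum>i\<in>I. k i) + 1) * q + 2" by (simp only: of_nat_eq_iff)
      from mm[OF i(1) m(2) q(2) this] have "mm i \<le> zd (w - fls_const (a i)) \<gamma>"
        using m(1) by (simp add: zd_def)
      then have "W w \<gamma> \<ge> 1" by (rule W_ge1[OF i(1)])
      then show ?thesis using Su Sw(2)[OF i] by linarith
    next
      case False
      then have no: "\<And>i. i \<in> I \<Longrightarrow> dvs (w - fls_const (a i)) \<gamma> \<le> 0" by force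
      have "dvs (dprod I a k b w) \<gamma> = dvs (fls_deriv w) \<gamma>" by (rule pw(3)[OF w_nonneg no])
      moreover have "?S w \<gamma> = - dvs (fls_deriv w) \<gamma>" by (rule Sw(3)[OF w_nonneg no])
      ultimately show ?thesis using Su dw_ge W_nonneg[of w \<gamma>] by linarith
    qed
  qed
  \<comment> \<open>If neither function has a pole, both products have order at least 0 with sum 0,
    hence order 0, and then neither divisor is positive.\<close>
  have nopole: "?S u \<gamma> \<le> 0 \<or> dvs (dprod I a k b u) \<gamma> > 0" "dvs (dprod I a k b u) \<gamma> \<ge> 0"
    if u: "u \<in> mero" "fls_deriv u \<noteq> 0" and np: "dvs u \<gamma> \<ge> 0" for u :: "'a fls" and \<gamma>
  proof -
    note pu = dprod_props(3-5)[OF u I(1,2) b, where k = k and \<gamma> = \<gamma>]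
    note Su = smt_divisor_eq[OF u I(1,2), where \<gamma> = \<gamma>]
    have "(?S u \<gamma> \<le> 0 \<or> dvs (dprod I a k b u) \<gamma> > 0) \<and> dvs (dprod I a k b u) \<gamma> \<ge> 0"
    proof (cases "\<exists>i\<in>I. dvs (u - fls_const (a i)) \<gamma> > 0")
      case True
      then obtain i where i: "i \<in> I" "dvs (u - fls_const (a i)) \<gamma> > 0" by blast
      have "2 * 1 \<le> (real (k i) + 1) * dvs (u - fls_const (a i)) \<gamma>"
        using k[OF i(1)] dvs_ge_1[OF i(2)] by (intro mult_mono) simp_all
      then show ?thesis using pu(2)[OF i] by linarith
    next
      case False
      then have no: "\<And>i. i \<in> I \<Longrightarrow> dvs (u - fls_const (a i)) \<gamma> \<le> 0" by force
      then show ?thesis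
        using pu(3)[OF np no] Su(3)[OF np no] dvs_deriv_cases(2)[OF u np] by linarith
    qed
    then show "?S u \<gamma> \<le> 0 \<or> dvs (dprod I a k b u) \<gamma> > 0" "dvs (dprod I a k b u) \<gamma> \<ge> 0" by auto
  qed
  have pt: "?S f \<gamma> + ?S g \<gamma> \<le> 2 * W f \<gamma> + 2 * W g \<gamma> + 2 * E \<gamma>" for \<gamma>
  proof (cases "dvs \<alpha> \<gamma> = 0")
    case False
    then have "E \<gamma> \<ge> 1"
      unfolding E_def using dvs_ge_1[of \<alpha> \<gamma>] dvs_le_minus_1[of \<alpha> \<gamma>] by linarith
    then show ?thesis using smt_divisor_le_1[OF f I(1,2), of \<gamma>] smt_divisor_le_1[OF g I(1,2), of \<gamma>] W_nonneg[of f \<gamma>] W_nonneg[of g \<gamma>] by linarith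
  next
    case True
    have "dvs (dprod I a k b f) \<gamma> + dvs (dprod I a k b g) \<gamma> = dvs (\<alpha> ^ 2) \<gamma>"
      unfolding eq[symmetric] using dprod_props(1,2)[OF f I(1,2) b] dprod_props(1,2)[OF g I(1,2) b]
      by (intro dvs_mult[symmetric])
    also have "\<dots> = 0" using \<alpha> True by (simp add: dvs_power)
    finally have 0: "dvs (dprod I a k b f) \<gamma> + dvs (dprod I a k b g) \<gamma> = 0" .
    consider "dvs f \<gamma> < 0" | "dvs g \<gamma> < 0" | "dvs f \<gamma> \<ge> 0" "dvs g \<gamma> \<ge> 0" by linarith
    then show ?thesis
    proof cases
      case 1
      then show ?thesis using pole[OF f g 0] W_nonneg[of f \<gamma>] E(2)[of \<gamma>] by linarith
    next
      case 2
      have "dvs (dprod I a k b g) \<gamma> + dvs (dprod I a k b f) \<gamma> = 0" using 0 by simp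
      from pole[OF g f this 2] show ?thesis using W_nonneg[of g \<gamma>] E(2)[of \<gamma>] by linarith
    next
      case 3
      then show ?thesis
        using nopole[OF f 3(1)] nopole[OF g 3(2)] 0 W_nonneg[of f \<gamma>] W_nonneg[of g \<gamma>] E(2)[of \<gamma>]
        by linarith
    qed
  qed
  have cntW: "locfin (W h) \<and> (\<exists>C. \<forall>r\<ge>1. cnt r (W h) \<le> (\<Sum>i\<in>I. 1 / mm i) * nev r h + C)"
    if h: "h \<in> mero" "fls_deriv h \<noteq> 0" for h :: "'a fls"
  proof -
    note * = mero_order_diff_const[OF h]
    have "\<exists>C. \<forall>i. \<forall>r\<ge>1. cnt r (zd (h - fls_const (a i))) \<le> nev r h + C i"
      using cnt_zd_diff_const_le[OF h] by (intro choice) blast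
    then obtain C where C: "\<And>i r. r \<ge> 1 \<Longrightarrow> cnt r (zd (h - fls_const (a i))) \<le> nev r h + C i" by blast
    have lf: "locfin (W h)"
      unfolding W_def[abs_def] using *(2,3) by (intro locfin_sum locfin_cmult locfin_zd)
    have "cnt r (W h) \<le> (\<Sum>i\<in>I. 1 / mm i) * nev r h + (\<Sum>i\<in>I. 1 / mm i * C i)" if r: "r \<ge> 1" for r
    proof -
      have "cnt r (W h) = (\<Sum>i\<in>I. 1 / mm i * cnt r (zd (h - fls_const (a i))))"
        unfolding W_def[abs_def] cnt_cmult[symmetric]
        by (intro cnt_sum locfin_cmult locfin_zd *)
      also have "\<dots> \<le> (\<Sum>i\<in>I. 1 / mm i * (nev r h + C i))"
        using C[OF r] mm_pos by (intro sum_mono mult_left_mono) (auto simp: less_imp_le)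
      also have "\<dots> = (\<Sum>i\<in>I. 1 / mm i) * nev r h + (\<Sum>i\<in>I. 1 / mm i * C i)"
        by (simp add: distrib_left sum.distrib sum_distrib_right)
      finally show ?thesis .
    qed
    then show ?thesis using lf by blast
  qed
  obtain Cf where Cf: "\<And>r. r \<ge> 1 \<Longrightarrow> cnt r (W f) \<le> (\<Sum>i\<in>I. 1 / mm i) * nev r f + Cf"
    using cntW[OF f] by blast
  obtain Cg where Cg: "\<And>r. r \<ge> 1 \<Longrightarrow> cnt r (W g) \<le> (\<Sum>i\<in>I. 1 / mm i) * nev r g + Cg"
    using cntW[OF g] by blast
  obtain Df where Df: "\<And>r. r \<ge> 1 \<Longrightarrow> (?q - 1) * nev r f \<le> cnt r (?S f) - ln r + Df"
    using second_main_theorem[OF f I(1,3,2)] by blast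
  obtain Dg where Dg: "\<And>r. r \<ge> 1 \<Longrightarrow> (?q - 1) * nev r g \<le> cnt r (?S g) - ln r + Dg"
    using second_main_theorem[OF g I(1,3,2)] by blast
  define s where "s = 2 * (\<Sum>i\<in>I. 1 / mm i)"
  \<comment> \<open>The gap left by the hypothesis \<open>sum\<close>: the multiple of
    \<open>nev r f\<close> that survives.\<close>
  define \<delta> where "\<delta> = ?q - 1 - s"
  have \<delta>: "\<delta> > 0" using sum by (simp add: \<delta>_def s_def)
  define C where "C = 2 * Cf + 2 * Cg + Df + Dg + 2 * Ce"
  have "nev r f \<le> 4 / \<delta> * nev r \<alpha> + C / \<delta>" if r: "r \<ge> 1" for r
  proof -
    have "cnt r (?S f) + cnt r (?S g) = cnt r (\<lambda>\<gamma>. ?S f \<gamma> + ?S g \<gamma>)"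
      using f g by (simp add: cnt_add)
    also have "\<dots> \<le> cnt r (\<lambda>\<gamma>. 2 * W f \<gamma> + 2 * W g \<gamma> + 2 * E \<gamma>)"
      using pt f g cntW[OF f] cntW[OF g] E(1) r by (intro cnt_mono) simp_all
    also have "\<dots> = 2 * cnt r (W f) + 2 * cnt r (W g) + 2 * cnt r E"
      using cntW[OF f] cntW[OF g] E(1) by (simp add: cnt_add cnt_cmult)
    finally have 1: "cnt r (?S f) + cnt r (?S g) \<le> 2 * cnt r (W f) + 2 * cnt r (W g) + 2 * cnt r E" .
    have 2: "2 * cnt r (W f) \<le> s * nev r f + 2 * Cf" "2 * cnt r (W g) \<le> s * nev r g + 2 * Cg"
      using Cf[OF r] Cg[OF r] by (simp_all add: s_def)
    have 3: "(?q - 1) * nev r h = \<delta> * nev r h + s * nev r h" for h :: "'a fls"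
      by (simp add: \<delta>_def algebra_simps)
    have 4: "\<delta> * nev r g \<ge> 0" using \<delta> nev_nonneg[OF r, of g] by simp
    have "ln r \<ge> 0" using r by simp
    then have "\<delta> * nev r f \<le> 4 * nev r \<alpha> + C"
      using 1 2 4 Ce[OF r] Df[OF r] Dg[OF r] unfolding 3 C_def by linarith
    then show ?thesis using \<delta> by (simp add: field_simps)
  qed
  from nev_not_le_small[OF f \<alpha> small this] show False .
qed

subsection \<open>The integrated equation\<close>

text \<open>
  If \<open>c \<noteq> 0\<close>, then the second main theorem for \<open>P(f)\<close> and the values \<open>P(a)\<close>, \<open>P(a) + c\<close> gives
  \<open>(n + k + 1) T(f) \<le> (2 k + 3) T(f) - ln r + O(1)\<close>. In the boundary case \<open>n = k + 2\<close> only the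
  term \<open>- ln r\<close> yields the contradiction.
\<close>

lemma poly_comp_eq_plus_const:
  fixes f g :: "'a::{complete_ultrametric_field, alg_closed_field, field_char_0} fls"
  assumes f: "f \<in> mero" "fls_deriv f \<noteq> 0" and g: "g \<in> mero" "fls_deriv g \<noteq> 0"
    and eq: "poly_comp P f = fls_const c + poly_comp P g"
    and R: "P - [:e:] = [:- a, 1:] ^ Suc n * R" "R \<noteq> 0" "n \<ge> degree R + 2"
  shows "c = 0"
proof (rule ccontr)
  assume c: "c \<noteq> 0"
  let ?H = "poly_comp P f" and ?k = "real (degree R)"
  have deg: "degree P = n + 1 + degree R"
  proof -
    have "degree (P - [:e:]) = n + 1 + degree R"
      unfolding R(1) using R(2) by (subst degree_mult_eq) (auto simp: degree_power_eq simp del: power_Suc)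
    then have "degree (P - [:e:] + [:e:]) = n + 1 + degree R"
      by (subst degree_add_eq_left) auto
    then show ?thesis by simp
  qed
  have dP: "pderiv P \<noteq> 0"
    using deg by (simp add: pderiv_eq_0_iff)
  have P0: "P \<noteq> 0" using deg by auto
  have H: "?H \<in> mero" "fls_deriv ?H \<noteq> 0"
    using f poly_comp_props(1)[OF f dP] by (simp_all add: deriv_poly_comp)
  have H0: "?H \<noteq> 0" using H by auto
  note * = mero_order_diff_const[OF H]
  have fac: "poly_comp P h - fls_const e = (h - fls_const a) ^ Suc n * poly_comp R h" for h :: "'a fls"
    using arg_cong[OF R(1), of "\<lambda>p. poly_comp p h"]
    unfolding poly_comp_diff_const poly_comp_mult poly_comp_power poly_comp_linear .
  \<comment> \<open>The root of multiplicity \<open>Suc n\<close> counts only once; this is the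
    whole gain over the trivial bound by \<open>degree P\<close>.\<close>
  have min_le: "min 1 (zd (poly_comp P h - fls_const e) \<gamma>) \<le> zd (h - fls_const a) \<gamma> + zd (poly_comp R h) \<gamma>"
    if h: "h \<in> mero" "fls_deriv h \<noteq> 0" for h :: "'a fls" and \<gamma>
  proof -
    note ** = mero_order_diff_const[OF h]
    have "dvs (poly_comp P h - fls_const e) \<gamma> = real (Suc n) * dvs (h - fls_const a) \<gamma> + dvs (poly_comp R h) \<gamma>"
      unfolding fac using h **(2,3)[of a] poly_comp_props(1)[OF h R(2)]
      by (subst dvs_mult) (simp_all add: dvs_power del: power_Suc of_nat_Suc)
    then have "dvs (poly_comp P h - fls_const e) \<gamma> \<le> 0"
      if "dvs (h - fls_const a) \<gamma> \<le> 0" "dvs (poly_comp R h) \<gamma> \<le> 0"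
      using that mult_nonneg_nonpos[of "real (Suc n)" "dvs (h - fls_const a) \<gamma>"] by simp
    then show ?thesis
      using dvs_ge_1[of "h - fls_const a" \<gamma>] dvs_ge_1[of "poly_comp R h" \<gamma>]
      by (cases "dvs (h - fls_const a) \<gamma> \<le> 0"; cases "dvs (poly_comp R h) \<gamma> \<le> 0") (auto simp: zd_def)
  qed
  have Hg: "?H - fls_const (e + c) = poly_comp P g - fls_const e"
    unfolding eq by (simp flip: fls_plus_const)
  have pt: "smt_divisor {e, e + c} (\<lambda>x. x) ?H \<gamma> \<le> pd f \<gamma> + (zd (f - fls_const a) \<gamma> + zd (poly_comp R f) \<gamma>) +
      (zd (g - fls_const a) \<gamma> + zd (poly_comp R g) \<gamma>)" for \<gamma>
  proof -
    have "smt_divisor {e, e + c} (\<lambda>x. x) ?H \<gamma> \<le> min 1 (pd ?H \<gamma>) +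
        (min 1 (zd (?H - fls_const e) \<gamma>) + min 1 (zd (?H - fls_const (e + c)) \<gamma>))"
      using smt_divisor_le[OF H, of "{e, e + c}" "\<lambda>x. x" \<gamma>] c by simp
    moreover have "min 1 (pd ?H \<gamma>) \<le> pd f \<gamma>"
      using pd_poly_comp[OF f P0, of \<gamma>] dvs_le_minus_1[of f \<gamma>]
      by (cases "dvs f \<gamma> < 0") (simp_all add: pd_def)
    ultimately show ?thesis using min_le[OF f, of \<gamma>] min_le[OF g, of \<gamma>] unfolding Hg by linarith
  qed
  obtain C0 where C0: "\<And>r. r \<ge> 1 \<Longrightarrow> (real (card {e, e + c}) - 1) * nev r ?H \<le>
      cnt r (smt_divisor {e, e + c} (\<lambda>x. x) ?H) - ln r + C0"
    using second_main_theorem[OF H, of "{e, e + c}" "\<lambda>x. x"] by auto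
  obtain C1 where C1: "\<And>r. r \<ge> 1 \<Longrightarrow> \<bar>nev r ?H - real (degree P) * nev r f\<bar> \<le> C1"
    using nev_poly_comp[OF f P0] by blast
  \<comment> \<open>\<open>P - c\<close> and \<open>P\<close> have equal degree, and
    \<open>(P - c)(f) = P(g)\<close>; hence \<open>f\<close> and \<open>g\<close> have the same
    characteristic up to a constant.\<close>
  have P': "P - [:c:] \<noteq> 0" "degree (P - [:c:]) = degree P"
  proof -
    show "degree (P - [:c:]) = degree P"
      unfolding diff_conv_add_uminus using deg by (intro degree_add_eq_left) simp
    then show "P - [:c:] \<noteq> 0" using deg by auto
  qed
  have "poly_comp (P - [:c:]) f = poly_comp P g" unfolding poly_comp_diff_const eq by simp
  then obtain C2 where C2: "\<And>r. r \<ge> 1 \<Longrightarrow> \<bar>nev r (poly_comp P g) - real (degree P) * nev r f\<bar> \<le> C2"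
    using nev_poly_comp[OF f P'(1)] P'(2) by metis
  obtain C3 where C3: "\<And>r. r \<ge> 1 \<Longrightarrow> \<bar>nev r (poly_comp P g) - real (degree P) * nev r g\<bar> \<le> C3"
    using nev_poly_comp[OF g P0] by blast
  have bound: "\<exists>C. \<forall>r\<ge>1. cnt r (\<lambda>\<gamma>. zd (h - fls_const a) \<gamma> + zd (poly_comp R h) \<gamma>) \<le> (1 + ?k) * nev r h + C"
    if h: "h \<in> mero" "fls_deriv h \<noteq> 0" for h :: "'a fls"
  proof -
    note ** = mero_order_diff_const[OF h]
    obtain D1 where D1: "\<And>r. r \<ge> 1 \<Longrightarrow> cnt r (zd (h - fls_const a)) \<le> nev r h + D1"
      using cnt_zd_diff_const_le[OF h] by blast
    obtain D2 where D2: "\<And>r. r \<ge> 1 \<Longrightarrow> cnt r (zd (poly_comp R h)) \<le> nev r (poly_comp R h) + D2"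
      using cnt_zd_le_nev[of "poly_comp R h"] h poly_comp_props(1)[OF h R(2)] by auto
    obtain D3 where D3: "\<And>r. r \<ge> 1 \<Longrightarrow> \<bar>nev r (poly_comp R h) - ?k * nev r h\<bar> \<le> D3"
      using nev_poly_comp[OF h R(2)] by blast
    have "cnt r (\<lambda>\<gamma>. zd (h - fls_const a) \<gamma> + zd (poly_comp R h) \<gamma>) \<le> (1 + ?k) * nev r h + (D1 + D2 + D3)"
      if r: "r \<ge> 1" for r
    proof -
      have "cnt r (\<lambda>\<gamma>. zd (h - fls_const a) \<gamma> + zd (poly_comp R h) \<gamma>) =
          cnt r (zd (h - fls_const a)) + cnt r (zd (poly_comp R h))"
        using h **(2,3)[of a] poly_comp_props(1)[OF h R(2)] by (intro cnt_add locfin_zd) simp_all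
      then show ?thesis using D1[OF r] D2[OF r] D3[OF r] unfolding distrib_right by linarith
    qed
    then show ?thesis by blast
  qed
  obtain C4 where C4: "\<And>r. r \<ge> 1 \<Longrightarrow>
      cnt r (\<lambda>\<gamma>. zd (f - fls_const a) \<gamma> + zd (poly_comp R f) \<gamma>) \<le> (1 + ?k) * nev r f + C4"
    using bound[OF f] by blast
  obtain C5 where C5: "\<And>r. r \<ge> 1 \<Longrightarrow>
      cnt r (\<lambda>\<gamma>. zd (g - fls_const a) \<gamma> + zd (poly_comp R g) \<gamma>) \<le> (1 + ?k) * nev r g + C5"
    using bound[OF g] by blast
  define C where "C = C0 + C1 + (C2 + C3) + C4 + C5"
  have ln_le: "ln r \<le> C" if r: "r \<ge> 1" for r
  proof -
    define x where "x = nev r f"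
    define y where "y = nev r g"
    have xy: "x \<ge> 0" "y \<ge> 0" using nev_nonneg[OF r] by (simp_all add: x_def y_def)
    note lf = locfin_zd[OF mero_order_diff_const(3,2)[OF f]] locfin_zd[OF mero_order_diff_const(3,2)[OF g]]
      locfin_zd[OF poly_comp_mero poly_comp_props(1)[OF f R(2)]]
      locfin_zd[OF poly_comp_mero poly_comp_props(1)[OF g R(2)]] locfin_pd[OF f(1) mero_order_diff_const(1)[OF f]]
    have "cnt r (smt_divisor {e, e + c} (\<lambda>x. x) ?H) \<le>
        cnt r (\<lambda>\<gamma>. pd f \<gamma> + (zd (f - fls_const a) \<gamma> + zd (poly_comp R f) \<gamma>) +
          (zd (g - fls_const a) \<gamma> + zd (poly_comp R g) \<gamma>))"
      using pt H f g lf r by (intro cnt_mono locfin_add locfin_smt_divisor) simp_all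
    also have "\<dots> = cnt r (pd f) + cnt r (\<lambda>\<gamma>. zd (f - fls_const a) \<gamma> + zd (poly_comp R f) \<gamma>) +
        cnt r (\<lambda>\<gamma>. zd (g - fls_const a) \<gamma> + zd (poly_comp R g) \<gamma>)"
      using f g lf by (simp add: cnt_add locfin_add)
    finally have 1: "cnt r (smt_divisor {e, e + c} (\<lambda>x. x) ?H) \<le> x + ((1 + ?k) * x + C4) + ((1 + ?k) * y + C5)"
      using cnt_pd_le_nev[of r f] C4[OF r] C5[OF r] by (simp add: x_def y_def)
    have 2: "nev r ?H \<le> cnt r (smt_divisor {e, e + c} (\<lambda>x. x) ?H) - ln r + C0" using C0[OF r] c by simp
    have 3: "real (degree P) * x \<le> nev r ?H + C1" using C1[OF r] by (simp add: x_def abs_le_iff)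
    have 4: "real (degree P) * y \<le> real (degree P) * x + (C2 + C3)"
      using C2[OF r] C3[OF r] by (simp add: x_def y_def abs_le_iff)
    have degk: "real (degree P) \<ge> 2 * ?k + 3" using R(3) deg by simp
    \<comment> \<open>The characteristics are comparable after multiplication by
      \<open>degree P\<close>. As \<open>1 + ?k\<close> is smaller than the degree, the same error
      bound still serves if \<open>y > x\<close>.\<close>
    have "(1 + ?k) * y \<le> (1 + ?k) * x + (C2 + C3)"
    proof (cases "y \<le> x")
      case True
      have "0 \<le> C2 + C3" using C2[OF r] C3[OF r] abs_ge_zero order_trans by (meson add_nonneg_nonneg)
      moreover have "(1 + ?k) * y \<le> (1 + ?k) * x" using True by (intro mult_left_mono) simp_all
      ultimately show ?thesis by linarith
    next
      case False
      then have "(1 + ?k) * (y - x) \<le> real (degree P) * (y - x)" using degk by (intro mult_right_mono) simp_all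
      then show ?thesis using 4 by (simp add: right_diff_distrib)
    qed
    moreover have "(2 * ?k + 3) * x \<le> real (degree P) * x" using degk xy by (intro mult_right_mono)
    moreover have "x + ((1 + ?k) * x + C4) + ((1 + ?k) * x + (C2 + C3) + C5) = (2 * ?k + 3) * x + C4 + (C2 + C3) + C5"
      by (simp add: algebra_simps)
    ultimately show ?thesis using 1 2 3 unfolding C_def by linarith
  qed
  have "ln (exp (\<bar>C\<bar> + 1)) \<le> C" by (rule ln_le) simp
  then show False by simp
qed

text \<open>Finitely many pairs \<open>(m, q)\<close> are compatible with the sizes. For
  \<open>kk = n\<close> the pair \<open>(3, 2)\<close> forces \<open>n = 2 * k + 1\<close>. For
  \<open>kk \<le> k\<close> the pair \<open>(3, 1)\<close> forces \<open>n + k = 3 * kk\<close>,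
  which is \<open>n = 2 * k\<close> if \<open>kk = k\<close>. Finally \<open>(4, 1)\<close> with
  \<open>kk = k\<close> forces \<open>n = 3 * k + 1\<close>. These are the excluded
  equalities.\<close>

lemma multiplicity_bounds:
  fixes k n m q kk :: nat
  assumes q: "q > 0" and m: "m > 0" and n: "n \<ge> k + 2" and k: "k \<ge> 1"
    and eq: "(kk + 1) * m = (n + k + 1) * q + 2"
  shows "kk = n \<Longrightarrow> 3 \<le> m" and "kk = n \<Longrightarrow> n \<noteq> 2 * k + 1 \<Longrightarrow> 4 \<le> m"
    and "kk \<le> k \<Longrightarrow> 3 \<le> m" and "kk \<le> k \<Longrightarrow> n + k \<noteq> 3 * kk \<Longrightarrow> 4 \<le> m"
    and "kk = k \<Longrightarrow> n \<noteq> 2 * k \<Longrightarrow> n \<noteq> 3 * k + 1 \<Longrightarrow> 5 \<le> m"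
proof -
  have q_cases: "q = 1 \<or> q = 2 \<or> q \<ge> 3" using q by linarith
  have q2: "(n + k + 1) * 2 \<le> (n + k + 1) * q" if "q \<ge> 2" using that by (rule mult_le_mono2)
  have q3: "(n + k + 1) * 3 \<le> (n + k + 1) * q" if "q \<ge> 3" using that by (rule mult_le_mono2)
  have m_cases: "m = 1 \<or> m = 2 \<or> m = 3 \<or> m = 4 \<or> m \<ge> 5" using m by linarith
  show "3 \<le> m" if "kk = n" using m_cases q_cases q2 q3 eq n k that by auto
  show "4 \<le> m" if "kk = n" "n \<noteq> 2 * k + 1" using m_cases q_cases q2 q3 eq n k that by auto
  show "3 \<le> m" if "kk \<le> k" using m_cases q_cases q2 q3 eq n k that by auto
  show "4 \<le> m" if "kk \<le> k" "n + k \<noteq> 3 * kk" using m_cases q_cases q2 q3 eq n k that by auto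
  show "5 \<le> m" if "kk = k" "n \<noteq> 2 * k" "n \<noteq> 3 * k + 1" using m_cases q_cases q2 q3 eq n k that by auto
qed

text \<open>In characteristic zero, passing to the primitive that vanishes at \<open>a\<close>
  raises the multiplicity of \<open>a\<close> by exactly one. The cofactor has degree
  \<open>k\<close> when applied to \<open>a 1\<close>.\<close>

lemma pderiv_multiplicity_factor:
  fixes P :: "'a::field_char_0 poly"
  assumes "[:- a, 1:] ^ n dvd pderiv P" "pderiv P \<noteq> 0"
  shows "\<exists>R. P - [:poly P a:] = [:- a, 1:] ^ Suc n * R \<and> R \<noteq> 0 \<and> n + degree R = degree (pderiv P)"
proof -
  let ?P = "P - [:poly P a:]"
  have d: "pderiv ?P = pderiv P" by (simp add: pderiv_diff pderiv_pCons)
  have nz: "?P \<noteq> 0" using assms(2) d by auto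
  have "poly ?P a = 0" by simp
  from order_pderiv[OF nz this] have "order a ?P = Suc (order a (pderiv P))"
    unfolding d .
  moreover have "n \<le> order a (pderiv P)" using assms by (simp add: order_divides)
  ultimately have "[:- a, 1:] ^ Suc n dvd ?P" using order_divides[of a "Suc n" ?P] by simp
  then obtain R where R: "?P = [:- a, 1:] ^ Suc n * R" by (elim dvdE)
  have "R \<noteq> 0" using R nz by auto
  have "degree ?P = Suc n + degree R"
    unfolding R using \<open>R \<noteq> 0\<close> by (subst degree_mult_eq) (auto simp: degree_power_eq simp del: power_Suc)
  then have "n + degree R = degree (pderiv P)" using degree_pderiv[of ?P] unfolding d by simp
  then show ?thesis using R \<open>R \<noteq> 0\<close> by blast
qed

theorem theorem1:
  fixes P :: "'a::{complete_ultrametric_field, alg_closed_field, field_char_0} poly"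
    and a :: "nat \<Rightarrow> 'a" and b :: 'a
    and l n k :: nat and ks :: "nat \<Rightarrow> nat"
    and f g \<alpha> :: "'a fls"
  assumes uniq: "uniqueness_poly P nonconstant_mero"
    and dP: "pderiv P = smult b ([:- a 1, 1:] ^ n * (\<Prod>i=2..l. [:- a i, 1:] ^ ks i))"
    and b: "b \<noteq> 0"
    and l: "l \<ge> 2"
    and a_distinct: "inj_on a {1..l}"
    and n_pos: "n > 0"
    and ks_pos: "\<And>i. i \<in> {2..l} \<Longrightarrow> ks i > 0"
    and ks_decreasing: "\<And>i. 2 \<le> i \<Longrightarrow> i \<le> l - 1 \<Longrightarrow> ks i \<ge> ks (i + 1)"
    and k: "k = (\<Sum>i=2..l. ks i)"
    and i: "int n \<ge> 10 + (\<Sum>i=3..l. max 0 (4 - int (ks i))) + max 0 (5 - int (ks 2))"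
    and ii: "n \<ge> k + 2"
    and iii: "l = 2 \<Longrightarrow> n \<noteq> 2 * k \<and> n \<noteq> 2 * k + 1 \<and> n \<noteq> 3 * k + 1"
    and iv: "l = 3 \<Longrightarrow> n \<noteq> 2 * k + 1 \<and> (\<forall>i\<in>{2,3}. int n \<noteq> 3 * int (ks i) - int k)"
    and f: "transcendental_mero f"
    and g: "transcendental_mero g"
    and \<alpha>: "\<alpha> \<in> mero" "\<alpha> \<noteq> 0"
    and small_f: "small_wrt \<alpha> f"
    and small_g: "small_wrt \<alpha> g"
    and share: "share_CM (fls_deriv f * poly_comp (pderiv P) f)
                         (fls_deriv g * poly_comp (pderiv P) g) \<alpha>"
  shows "f = g"
proof -
  note f' = transcendental_meroD[OF f] and g' = transcendental_meroD[OF g]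
  define I where "I = {1..l}"
  define kk where "kk i = (if i = 1 then n else ks i)" for i
  have I_eq: "I = insert 1 {2..l}" using l by (auto simp: I_def)
  have I: "finite I" "inj_on a I" "I \<noteq> {}" "card I = l" using a_distinct l by (auto simp: I_def)
  have kk_pos: "kk i > 0" if "i \<in> I" for i
    using that n_pos ks_pos by (auto simp: I_def kk_def)
  have kk2: "kk i = ks i" if "i \<in> {2..l}" for i using that by (simp add: kk_def)
  have sum_kk: "(\<Sum>i\<in>I. kk i) = n + k"
    unfolding I_eq k using kk2 by (subst sum.insert) (auto simp: kk_def)
  have "(\<Prod>i\<in>I. [:- a i, 1:] ^ kk i) = [:- a 1, 1:] ^ n * (\<Prod>i=2..l. [:- a i, 1:] ^ ks i)"
    unfolding I_eq using kk2 by (subst prod.insert) (auto simp: kk_def)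
  then have dP': "pderiv P = smult b (\<Prod>i\<in>I. [:- a i, 1:] ^ kk i)" using dP by simp
  have dprod: "fls_deriv h * poly_comp (pderiv P) h = dprod I a kk b h" for h
    unfolding dP' dprod_eq_poly_comp ..
  have ks_le: "ks i \<le> k" if "i \<in> {2..l}" for i
    unfolding k using that by (intro member_le_sum) simp_all
  have "ks 2 > 0" using l by (intro ks_pos) simp
  then have k1: "k \<ge> 1" using ks_le[of 2] l by simp
  \<comment> \<open>In (i) each maximum tops up \<open>ks i\<close> to at least 4, and
    \<open>ks 2\<close> to at least 5. Hence \<open>n + k\<close> is at least
    \<open>10 + 5 + 4 * (l - 2)\<close>.\<close>
  have "4 * l + 7 \<le> n + k"
  proof -
    have "{2..l} = insert 2 {3..l}" using l by auto
    then have "int k = int (ks 2) + (\<Sum>i=3..l. int (ks i))" by (simp add: k)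
    moreover have "(\<Sum>i=3..l. 4) \<le> (\<Sum>i=3..l. max 0 (4 - int (ks i)) + int (ks i))"
      by (intro sum_mono) simp
    moreover have "(\<Sum>i=3..l. 4 :: int) = 4 * (int l - 2)" using l by simp
    ultimately show ?thesis using i by (simp add: sum.distrib)
  qed
  then have d: "4 * card I + 7 \<le> (\<Sum>i\<in>I. kk i)" unfolding sum_kk I(4) .
  consider (same) "dprod I a kk b f = dprod I a kk b g" | (prod) "dprod I a kk b f * dprod I a kk b g = \<alpha> ^ 2"
    using dprod_share_cases[OF f' g' I(1,2) b \<alpha> small_f small_g d] share unfolding dprod by blast
  then show ?thesis
  proof cases
    case prod
    \<comment> \<open>The bounds of \<open>multiplicity_bounds\<close>. Twice the sum of reciprocals
      is \<open>9/10 < 1\<close> for \<open>l = 2\<close>, \<open>3/2 < 2\<close> for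
      \<open>l = 3\<close>, and \<open>2 * l / 3 < l - 1\<close> for \<open>l \<ge> 4\<close>, where
      multiplicity 3 already suffices.\<close>
    define mm :: "nat \<Rightarrow> real" where
      "mm i = (if l = 2 then if i = 1 then 4 else 5 else if l = 3 then 4 else 3)" for i
    have mm: "mm i \<le> real m"
      if "i \<in> I" "m > 0" "q > 0" "(kk i + 1) * m = ((\<Sum>i\<in>I. kk i) + 1) * q + 2" for i m q
    proof -
      have eq: "(kk i + 1) * m = (n + k + 1) * q + 2" using that(4) unfolding sum_kk .
      note mb = multiplicity_bounds[OF that(3,2) ii k1 eq]
      show ?thesis
      proof (cases "i = 1")
        case True
        then have "kk i = n" by (simp add: kk_def)
        then show ?thesis using mb(1,2) iii iv True by (auto simp: mm_def)
      next
        case False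
        then have i2: "i \<in> {2..l}" using that(1) by (auto simp: I_def)
        have kki: "kk i = ks i" "ks i \<le> k" using kk2[OF i2] ks_le[OF i2] by auto
        consider "l = 2" | "l = 3" | "l \<ge> 4" using l by linarith
        then show ?thesis
        proof cases
          case 1
          then have "kk i = k" using kki i2 by (simp add: k)
          then show ?thesis using mb(5) iii 1 False by (simp add: mm_def)
        next
          case 2
          then have "i \<in> {2, 3}" using i2 by auto
          then have "int n \<noteq> 3 * int (ks i) - int k" using iv 2 by blast
          then have "n + k \<noteq> 3 * kk i" using kki by linarith
          then show ?thesis using mb(4) kki 2 by (simp add: mm_def)
        next
          case 3
          then show ?thesis using mb(3) kki by (simp add: mm_def)
        qed
      qed
    qed
    have sum_mm: "2 * (\<Sum>i\<in>I. 1 / mm i) < real (card I) - 1"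
    proof -
      consider "l = 2" | "l = 3" | "l \<ge> 4" using l by linarith
      then show ?thesis
      proof cases
        case 1
        then have "I = {1, 2}" by (auto simp: I_def)
        then show ?thesis using 1 by (simp add: mm_def)
      next
        case 2
        then show ?thesis using I(4) by (simp add: mm_def)
      next
        case 3
        then show ?thesis using I(4) by (simp add: mm_def)
      qed
    qed
    have mm_pos: "mm i > 0" for i by (simp add: mm_def)
    have False
      by (rule dprod_product_contradiction[OF f' g' I(1-3) b kk_pos \<alpha> small_f prod mm_pos mm sum_mm])
    then show ?thesis ..
  next
    case same
    have "fls_deriv (poly_comp P f) = fls_deriv (poly_comp P g)"
      unfolding deriv_poly_comp dprod by (rule same)
    then obtain c where c: "poly_comp P f = fls_const c + poly_comp P g"
      unfolding fls_deriv_eq_iff_ex by blast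
    have "[:- a 1, 1:] ^ n dvd pderiv P" unfolding dP by (intro dvd_smult dvd_triv_left)
    moreover have "pderiv P \<noteq> 0" "degree (pderiv P) = n + k"
      unfolding dP' using degree_prod_linear_powers[OF b, where I = I and a = a and k = kk] I(1) sum_kk by simp_all
    ultimately obtain R where R: "P - [:poly P (a 1):] = [:- a 1, 1:] ^ Suc n * R" "R \<noteq> 0"
        "n + degree R = n + k"
      using pderiv_multiplicity_factor[of "a 1" n P] by metis
    \<comment> \<open>\<open>degree R = k\<close>, so (ii) is the degree condition on
      \<open>R\<close> at the root \<open>a 1\<close>.\<close>
    have "c = 0" using poly_comp_eq_plus_const[OF f' g' c R(1,2)] R(3) ii by simp
    then have "poly_comp P f = poly_comp P g" using c by simp
    moreover have "f \<in> nonconstant_mero" "g \<in> nonconstant_mero"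
      using f' g' by (auto simp: nonconstant_mero_def)
    ultimately show ?thesis using uniq unfolding uniqueness_poly_def by blast
  qed
qed

end
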